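(* Let $d\ge2$, $1\le q<p\le\infty$, $1\le\theta\le\infty$, and let $\boldsymbol r\in\mathbb R^d$ satisfy $0<r_1=\dots=r_\nu<r_{\nu+1}\le\dots\le r_d$ for some $1\le\nu\le d$. Put $\boldsymbol\gamma=\boldsymbol r/r_1$, and let $\boldsymbol\gamma'\in\mathbb R^d$ satisfy $\gamma'_j=\gamma_j=1$ for $j=1,\dots,\nu$ and $1<\gamma'_j<\gamma_j$ for $j=\nu+1,\dots,d$. Then $$\mathscr E_{Q_n^{\boldsymbol\gamma'}}(B^{\boldsymbol r}_{p,\theta})_{B_{q,1}}\asymp E_{Q_n^{\boldsymbol\gamma'}}(B^{\boldsymbol r}_{p,\theta})_{B_{q,1}}\asymp 2^{-nr_1}\,n^{(\nu-1)\left(1-\frac1\theta\right)},\qquad n\in\mathbb N.$$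
   Context: Functions are complex-valued, $2\pi$-periodic in each of $d$ variables; $\|\cdot\|_p$ is the $L_p(\mathbb T^d)$ norm with respect to $(2\pi)^{-d}d\boldsymbol x$ on $\mathbb T^d=[0,2\pi)^d$ (essential supremum for $p=\infty$). $L_p^0=\{f\in L_p(\mathbb T^d):\int_0^{2\pi}f(\boldsymbol x)\,dx_j=0\text{ a.e.},\ j=1,\dots,d\}$. $(\boldsymbol x,\boldsymbol y)=\sum_j x_jy_j$. $1/\theta:=0$ for $\theta=\infty$. Blocks. For $\boldsymbol s\in\mathbb N^d$ ($\mathbb N=\{1,2,\dots\}$), $\rho(\boldsymbol s)=\{\boldsymbol k\in\mathbb Z^d:2^{s_j-1}\le|k_j|<2^{s_j},\ j=1,\dots,d\}$ and $\delta_{\boldsymbol s}(f)=\sum_{\boldsymbol k\in\rho(\boldsymbol s)}\widehat f(\boldsymbol k)e^{i(\boldsymbol k,\boldsymbol x)}$, with $\widehat f(\boldsymbol k)=(2\pi)^{-d}\int_{\mathbb T^d}f(\boldsymbol t)e^{-i(\boldsymbol k,\boldsymbol t)}d\boldsymbol t$. De la Vallée-Poussin kernel: $V_l(t)=1+2\sum_{k=1}^l\cos kt+2\sum_{k=l+1}^{2l-1}\left(1-\frac{k-l}{l}\right)\cos kt$ (last sum is zero for $l=1$). Put $a_1=V_2-1$, $a_s=V_{2^s}-V_{2^{s-1}}$ for $s\ge2$, $A_{\boldsymbol s}(\boldsymbol x)=\prod_{j=1}^d a_{s_j}(x_j)$, and $A_{\boldsymbol s}(f)=f*A_{\boldsymbol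 s}$ (convolution with respect to $(2\pi)^{-d}d\boldsymbol x$). Class $B^{\boldsymbol r}_{p,\theta}$: the set of $f\in L_p^0$ with $\|f\|_{B^{\boldsymbol r}_{p,\theta}}\le1$, where $\|f\|_{B^{\boldsymbol r}_{p,\theta}}=\left(\sum_{\boldsymbol s\in\mathbb N^d}2^{(\boldsymbol s,\boldsymbol r)\theta}\|\beta_{\boldsymbol s}(f)\|_p^\theta\right)^{1/\theta}$ for $\theta<\infty$ and $\sup_{\boldsymbol s}2^{(\boldsymbol s,\boldsymbol r)}\|\beta_{\boldsymbol s}(f)\|_p$ for $\theta=\infty$, with $\beta_{\boldsymbol s}=\delta_{\boldsymbol s}$ if $1<p<\infty$ and $\beta_{\boldsymbol s}=A_{\boldsymbol s}$ if $p\in\{1,\infty\}$. Space $B_{q,1}$ ($1\le q\le\infty$): all $f\in L_q^0$ with $\|f\|_{B_{q,1}}:=\sum_{\boldsymbol s\in\mathbb N^d}\|A_{\boldsymbol s}(f)\|_q<\infty$. Approximation quantities. For a vector $\boldsymbol\beta\in\mathbb R^d$ with positive coordinates, $Q_n^{\boldsymbol\beta}=\bigcup_{\boldsymbol s\in\mathbb N^d,\ (\boldsymbol s,\boldsymbol\beta)<n}\rho(\boldsymbol s)$; $T(Q_n^{\boldsymbol\beta})$ is the set of trigonometric polynomials $\sum_{\boldsymbol k\in Q_n^{\boldsymbol\beta}}c_{\boldsymbol k}e^{i(\boldsymbol k,\boldsymbol x)}$, $c_{\boldsymbol k}\in\mathbb C$; $S_{Q_n^{\boldsymbol\beta}}(f)=\sum_{\boldsymbol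 k\in Q_n^{\boldsymbol\beta}}\widehat f(\boldsymbol k)e^{i(\boldsymbol k,\boldsymbol x)}$. For a class $F$ in a normed space $\mathscr X$: $E_{Q_n^{\boldsymbol\beta}}(F)_{\mathscr X}=\sup_{f\in F}\inf_{t\in T(Q_n^{\boldsymbol\beta})}\|f-t\|_{\mathscr X}$ and $\mathscr E_{Q_n^{\boldsymbol\beta}}(F)_{\mathscr X}=\sup_{f\in F}\|f-S_{Q_n^{\boldsymbol\beta}}(f)\|_{\mathscr X}$. $a(n)\asymp b(n)$ means that there are constants $C_1,C_2>0$ independent of $n$ with $C_1a(n)\le b(n)\le C_2a(n)$ (the constants may depend on $d$ and all other fixed parameters). *)

theory Defs
  imports "HOL-Probability.Probability"
begin

text \<open>
  A point of d-dimensional space is a function on the index set \<open>{1..d}\<close>, extended by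
  \<open>undefined\<close>; likewise for integer frequency vectors and for block indices.
\<close>

definition dot :: "nat \<Rightarrow> (nat \<Rightarrow> real) \<Rightarrow> (nat \<Rightarrow> real) \<Rightarrow> real" where
  "dot d x y = (\<Sum>j=1..d. x j * y j)"

text \<open>
  The normalised measure \<open>(2\<pi>)\<^sup>-\<^sup>d dx\<close> on \<open>[0,2\<pi>)\<^sup>d\<close>, as a probability measure on the whole
  of d-dimensional space that is concentrated on the cube.
\<close>
definition torus :: "nat \<Rightarrow> (nat \<Rightarrow> real) measure" where
  "torus d = PiM {1..d} (\<lambda>_. uniform_measure lborel {0..<2 * pi})"

definition periodic :: "nat \<Rightarrow> ((nat \<Rightarrow> real) \<Rightarrow> complex) \<Rightarrow> bool" where
  "periodic d f \<longleftrightarrow>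
     (\<forall>x \<in> {1..d} \<rightarrow>\<^sub>E UNIV. \<forall>j \<in> {1..d}. f (x(j := x j + 2 * pi)) = f x)"


section \<open>Lebesgue spaces\<close>

text \<open>Power of an extended nonnegative number with an exponent that is meant to be positive.\<close>
definition epow :: "ennreal \<Rightarrow> real \<Rightarrow> ennreal" where
  "epow x a = (if x = \<top> then \<top> else ennreal (enn2real x powr a))"

definition Lp_norm :: "nat \<Rightarrow> ennreal \<Rightarrow> ((nat \<Rightarrow> real) \<Rightarrow> complex) \<Rightarrow> ennreal" where
  "Lp_norm d p f =
     (if p = \<top> then esssup (torus d) (\<lambda>x. ennreal (norm (f x)))
      else epow (\<integral>\<^sup>+ x. ennreal (norm (f x) powr enn2real p) \<partial>torus d) (1 / enn2real p))"

definition Lp :: "nat \<Rightarrow> ennreal \<Rightarrow> ((nat \<Rightarrow> real) \<Rightarrow> complex) set" where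
  "Lp d p = {f \<in> borel_measurable (torus d). periodic d f \<and> Lp_norm d p f < \<top>}"

definition Lp0 :: "nat \<Rightarrow> ennreal \<Rightarrow> ((nat \<Rightarrow> real) \<Rightarrow> complex) set" where
  "Lp0 d p = {f \<in> Lp d p. \<forall>j \<in> {1..d}.
     AE x in torus d. (LBINT t:{0..2 * pi}. f (x(j := t))) = 0}"


section \<open>Fourier coefficients and dyadic blocks\<close>

definition character :: "nat \<Rightarrow> (nat \<Rightarrow> int) \<Rightarrow> (nat \<Rightarrow> real) \<Rightarrow> complex" where
  "character d k x = exp (\<i> * complex_of_real (dot d (\<lambda>j. of_int (k j)) x))"

definition fourier_coeff :: "nat \<Rightarrow> ((nat \<Rightarrow> real) \<Rightarrow> complex) \<Rightarrow> (nat \<Rightarrow> int) \<Rightarrow> complex" where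
  "fourier_coeff d f k =
     (LINT t|torus d. f t * exp (- \<i> * complex_of_real (dot d (\<lambda>j. of_int (k j)) t)))"

definition fourier_sum ::
    "nat \<Rightarrow> (nat \<Rightarrow> int) set \<Rightarrow> ((nat \<Rightarrow> real) \<Rightarrow> complex) \<Rightarrow> (nat \<Rightarrow> real) \<Rightarrow> complex" where
  "fourier_sum d Q f x = (\<Sum>k\<in>Q. fourier_coeff d f k * character d k x)"

definition block_indices :: "nat \<Rightarrow> (nat \<Rightarrow> nat) set" where
  "block_indices d = {1..d} \<rightarrow>\<^sub>E {1..}"

definition rho :: "nat \<Rightarrow> (nat \<Rightarrow> nat) \<Rightarrow> (nat \<Rightarrow> int) set" where
  "rho d s = {k \<in> {1..d} \<rightarrow>\<^sub>E UNIV. \<forall>j \<in> {1..d}. 2 ^ (s j - 1) \<le> \<bar>k j\<bar> \<and> \<bar>k j\<bar> < 2 ^ s j}"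

definition delta_block ::
    "nat \<Rightarrow> (nat \<Rightarrow> nat) \<Rightarrow> ((nat \<Rightarrow> real) \<Rightarrow> complex) \<Rightarrow> (nat \<Rightarrow> real) \<Rightarrow> complex" where
  "delta_block d s f = fourier_sum d (rho d s) f"

definition vallee_poussin :: "nat \<Rightarrow> real \<Rightarrow> real" where
  "vallee_poussin l t =
     1 + 2 * (\<Sum>k=1..l. cos (real k * t))
       + 2 * (\<Sum>k=l+1..2*l-1. (1 - (real k - real l) / real l) * cos (real k * t))"

definition vp_diff :: "nat \<Rightarrow> real \<Rightarrow> real" where
  "vp_diff s t =
     (if s = 1 then vallee_poussin 2 t - 1
      else vallee_poussin (2 ^ s) t - vallee_poussin (2 ^ (s - 1)) t)"

definition A_kernel :: "nat \<Rightarrow> (nat \<Rightarrow> nat) \<Rightarrow> (nat \<Rightarrow> real) \<Rightarrow> real" where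
  "A_kernel d s x = (\<Prod>j=1..d. vp_diff (s j) (x j))"

definition convolution ::
    "nat \<Rightarrow> ((nat \<Rightarrow> real) \<Rightarrow> complex) \<Rightarrow> ((nat \<Rightarrow> real) \<Rightarrow> complex) \<Rightarrow> (nat \<Rightarrow> real) \<Rightarrow> complex"
  where "convolution d f g x = (LINT y|torus d. f y * g (\<lambda>j\<in>{1..d}. x j - y j))"

definition A_block ::
    "nat \<Rightarrow> (nat \<Rightarrow> nat) \<Rightarrow> ((nat \<Rightarrow> real) \<Rightarrow> complex) \<Rightarrow> (nat \<Rightarrow> real) \<Rightarrow> complex" where
  "A_block d s f = convolution d f (\<lambda>x. complex_of_real (A_kernel d s x))"


section \<open>The class and the space\<close>

definition beta_block ::
    "nat \<Rightarrow> ennreal \<Rightarrow> (nat \<Rightarrow> nat) \<Rightarrow> ((nat \<Rightarrow> real) \<Rightarrow> complex) \<Rightarrow> (nat \<Rightarrow> real) \<Rightarrow> complex" where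
  "beta_block d p s f = (if 1 < p \<and> p < \<top> then delta_block d s f else A_block d s f)"

definition besov_norm ::
    "nat \<Rightarrow> (nat \<Rightarrow> real) \<Rightarrow> ennreal \<Rightarrow> ennreal \<Rightarrow> ((nat \<Rightarrow> real) \<Rightarrow> complex) \<Rightarrow> ennreal" where
  "besov_norm d r p \<theta> f =
     (if \<theta> = \<top> then
        (SUP s\<in>block_indices d.
           ennreal (2 powr dot d (\<lambda>j. real (s j)) r) * Lp_norm d p (beta_block d p s f))
      else
        epow (\<Sum>\<^sub>\<infinity>s\<in>block_indices d.
                ennreal (2 powr (dot d (\<lambda>j. real (s j)) r * enn2real \<theta>))
                * epow (Lp_norm d p (beta_block d p s f)) (enn2real \<theta>))
             (1 / enn2real \<theta>))"

definition besov_class ::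
    "nat \<Rightarrow> (nat \<Rightarrow> real) \<Rightarrow> ennreal \<Rightarrow> ennreal \<Rightarrow> ((nat \<Rightarrow> real) \<Rightarrow> complex) set" where
  "besov_class d r p \<theta> = {f \<in> Lp0 d p. besov_norm d r p \<theta> f \<le> 1}"

text \<open>
  The norm of \<open>B\<^sub>q\<^sub>,\<^sub>1\<close>, extended by \<open>\<infinity>\<close> to all functions, so that the space itself is the set
  of functions of finite norm.
\<close>
definition Bq1_norm :: "nat \<Rightarrow> ennreal \<Rightarrow> ((nat \<Rightarrow> real) \<Rightarrow> complex) \<Rightarrow> ennreal" where
  "Bq1_norm d q f =
     (if f \<in> Lp0 d q then (\<Sum>\<^sub>\<infinity>s\<in>block_indices d. Lp_norm d q (A_block d s f)) else \<top>)"


section \<open>Approximation quantities\<close>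

definition hyp_cross :: "nat \<Rightarrow> (nat \<Rightarrow> real) \<Rightarrow> nat \<Rightarrow> (nat \<Rightarrow> int) set" where
  "hyp_cross d \<beta> n =
     (\<Union>s\<in>{s \<in> block_indices d. dot d (\<lambda>j. real (s j)) \<beta> < real n}. rho d s)"

text \<open>
  In the next three definitions the finite set \<open>Q\<close> of frequencies is arbitrary, and \<open>N\<close> is the
  (extended) norm of the ambient space.
\<close>
definition trig_polys :: "nat \<Rightarrow> (nat \<Rightarrow> int) set \<Rightarrow> ((nat \<Rightarrow> real) \<Rightarrow> complex) set" where
  "trig_polys d Q = {t. \<exists>c. t = (\<lambda>x. \<Sum>k\<in>Q. c k * character d k x)}"

definition best_approx ::
    "nat \<Rightarrow> (((nat \<Rightarrow> real) \<Rightarrow> complex) \<Rightarrow> ennreal) \<Rightarrow> (nat \<Rightarrow> int) set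
      \<Rightarrow> ((nat \<Rightarrow> real) \<Rightarrow> complex) set \<Rightarrow> ennreal" where
  "best_approx d N Q F = (SUP f\<in>F. INF t\<in>trig_polys d Q. N (\<lambda>x. f x - t x))"

definition fourier_approx ::
    "nat \<Rightarrow> (((nat \<Rightarrow> real) \<Rightarrow> complex) \<Rightarrow> ennreal) \<Rightarrow> (nat \<Rightarrow> int) set
      \<Rightarrow> ((nat \<Rightarrow> real) \<Rightarrow> complex) set \<Rightarrow> ennreal" where
  "fourier_approx d N Q F = (SUP f\<in>F. N (\<lambda>x. f x - fourier_sum d Q f x))"

text \<open>
  Two-sided estimate, uniform over all \<open>n \<ge> 1\<close> (not only eventually, unlike Landau's \<open>\<Theta>\<close>). As the
  constants are real, it also forces the two sides to be finite at the same \<open>n\<close>.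
\<close>
definition same_order :: "(nat \<Rightarrow> ennreal) \<Rightarrow> (nat \<Rightarrow> ennreal) \<Rightarrow> bool"  (infix "\<asymp>" 50) where
  "a \<asymp> b \<longleftrightarrow> (\<exists>C1 C2 :: real. C1 > 0 \<and> C2 > 0 \<and>
     (\<forall>n\<ge>1. ennreal C1 * a n \<le> b n \<and> b n \<le> ennreal C2 * a n))"

end

theory Submission
  imports Defs "HOL-Library.Real_Mod"
begin

text \<open>
  Upper bound. The block \<open>A\<^sub>s\<close> of the remainder \<open>f - S\<^sub>Q f\<close> is a sum of at most \<open>2\<^sup>d\<close> dyadic pieces of
  \<open>A\<^sub>s f\<close>, namely those in blocks outside the cross. For \<open>p < \<infinity>\<close> such a piece is \<open>A\<^sub>s\<close> applied to a
  \<open>\<delta>\<close>-block, and \<open>A\<^sub>s\<close> is bounded on \<open>L\<^sub>q\<close> since it is a combination of Fejer means. For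
  \<open>p = \<infinity>\<close> it is a dyadic projection of \<open>A\<^sub>s f\<close>, which is bounded on \<open>L\<^sub>2\<^sub>m\<close> for any even \<open>2m \<ge> q\<close> by
  M. Riesz's theorem. In both cases Hoelder's inequality reduces the claim to the sums
  \<open>\<Sum> 2\<^bsup>-\<tau>(s,r)\<^esup>\<close> over \<open>(s,\<gamma>') \<ge> n\<close>, which are at most of order \<open>2\<^bsup>-\<tau>nr\<^sub>1\<^esup> n\<^bsup>\<nu>-1\<^esup>\<close>.

  Lower bound. Take one exponential of equal amplitude in each of about \<open>n\<^bsup>\<nu>-1\<^esup>\<close> blocks with
  \<open>s\<^sub>1 + \<dots> + s\<^sub>\<nu> = n + \<nu>\<close> and \<open>s\<^sub>j = 1\<close> for \<open>j > \<nu>\<close>. On these blocks \<open>A\<^sub>s\<close> annihilates every polynomial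
  with frequencies in the cross, so subtracting one does not change the corresponding part of
  the \<open>B\<^sub>q\<^sub>,\<^sub>1\<close> norm.
\<close>

section \<open>Integration over the circle\<close>

text \<open>The hypothesis \<open>q < p\<close> rules out \<open>p = 1\<close> and makes
  \<open>q\<close> finite, so the class is measured by \<open>A\<close>-blocks only when
  \<open>p = \<top>\<close>. Sharp dyadic projections are not uniformly bounded on
  \<open>L_1\<close> or \<open>L_\<infinity>\<close>. For finite \<open>p\<close> none has to be
  estimated, because the class norm already contains the \<open>\<delta>\<close>-blocks; for
  \<open>p = \<top>\<close> an even exponent between \<open>q\<close> and infinity supplies a space
  where they are bounded. All multipliers are products of one-variable multipliers. They are
  therefore studied on the circle, on polynomials only, and lifted by integrating over one variable
  at a time. Fejer means are averages over a finite grid of translates, so Jensen's inequality for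
  finite sums does the work of a convolution inequality. The strict inequality
  \<open>\<gamma>' < \<gamma>\<close> beyond coordinate \<open>\<nu>\<close> yields extra geometric
  decay there; hence only the first \<open>\<nu>\<close> coordinates feed the power of
  \<open>n\<close>. In the lower bound each relevant block of the extremal function is a single
  exponential. Its modulus is constant, so its norm is the same for every exponent, and neither
  \<open>p\<close> nor \<open>q\<close> enters the rate.\<close>

definition circle :: "real measure" where
  "circle = uniform_measure lborel {0..<2 * pi}"

lemma prob_space_circle: "prob_space circle"
  unfolding circle_def by (rule prob_space_uniform_measure) auto

lemma sets_circle [measurable_cong, simp]: "sets circle = sets borel"
  by (simp add: circle_def)

lemma space_circle [simp]: "space circle = UNIV"
  by (simp add: circle_def)

lemma nn_integral_circle:
  fixes f :: "real \<Rightarrow> ennreal"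
  assumes [measurable]: "f \<in> borel_measurable borel"
  shows "(\<integral>\<^sup>+ t. f t \<partial>circle) = (\<integral>\<^sup>+ t. f t * indicator {0..<2*pi} t \<partial>lborel) / ennreal (2*pi)"
  unfolding circle_def by (subst nn_integral_uniform_measure) auto

text \<open>The shift moves the window to \<open>[\<tau>, 2 pi + \<tau>)\<close>, and the part
  beyond \<open>2 pi\<close> is carried back by one period. Shifts below \<open>2 pi\<close> cover
  the grid points that represent Fejer means.\<close>

lemma nn_integral_circle_shift:
  fixes f :: "real \<Rightarrow> ennreal"
  assumes [measurable]: "f \<in> borel_measurable borel"
    and per: "\<And>t. f (t + 2 * pi) = f t" and \<tau>: "0 \<le> \<tau>" "\<tau> < 2 * pi"
  shows "(\<integral>\<^sup>+ t. f (t + \<tau>) \<partial>circle) = (\<integral>\<^sup>+ t. f t \<partial>circle)"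
proof -
  have "(\<integral>\<^sup>+ t. f (t + \<tau>) * indicator {0..<2*pi} t \<partial>lborel)
      = (\<integral>\<^sup>+ t. f t * indicator {\<tau>..<2*pi+\<tau>} t \<partial>lborel)"
    by (subst nn_integral_real_affine[where c=1 and t=\<tau> and f="\<lambda>t. f t * indicator {\<tau>..<2*pi+\<tau>} t"])
       (auto intro!: nn_integral_cong simp: indicator_def add_ac)
  also have "\<dots> = (\<integral>\<^sup>+ t. f t * indicator {\<tau>..<2*pi} t + f t * indicator {2*pi..<2*pi+\<tau>} t \<partial>lborel)"
    using \<tau> by (intro nn_integral_cong) (auto simp: indicator_def)
  also have "\<dots> = (\<integral>\<^sup>+ t. f t * indicator {\<tau>..<2*pi} t \<partial>lborel)
      + (\<integral>\<^sup>+ t. f t * indicator {2*pi..<2*pi+\<tau>} t \<partial>lborel)"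
    by (rule nn_integral_add) auto
  also have "(\<integral>\<^sup>+ t. f t * indicator {2*pi..<2*pi+\<tau>} t \<partial>lborel)
      = (\<integral>\<^sup>+ t. f t * indicator {0..<\<tau>} t \<partial>lborel)"
    by (subst nn_integral_real_affine[where c=1 and t="2*pi"])
       (auto intro!: nn_integral_cong simp: indicator_def per add.commute[of "2*pi"])
  also have "(\<integral>\<^sup>+ t. f t * indicator {\<tau>..<2*pi} t \<partial>lborel) + (\<integral>\<^sup>+ t. f t * indicator {0..<\<tau>} t \<partial>lborel)
      = (\<integral>\<^sup>+ t. f t * indicator {\<tau>..<2*pi} t + f t * indicator {0..<\<tau>} t \<partial>lborel)"
    by (rule nn_integral_add[symmetric]) auto
  also have "\<dots> = (\<integral>\<^sup>+ t. f t * indicator {0..<2*pi} t \<partial>lborel)"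
    using \<tau> by (intro nn_integral_cong) (auto simp: indicator_def)
  finally show ?thesis
    by (simp add: nn_integral_circle)
qed

lemma integral_circle:
  fixes f :: "real \<Rightarrow> complex"
  assumes [measurable]: "f \<in> borel_measurable borel"
  shows "(LINT t|circle. f t) = (LBINT t:{0..2*pi}. f t) / (2 * pi)"
proof -
  have eq: "circle = density lborel (\<lambda>t. ennreal (indicator {0..<2*pi} t / (2*pi)))"
    unfolding circle_def uniform_measure_def
    by (intro density_cong)
       (auto simp: indicator_def divide_ennreal[symmetric] simp flip: ennreal_1)
  have "(LINT t|circle. f t) = (LBINT t. (indicator {0..<2*pi} t / (2*pi)) *\<^sub>R f t)"
    unfolding eq by (rule integral_density) auto
  \<comment> \<open>The endpoint \<open>2 pi\<close> is a null set. The closed interval is the form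
    to which the fundamental theorem of calculus applies.\<close>
  also have "\<dots> = (LBINT t. (indicator {0..2*pi} t / (2*pi)) *\<^sub>R f t)"
    by (rule integral_discrete_difference[where X="{2*pi}"]) (auto simp: indicator_def)
  also have "\<dots> = (LBINT t. (indicator {0..2*pi} t *\<^sub>R f t) / complex_of_real (2*pi))"
    by (intro Bochner_Integration.integral_cong) (auto simp: scaleR_conv_of_real)
  finally show ?thesis
    by (simp add: set_lebesgue_integral_def)
qed

lemma set_integral_cis:
  "set_integrable lborel {0..2*pi} (\<lambda>t. cis (of_int k * t))"
  "(LBINT t:{0..2*pi}. cis (of_int k * t)) = (if k = 0 then complex_of_real (2 * pi) else 0)"
proof -
  show int: "set_integrable lborel {0..2*pi} (\<lambda>t. cis (of_int k * t))"
    by (rule borel_integrable_atLeastAtMost') (intro continuous_intros)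
  show "(LBINT t:{0..2*pi}. cis (of_int k * t)) = (if k = 0 then complex_of_real (2 * pi) else 0)"
  proof (cases "k = 0")
    case True
    then show ?thesis by (simp add: set_lebesgue_integral_def scaleR_conv_of_real)
  next
    case False
    define F where "F = (\<lambda>t. cis (of_int k * t) / (\<i> * of_int k))"
    have "(F has_vector_derivative cis (of_int k * t)) (at t within {0..2*pi})" for t
      unfolding F_def cis_conv_exp using False
      by (auto intro!: derivative_eq_intros has_vector_derivative_real_field simp: field_simps)
    then have "(LBINT t. indicator {0..2*pi} t *\<^sub>R cis (of_int k * t)) = F (2*pi) - F 0"
      by (intro integral_FTC_Icc continuous_intros) auto
    moreover have "cis (of_int k * (2 * pi)) = 1"
      using cis_multiple_2pi[of "of_int k"] by (simp add: mult.commute)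
    ultimately show ?thesis
      using False by (simp add: set_lebesgue_integral_def F_def)
  qed
qed

lemma integral_circle_cis:
  "(LINT t|circle. cis (of_int k * t)) = (if k = 0 then 1 else 0)"
proof -
  have "(\<lambda>t. cis (of_int k * t)) \<in> borel_measurable borel"
    by (intro borel_measurable_continuous_onI continuous_intros)
  from integral_circle[OF this] show ?thesis by (simp add: set_integral_cis)
qed

lemma borel_measurable_cis [measurable (raw)]:
  assumes [measurable]: "f \<in> borel_measurable M"
  shows "(\<lambda>x. cis (f x)) \<in> borel_measurable M"
proof -
  have "cis \<in> borel_measurable borel"
    by (intro borel_measurable_continuous_onI continuous_intros)
  from measurable_compose[OF assms this] show ?thesis .
qed

lemma integrable_circle_bounded:
  fixes f :: "real \<Rightarrow> 'b::{banach, second_countable_topology}"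
  assumes "f \<in> borel_measurable borel" "\<And>t. norm (f t) \<le> B"
  shows "integrable circle f"
proof -
  interpret prob_space circle by (rule prob_space_circle)
  show ?thesis using assms by (intro integrable_const_bound[of _ B]) auto
qed

section \<open>Bounded multipliers\<close>

text \<open>Compared with the open half-line, only the endpoint 0 needs an argument: there convexity
  reduces to \<open>v powr p \<le> v\<close> for \<open>0 < v < 1\<close>. Zero is included because
  Jensen is applied to moduli of polynomials, which may vanish.\<close>

lemma powr_convex_nonneg:
  assumes "p \<ge> 1" shows "convex_on {0..} (\<lambda>x::real. x powr p)"
proof (rule convex_onI)
  fix t x y :: real
  assume t: "0 < t" "t < 1" and xy: "x \<in> {0..}" "y \<in> {0..}"
  have le: "v powr p \<le> v" if "0 < v" "v < 1" for v :: real
    using powr_mono'[of 1 p v] that assms by simp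
  consider "x = 0" | "y = 0" | "x > 0" "y > 0" using xy by fastforce
  then show "((1 - t) *\<^sub>R x + t *\<^sub>R y) powr p \<le> (1 - t) * x powr p + t * y powr p"
  proof cases
    case 1
    then show ?thesis using xy t le[of t]
      by (auto simp: powr_mult intro!: mult_right_mono)
  next
    case 2
    then show ?thesis using xy t le[of "1 - t"]
      by (auto simp: powr_mult intro!: mult_right_mono)
  next
    case 3
    then show ?thesis using powr_convex[OF assms] t by (auto simp: convex_on_def)
  qed
qed auto

definition trig :: "'i set \<Rightarrow> ('i \<Rightarrow> int) \<Rightarrow> ('i \<Rightarrow> complex) \<Rightarrow> real \<Rightarrow> complex" where
  "trig I \<kappa> c t = (\<Sum>i\<in>I. c i * cis (of_int (\<kappa> i) * t))"

lemma trig_measurable [measurable]: "trig I \<kappa> c \<in> borel_measurable borel"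
  unfolding trig_def by measurable

lemma trig_periodic: "trig I \<kappa> c (t + 2 * pi) = trig I \<kappa> c t"
proof -
  have "cis (of_int (\<kappa> i) * (t + 2 * pi)) = cis (of_int (\<kappa> i) * t)" for i
    using cis_multiple_2pi[of "of_int (\<kappa> i)"]
    by (simp add: distrib_left cis_mult[symmetric] mult_ac)
  then show ?thesis by (simp add: trig_def)
qed

lemma trig_bounded: "norm (trig I \<kappa> c t) \<le> (\<Sum>i\<in>I. norm (c i))"
  unfolding trig_def by (rule sum_norm_le) (simp add: norm_mult)

text \<open>
  The frequencies \<open>\<kappa> i\<close> need not be distinct: a polynomial in \<open>d\<close> variables, seen as a function of one
  of them, has this form with \<open>I\<close> its set of frequency vectors.
\<close>
definition mult_bdd :: "real \<Rightarrow> (int \<Rightarrow> complex) \<Rightarrow> real \<Rightarrow> bool" where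
  "mult_bdd q m C \<longleftrightarrow> 0 \<le> C \<and>
     (\<forall>(I :: (nat \<Rightarrow> int) set) \<kappa> c. finite I \<longrightarrow>
       (\<integral>\<^sup>+ t. ennreal (norm (trig I \<kappa> (\<lambda>i. m (\<kappa> i) * c i) t) powr q) \<partial>circle)
         \<le> ennreal C * (\<integral>\<^sup>+ t. ennreal (norm (trig I \<kappa> c t) powr q) \<partial>circle))"

lemma norm_add_powr_le:
  fixes x y :: "'a::real_normed_vector"
  assumes "1 \<le> q"
  shows "norm (x + y) powr q \<le> 2 powr q * (norm x powr q + norm y powr q)"
proof -
  have "norm (x + y) powr q \<le> (2 * max (norm x) (norm y)) powr q"
    using assms norm_triangle_ineq[of x y] by (intro powr_mono2) auto
  also have "\<dots> = 2 powr q * max (norm x) (norm y) powr q" by (simp add: powr_mult)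
  also have "\<dots> \<le> 2 powr q * (norm x powr q + norm y powr q)"
    by (intro mult_left_mono) (auto simp: max_def)
  finally show ?thesis .
qed

text \<open>The constants bound q-th powers of norms, so a sum costs a factor
  \<open>2 powr q\<close> and the pointwise inequality is enough; Minkowski's inequality does not
  enter.\<close>

lemma mult_bdd_add:
  assumes "1 \<le> q" "mult_bdd q m C" "mult_bdd q m' C'"
  shows "mult_bdd q (\<lambda>k. m k + m' k) (2 powr q * (C + C'))"
  unfolding mult_bdd_def
proof (intro conjI allI impI)
  show "0 \<le> 2 powr q * (C + C')" using assms by (auto simp: mult_bdd_def)
  fix I :: "(nat \<Rightarrow> int) set" and \<kappa> c assume I: "finite I"
  let ?N = "\<lambda>m. \<integral>\<^sup>+ t. ennreal (norm (trig I \<kappa> (\<lambda>i. m (\<kappa> i) * c i) t) powr q) \<partial>circle"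
  let ?X = "\<integral>\<^sup>+ t. ennreal (norm (trig I \<kappa> c t) powr q) \<partial>circle"
  have "?N (\<lambda>k. m k + m' k) \<le> (\<integral>\<^sup>+ t. ennreal (2 powr q) *
      (ennreal (norm (trig I \<kappa> (\<lambda>i. m (\<kappa> i) * c i) t) powr q)
        + ennreal (norm (trig I \<kappa> (\<lambda>i. m' (\<kappa> i) * c i) t) powr q)) \<partial>circle)"
  proof (intro nn_integral_mono)
    fix t
    have "trig I \<kappa> (\<lambda>i. (m (\<kappa> i) + m' (\<kappa> i)) * c i) t
        = trig I \<kappa> (\<lambda>i. m (\<kappa> i) * c i) t + trig I \<kappa> (\<lambda>i. m' (\<kappa> i) * c i) t"
      by (simp add: trig_def sum.distrib algebra_simps)
    then show "ennreal (norm (trig I \<kappa> (\<lambda>i. (m (\<kappa> i) + m' (\<kappa> i)) * c i) t) powr q)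
      \<le> ennreal (2 powr q) * (ennreal (norm (trig I \<kappa> (\<lambda>i. m (\<kappa> i) * c i) t) powr q)
        + ennreal (norm (trig I \<kappa> (\<lambda>i. m' (\<kappa> i) * c i) t) powr q))"
      using norm_add_powr_le[OF assms(1)]
      by (simp flip: ennreal_plus ennreal_mult)
  qed
  also have "\<dots> = ennreal (2 powr q) * (?N m + ?N m')"
    by (subst nn_integral_cmult, measurable, subst nn_integral_add, auto)
  also have "\<dots> \<le> ennreal (2 powr q) * (ennreal C * ?X + ennreal C' * ?X)"
    using assms I by (intro mult_left_mono add_mono) (auto simp: mult_bdd_def)
  also have "\<dots> = ennreal (2 powr q * (C + C')) * ?X"
    using assms by (auto simp: mult_bdd_def ennreal_mult ennreal_plus algebra_simps)
  finally show "?N (\<lambda>k. m k + m' k) \<le> ennreal (2 powr q * (C + C')) * ?X" .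
qed

lemma mult_bdd_scale:
  assumes "mult_bdd q m C"
  shows "mult_bdd q (\<lambda>k. a * m k) (norm a powr q * C)"
  unfolding mult_bdd_def
proof (intro conjI allI impI)
  show "0 \<le> norm a powr q * C" using assms by (auto simp: mult_bdd_def)
  fix I :: "(nat \<Rightarrow> int) set" and \<kappa> c assume I: "finite I"
  have "trig I \<kappa> (\<lambda>i. a * m (\<kappa> i) * c i) t = a * trig I \<kappa> (\<lambda>i. m (\<kappa> i) * c i) t" for t
    by (simp add: trig_def sum_distrib_left mult_ac)
  then have "(\<integral>\<^sup>+ t. ennreal (norm (trig I \<kappa> (\<lambda>i. a * m (\<kappa> i) * c i) t) powr q) \<partial>circle)
     = ennreal (norm a powr q) * (\<integral>\<^sup>+ t. ennreal (norm (trig I \<kappa> (\<lambda>i. m (\<kappa> i) * c i) t) powr q) \<partial>circle)"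
    by (subst nn_integral_cmult[symmetric]) (auto simp: norm_mult powr_mult ennreal_mult)
  also have "\<dots> \<le> ennreal (norm a powr q) * (ennreal C * (\<integral>\<^sup>+ t. ennreal (norm (trig I \<kappa> c t) powr q) \<partial>circle))"
    using assms I by (intro mult_left_mono) (auto simp: mult_bdd_def)
  finally show "(\<integral>\<^sup>+ t. ennreal (norm (trig I \<kappa> (\<lambda>i. a * m (\<kappa> i) * c i) t) powr q) \<partial>circle)
     \<le> ennreal (norm a powr q * C) * (\<integral>\<^sup>+ t. ennreal (norm (trig I \<kappa> c t) powr q) \<partial>circle)"
    using assms by (auto simp: mult_bdd_def ennreal_mult mult_ac)
qed

text \<open>The Fourier coefficients of the Fejer kernel, which is the squared modulus of the sum of
  \<open>cis (a * t)\<close> over \<open>a < N\<close>, divided by \<open>N\<close>.\<close>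

definition fejer :: "nat \<Rightarrow> int \<Rightarrow> real" where
  "fejer N k = max 0 (1 - \<bar>of_int k\<bar> / real N)"

text \<open>A geometric sum. The bound on \<open>j\<close> excludes the nonzero multiples of
  \<open>M\<close>, which would alias to frequency 0 on the grid.\<close>

lemma sum_roots_of_unity:
  assumes "M > 0" "\<bar>j\<bar> < int M"
  shows "(\<Sum>l<M. cis (of_int j * (2 * pi * real l / real M))) = (if j = 0 then of_nat M else 0)"
proof (cases "j = 0")
  case False
  define z where "z = cis (of_int j * (2 * pi / real M))"
  have z1: "z \<noteq> 1"
  proof
    assume "z = 1"
    then obtain n where "of_int j * (2 * pi / real M) = of_int n * (2 * pi)"
      unfolding z_def cis_eq_1_iff by auto
    then have "real_of_int j = of_int (n * int M)"
      using assms by (simp add: field_simps)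
    then have "j = n * int M" by linarith
    with assms False show False by (auto simp: abs_mult)
  qed
  have "real M * (of_int j * (2 * pi / real M)) = 2 * pi * of_int j"
    using assms by simp
  then have "z ^ M = cis (2 * pi * of_int j)"
    unfolding z_def Complex.DeMoivre by (rule arg_cong)
  then have zM: "z ^ M = 1" by simp
  have "(\<Sum>l<M. cis (of_int j * (2 * pi * real l / real M))) = (\<Sum>l<M. z ^ l)"
    unfolding z_def Complex.DeMoivre by (intro sum.cong arg_cong[where f=cis]) simp_all
  also have "\<dots> = 0" using z1 zM by (simp add: sum_gp_strict)
  finally show ?thesis using False by simp
qed simp

text \<open>A pair is determined by \<open>a\<close>, since \<open>b = a + k\<close>, and
  \<open>a\<close> runs through an interval of \<open>N - \<bar>k\<bar>\<close> integers, empty once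
  \<open>\<bar>k\<bar> \<ge> N\<close>.\<close>

lemma card_fejer:
  "of_nat (card {(a,b) \<in> {..<N} \<times> {..<N}. int a - int b + k = 0}) = max 0 (real N - \<bar>of_int k\<bar>)"
proof -
  have "bij_betw (\<lambda>(a,b). int a) {(a,b) \<in> {..<N} \<times> {..<N}. int a - int b + k = 0}
     {max 0 (- k)..<min (int N) (int N - k)}"
    by (rule bij_betwI[where g="\<lambda>a. (nat a, nat (a + k))"]) auto
  then have "card {(a,b) \<in> {..<N} \<times> {..<N}. int a - int b + k = 0}
     = card {max 0 (- k)..<min (int N) (int N - k)}"
    by (rule bij_betw_same_card)
  also have "\<dots> = nat (min (int N) (int N - k) - max 0 (- k))" by simp
  finally show ?thesis by linarith
qed

text \<open>
  On polynomials of bounded degree the Fejer mean is a convex combination of translates over a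
  sufficiently fine grid.
\<close>
lemma fejer_sampling:
  assumes "N > 0" "M > 0" "\<bar>k\<bar> + int N \<le> int M"
  defines "w \<equiv> \<lambda>l. (norm (\<Sum>a<N. cis (real a * (2 * pi * real l / real M))))\<^sup>2 / (real N * real M)"
  shows "(\<Sum>l<M. complex_of_real (w l) * cis (of_int k * (2 * pi * real l / real M))) = of_real (fejer N k)"
proof -
  let ?t = "\<lambda>l. 2 * pi * real l / real M"
  have sq: "complex_of_real ((norm (\<Sum>a<N. cis (real a * ?t l)))\<^sup>2)
      = (\<Sum>a<N. \<Sum>b<N. cis (real a * ?t l) * cis (- (real b * ?t l)))" for l
    unfolding complex_norm_square by (simp add: sum_product cis_cnj)
  have 1: "(\<Sum>l<M. complex_of_real (w l) * cis (of_int k * ?t l))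
    = (\<Sum>l<M. (\<Sum>a<N. \<Sum>b<N. cis (real_of_int (int a - int b + k) * ?t l))) / (of_nat N * of_nat M)"
  proof -
    have cis3: "cis (real a * t) * cis (- (real b * t)) * cis (of_int k * t) = cis (real_of_int (int a - int b + k) * t)" for a b t
      unfolding cis_mult by (rule arg_cong[where f=cis]) (simp add: algebra_simps)
    have "complex_of_real (w l) * cis (of_int k * ?t l)
       = (\<Sum>a<N. \<Sum>b<N. cis (real_of_int (int a - int b + k) * ?t l)) / (of_nat N * of_nat M)" for l
    proof -
      have "complex_of_real (w l) * cis (of_int k * ?t l)
        = (\<Sum>a<N. \<Sum>b<N. cis (real a * ?t l) * cis (- (real b * ?t l))) * cis (of_int k * ?t l) / (of_nat N * of_nat M)"
        unfolding w_def of_real_divide sq by simp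
      also have "\<dots> = (\<Sum>a<N. \<Sum>b<N. cis (real_of_int (int a - int b + k) * ?t l)) / (of_nat N * of_nat M)"
        unfolding sum_distrib_right cis3 ..
      finally show ?thesis .
    qed
    then show ?thesis by (simp only: sum_divide_distrib)
  qed
  have "(\<Sum>l<M. (\<Sum>a<N. \<Sum>b<N. cis (real_of_int (int a - int b + k) * ?t l)))
    = (\<Sum>a<N. \<Sum>b<N. \<Sum>l<M. cis (real_of_int (int a - int b + k) * ?t l))"
    by (subst sum.swap, rule sum.cong[OF refl], rule sum.swap)
  \<comment> \<open>Here \<open>\<bar>a - b + k\<bar> \<le> N - 1 + \<bar>k\<bar> < M\<close>, so
    the grid sum detects exactly the frequency 0.\<close>
  also have "\<dots> = (\<Sum>a<N. \<Sum>b<N. if int a - int b + k = 0 then of_nat M else 0)"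
    using assms by (intro sum.cong refl sum_roots_of_unity) auto
  also have "\<dots> = of_nat M * of_nat (card {(a,b) \<in> {..<N} \<times> {..<N}. int a - int b + k = 0})"
  proof -
    have "(\<Sum>a<N. \<Sum>b<N. if int a - int b + k = 0 then of_nat M else (0::complex))
      = (\<Sum>x\<in>{..<N}\<times>{..<N}. if case x of (a,b) \<Rightarrow> int a - int b + k = 0 then of_nat M else 0)"
      by (simp add: sum.cartesian_product split_def)
    also have "\<dots> = (\<Sum>x\<in>{x\<in>{..<N}\<times>{..<N}. case x of (a,b) \<Rightarrow> int a - int b + k = 0}. of_nat M)"
      by (rule sum.inter_filter[symmetric]) auto
    finally have "(\<Sum>a<N. \<Sum>b<N. if int a - int b + k = 0 then of_nat M else (0::complex))
      = of_nat (card {x\<in>{..<N}\<times>{..<N}. case x of (a,b) \<Rightarrow> int a - int b + k = 0}) * of_nat M"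
      by simp
    moreover have "{x\<in>{..<N}\<times>{..<N}. case x of (a,b) \<Rightarrow> int a - int b + k = 0}
      = {(a,b) \<in> {..<N} \<times> {..<N}. int a - int b + k = 0}" by auto
    ultimately show ?thesis by (simp only: mult.commute)
  qed
  also have "\<dots> = of_nat M * complex_of_real (max 0 (real N - \<bar>of_int k\<bar>))"
    by (simp only: card_fejer[symmetric] of_real_of_nat_eq)
  finally have 2: "(\<Sum>l<M. (\<Sum>a<N. \<Sum>b<N. cis (real_of_int (int a - int b + k) * ?t l)))
    = of_nat M * complex_of_real (max 0 (real N - \<bar>of_int k\<bar>))" .
  show ?thesis
    unfolding 1 2
  proof -
    have "max 0 (real N - \<bar>of_int k\<bar>) / real N = fejer N k"
      using assms(1) by (auto simp: fejer_def max_def field_simps)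
    then have "real M * max 0 (real N - \<bar>of_int k\<bar>) / (real N * real M) = fejer N k"
      using assms(2) by simp
    then have "complex_of_real (real M * max 0 (real N - \<bar>of_int k\<bar>) / (real N * real M)) = of_real (fejer N k)"
      by (rule arg_cong)
    then show "of_nat M * complex_of_real (max 0 (real N - \<bar>of_int k\<bar>)) / (of_nat N * of_nat M) = complex_of_real (fejer N k)"
      by (simp only: of_real_divide of_real_mult of_real_of_nat_eq)
  qed
qed

text \<open>Jensen's inequality for a convex combination of translates, together with translation
  invariance, gives the constant 1. The grid size \<open>M\<close> depends on the polynomial, the
  constant does not.\<close>

lemma mult_bdd_fejer:
  assumes N: "N > 0" and q: "1 \<le> q"
  shows "mult_bdd q (\<lambda>k. of_real (fejer N k)) 1"
  unfolding mult_bdd_def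
proof (intro conjI allI impI)
  fix I :: "(nat \<Rightarrow> int) set" and \<kappa> c assume I: "finite I"
  define M where "M = N + nat (\<Sum>i\<in>I. \<bar>\<kappa> i\<bar>)"
  have M: "M > 0" using N by (simp add: M_def)
  have MI: "\<bar>\<kappa> i\<bar> + int N \<le> int M" if "i \<in> I" for i
    using member_le_sum[of i I "\<lambda>i. \<bar>\<kappa> i\<bar>"] that I by (auto simp: M_def)
  define w where "w = (\<lambda>l. (norm (\<Sum>a<N. cis (real a * (2 * pi * real l / real M))))\<^sup>2 / (real N * real M))"
  define \<tau> where "\<tau> = (\<lambda>l. 2 * pi * real l / real M)"
  have w0: "w l \<ge> 0" for l by (simp add: w_def)
  \<comment> \<open>The sampling identity at frequency 0, where the Fejer symbol is 1, says that the
    weights sum to 1.\<close>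
  have "complex_of_real (\<Sum>l<M. w l) = of_real (fejer N 0)"
    using fejer_sampling[of N M 0] N M unfolding w_def by (simp add: M_def)
  then have w1: "(\<Sum>l<M. w l) = 1" by (simp only: of_real_eq_iff) (simp add: fejer_def)
  have \<tau>: "0 \<le> \<tau> l" "\<tau> l < 2 * pi" if "l < M" for l
    using that M by (auto simp: \<tau>_def field_simps)
  let ?g = "trig I \<kappa> c"
  have Tg: "trig I \<kappa> (\<lambda>i. of_real (fejer N (\<kappa> i)) * c i) t = (\<Sum>l<M. of_real (w l) * ?g (t + \<tau> l))" for t
  proof -
    have "(\<Sum>l<M. of_real (w l) * ?g (t + \<tau> l))
      = (\<Sum>l<M. \<Sum>i\<in>I. c i * cis (of_int (\<kappa> i) * t) * (of_real (w l) * cis (of_int (\<kappa> i) * \<tau> l)))"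
      by (simp add: trig_def sum_distrib_left distrib_left cis_mult[symmetric] mult_ac)
    also have "\<dots> = (\<Sum>i\<in>I. c i * cis (of_int (\<kappa> i) * t) * (\<Sum>l<M. of_real (w l) * cis (of_int (\<kappa> i) * \<tau> l)))"
      by (subst sum.swap) (simp add: sum_distrib_left)
    also have "\<dots> = (\<Sum>i\<in>I. c i * cis (of_int (\<kappa> i) * t) * of_real (fejer N (\<kappa> i)))"
      using fejer_sampling[OF N M MI] unfolding w_def \<tau>_def by (intro sum.cong refl) auto
    finally show ?thesis by (simp add: trig_def mult_ac)
  qed
  have pw: "norm (\<Sum>l<M. of_real (w l) * ?g (t + \<tau> l)) powr q \<le> (\<Sum>l<M. w l * norm (?g (t + \<tau> l)) powr q)" for t
  proof -
    have "norm (\<Sum>l<M. of_real (w l) * ?g (t + \<tau> l)) \<le> (\<Sum>l<M. w l *\<^sub>R norm (?g (t + \<tau> l)))"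
      using w0 by (intro sum_norm_le) (simp add: norm_mult)
    then have "norm (\<Sum>l<M. of_real (w l) * ?g (t + \<tau> l)) powr q \<le> (\<Sum>l<M. w l *\<^sub>R norm (?g (t + \<tau> l))) powr q"
      using q by (intro powr_mono2) auto
    also have "\<dots> \<le> (\<Sum>l<M. w l * norm (?g (t + \<tau> l)) powr q)"
      using w0 w1 M by (intro convex_on_sum[OF _ _ powr_convex_nonneg[OF q]]) auto
    finally show ?thesis .
  qed
  have "(\<integral>\<^sup>+ t. ennreal (norm (trig I \<kappa> (\<lambda>i. of_real (fejer N (\<kappa> i)) * c i) t) powr q) \<partial>circle)
     \<le> (\<integral>\<^sup>+ t. (\<Sum>l<M. ennreal (w l) * ennreal (norm (?g (t + \<tau> l)) powr q)) \<partial>circle)"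
    unfolding Tg using w0
    by (intro nn_integral_mono) (simp add: sum_ennreal ennreal_leI[OF pw] flip: ennreal_mult)
  also have "\<dots> = (\<Sum>l<M. ennreal (w l) * (\<integral>\<^sup>+ t. ennreal (norm (?g (t + \<tau> l)) powr q) \<partial>circle))"
    by (subst nn_integral_sum) (auto simp: nn_integral_cmult)
  also have "\<dots> = (\<Sum>l<M. ennreal (w l) * (\<integral>\<^sup>+ t. ennreal (norm (?g t) powr q) \<partial>circle))"
  proof (intro sum.cong refl arg_cong2[where f="(*)"])
    fix l assume "l \<in> {..<M}"
    then show "(\<integral>\<^sup>+ t. ennreal (norm (?g (t + \<tau> l)) powr q) \<partial>circle) = (\<integral>\<^sup>+ t. ennreal (norm (?g t) powr q) \<partial>circle)"
      using \<tau>[of l] by (intro nn_integral_circle_shift) (auto simp: trig_periodic)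
  qed
  also have "\<dots> = ennreal 1 * (\<integral>\<^sup>+ t. ennreal (norm (?g t) powr q) \<partial>circle)"
    unfolding sum_distrib_right[symmetric] using w0 w1 by (simp add: sum_ennreal)
  finally show "(\<integral>\<^sup>+ t. ennreal (norm (trig I \<kappa> (\<lambda>i. of_real (fejer N (\<kappa> i)) * c i) t) powr q) \<partial>circle)
     \<le> ennreal 1 * (\<integral>\<^sup>+ t. ennreal (norm (?g t) powr q) \<partial>circle)" .
qed simp


section \<open>Riesz projections for even exponents\<close>

text \<open>
  With \<open>e = a + cnj b\<close> one has \<open>\<bar>a\<bar>\<^sup>2 - a * cnj e = - a * b\<close>. If \<open>a\<close> and \<open>b\<close> are boundary values of
  polynomials and \<open>b\<close> vanishes at \<open>0\<close>, the \<open>m\<close>-th power of this has mean zero over the circle.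
\<close>
lemma riesz_pointwise:
  assumes "m > 0"
  obtains C where "C \<ge> 0" "\<And>a e :: complex. norm a ^ (2*m) \<le> C * norm e ^ (2*m)
      + 2 * Re ((of_real ((norm a)\<^sup>2) - a * cnj e) ^ m)"
proof -
  have "isCont (\<lambda>w::complex. Re ((1 - w) ^ m)) 0"
    by (intro isCont_Re continuous_intros)
  from LIM_D[OF isContD[OF this], of "1/2"] obtain \<delta> where \<delta>: "\<delta> > 0" and
    near': "\<forall>w. w \<noteq> 0 \<and> norm (w - 0) < \<delta> \<longrightarrow> norm (Re ((1 - w) ^ m) - Re ((1 - 0) ^ m)) < 1/2"
    by auto
  have near: "\<bar>Re ((1 - w) ^ m) - 1\<bar> < 1/2" if "norm w < \<delta>" for w
    using near'[rule_format, of w] that by (cases "w = 0") simp_all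
  define K where "K = (1 / \<delta>\<^sup>2 + 1 / \<delta>) ^ m"
  define C where "C = (1 / \<delta>) ^ (2*m) + 2 * K"
  have K: "K \<ge> 0" using \<delta> by (simp add: K_def)
  have "norm a ^ (2*m) \<le> C * norm e ^ (2*m) + 2 * Re ((of_real ((norm a)\<^sup>2) - a * cnj e) ^ m)" for a e
  \<comment> \<open>If \<open>e\<close> is small against \<open>a\<close>, the power equals
    \<open>norm a ^ (2*m) * (1 - w) ^ m\<close> with \<open>w\<close> near 0, and twice its real
    part dominates the left side. Otherwise everything is bounded by \<open>norm e ^ (2*m)\<close>;
    the summand \<open>2 * K\<close> of \<open>C\<close> absorbs a negative real part.\<close>
  proof (cases "norm e < \<delta> * norm a")
    case True
    then have a0: "a \<noteq> 0" by auto
    define w where "w = cnj (e / a)"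
    have "norm w < \<delta>" using True a0 by (simp add: w_def norm_divide field_simps)
    then have re: "Re ((1 - w) ^ m) \<ge> 1/2" using near[of w] by (simp add: abs_if split: if_splits)
    have "of_real ((norm a)\<^sup>2) - a * cnj e = of_real ((norm a)\<^sup>2) * (1 - w)"
      unfolding complex_norm_square w_def using a0 by (simp add: right_diff_distrib)
    then have "(of_real ((norm a)\<^sup>2) - a * cnj e) ^ m = of_real (norm a ^ (2*m)) * (1 - w) ^ m"
      by (simp add: power_mult_distrib power_mult)
    then have "Re ((of_real ((norm a)\<^sup>2) - a * cnj e) ^ m) = norm a ^ (2*m) * Re ((1 - w) ^ m)"
      by (simp only: Re_complex_of_real times_complex.sel Im_complex_of_real)
    moreover have "norm a ^ (2*m) * (1/2) \<le> norm a ^ (2*m) * Re ((1 - w) ^ m)"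
      using re by (intro mult_left_mono) auto
    moreover have "C * norm e ^ (2*m) \<ge> 0" using K \<delta> by (simp add: C_def)
    ultimately show ?thesis by linarith
  next
    case False
    then have ae: "norm a \<le> norm e / \<delta>" using \<delta> by (simp add: field_simps)
    have "norm (of_real ((norm a)\<^sup>2) - a * cnj e) \<le> (norm a)\<^sup>2 + norm a * norm e"
      by (rule order_trans[OF norm_triangle_ineq4]) (simp add: norm_mult norm_power)
    also have "\<dots> \<le> (norm e / \<delta>)\<^sup>2 + norm e / \<delta> * norm e"
      using ae by (intro add_mono power_mono mult_right_mono) auto
    also have "\<dots> = (norm e)\<^sup>2 * (1 / \<delta>\<^sup>2 + 1 / \<delta>)"
      by (simp add: power2_eq_square algebra_simps)
    finally have "norm (of_real ((norm a)\<^sup>2) - a * cnj e) ^ m \<le> ((norm e)\<^sup>2 * (1 / \<delta>\<^sup>2 + 1 / \<delta>)) ^ m"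
      by (intro power_mono) auto
    then have "norm ((of_real ((norm a)\<^sup>2) - a * cnj e) ^ m) \<le> K * norm e ^ (2*m)"
      by (simp add: norm_power power_mult_distrib K_def mult.commute flip: power_mult)
    then have "- Re ((of_real ((norm a)\<^sup>2) - a * cnj e) ^ m) \<le> K * norm e ^ (2*m)"
      using abs_Re_le_cmod[of "(of_real ((norm a)\<^sup>2) - a * cnj e) ^ m"] by linarith
    moreover have "norm a ^ (2*m) \<le> (1 / \<delta>) ^ (2*m) * norm e ^ (2*m)"
      using power_mono[OF ae, of "2*m"] by (simp add: power_divide)
    ultimately show ?thesis unfolding C_def by (simp add: algebra_simps)
  qed
  moreover have "C \<ge> 0" using K \<delta> by (simp add: C_def)
  ultimately show thesis using that by blast
qed

text \<open>Mean value property: every positive power of \<open>cis t\<close> integrates to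
  0.\<close>

lemma integral_circle_poly:
  "(LINT t|circle. poly P (cis t)) = poly P 0"
proof -
  interpret prob_space circle by (rule prob_space_circle)
  have "(LINT t|circle. poly P (cis t)) = (LINT t|circle. (\<Sum>i\<le>degree P. coeff P i * cis (of_int (int i) * t)))"
    unfolding poly_altdef Complex.DeMoivre by simp
  also have "\<dots> = (\<Sum>i\<le>degree P. LINT t|circle. coeff P i * cis (of_int (int i) * t))"
    by (intro Bochner_Integration.integral_sum integrable_circle_bounded[where B="norm (coeff P i)" for i])
       (auto simp: norm_mult)
  also have "\<dots> = (\<Sum>i\<le>degree P. coeff P i * (if i = 0 then 1 else 0))"
    by (simp only: integral_mult_right_zero integral_circle_cis) simp
  also have "\<dots> = poly P 0" by (simp add: poly_0_coeff_0 if_distrib cong: if_cong)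
  finally show ?thesis .
qed

text \<open>One constant serves all half-lines, since multiplication by \<open>cis (- N * t)\<close>
  preserves moduli and moves the cut to 0. Integrating the pointwise inequality then makes its last
  term vanish.\<close>

lemma mult_bdd_riesz:
  assumes m: "m > 0"
  obtains C where "\<And>N. mult_bdd (real (2*m)) (\<lambda>k. if k \<ge> N then 1 else 0) C"
proof -
  obtain C where C: "C \<ge> 0" and pw: "\<And>a e :: complex. norm a ^ (2*m) \<le> C * norm e ^ (2*m)
      + 2 * Re ((of_real ((norm a)\<^sup>2) - a * cnj e) ^ m)"
    using riesz_pointwise[OF m] by blast
  have "mult_bdd (real (2*m)) (\<lambda>k. if k \<ge> N then 1 else 0) C" for N
    unfolding mult_bdd_def
  proof (intro conjI allI impI)
    fix I :: "(nat \<Rightarrow> int) set" and \<kappa> c assume I: "finite I"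
    define I1 where "I1 = {i\<in>I. \<kappa> i \<ge> N}"
    define I2 where "I2 = {i\<in>I. \<kappa> i < N}"
    \<comment> \<open>After the modulation, \<open>a\<close> is the retained part with frequencies
      at least 0. The discarded part has strictly negative frequencies, so its conjugate
      \<open>b\<close> is a polynomial in \<open>cis t\<close> without constant term.\<close>
    define a where "a = (\<lambda>t. \<Sum>i\<in>I1. c i * cis (of_int (\<kappa> i - N) * t))"
    define b where "b = (\<lambda>t. \<Sum>i\<in>I2. cnj (c i) * cis (of_int (N - \<kappa> i) * t))"
    define PA where "PA = (\<Sum>i\<in>I1. monom (c i) (nat (\<kappa> i - N)))"
    define PB where "PB = (\<Sum>i\<in>I2. monom (cnj (c i)) (nat (N - \<kappa> i)))"
    have cis_nat: "cis (of_int k * t) = cis t ^ nat k" if "k \<ge> 0" for k t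
      unfolding Complex.DeMoivre using that by simp
    have a: "a t = poly PA (cis t)" for t
      unfolding a_def PA_def poly_sum poly_monom
      by (intro sum.cong refl) (subst cis_nat, auto simp: I1_def)
    have b: "b t = poly PB (cis t)" for t
      unfolding b_def PB_def poly_sum poly_monom
      by (intro sum.cong refl) (subst cis_nat, auto simp: I2_def)
    have PB0: "poly PB 0 = 0"
      unfolding PB_def poly_sum poly_monom by (intro sum.neutral) (auto simp: I2_def)
    define e where "e = (\<lambda>t. a t + cnj (b t))"
    have [measurable]: "a \<in> borel_measurable borel" "b \<in> borel_measurable borel"
      unfolding a_def b_def by measurable
    have [measurable]: "cnj \<in> borel_measurable borel"
      by (intro borel_measurable_continuous_onI continuous_intros)
    have [measurable]: "e \<in> borel_measurable borel" unfolding e_def by measurable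
    have Nfull: "norm (trig I \<kappa> c t) = norm (e t)" for t
    proof -
      have "e t = (\<Sum>i\<in>I. c i * cis (of_int (\<kappa> i - N) * t))"
      proof -
        have "I = I1 \<union> I2" "I1 \<inter> I2 = {}" by (auto simp: I1_def I2_def)
        moreover have "cnj (b t) = (\<Sum>i\<in>I2. c i * cis (of_int (\<kappa> i - N) * t))"
          unfolding b_def cnj_sum by (intro sum.cong) (auto simp: cis_cnj left_diff_distrib)
        ultimately show ?thesis using I unfolding e_def a_def by (simp add: sum.union_disjoint)
      qed
      also have "\<dots> = trig I \<kappa> c t * cis (- (of_int N * t))"
        by (simp add: trig_def sum_distrib_right left_diff_distrib cis_mult mult.assoc)
      finally show ?thesis by (simp add: norm_mult)
    qed
    have Nproj: "norm (trig I \<kappa> (\<lambda>i. (if \<kappa> i \<ge> N then 1 else 0) * c i) t) = norm (a t)" for t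
    proof -
      have "a t = (\<Sum>i\<in>I1. c i * cis (of_int (\<kappa> i) * t)) * cis (- (of_int N * t))"
        by (simp add: a_def sum_distrib_right left_diff_distrib cis_mult mult.assoc)
      also have "(\<Sum>i\<in>I1. c i * cis (of_int (\<kappa> i) * t)) = trig I \<kappa> (\<lambda>i. (if \<kappa> i \<ge> N then 1 else 0) * c i) t"
        unfolding trig_def I1_def using I by (subst sum.inter_filter) (auto intro!: sum.cong)
      finally show ?thesis by (simp add: norm_mult)
    qed
    define Ba where "Ba = (\<Sum>i\<in>I1. norm (c i))"
    have Ba: "norm (a t) \<le> Ba" for t
      unfolding a_def Ba_def by (rule sum_norm_le) (simp add: norm_mult)
    have Be: "norm (e t) \<le> (\<Sum>i\<in>I. norm (c i))" for t
      using trig_bounded[of I \<kappa> c t] Nfull[of t] by simp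
    have ia: "integrable circle (\<lambda>t. norm (a t) ^ (2*m))"
      by (rule integrable_circle_bounded[where B="Ba ^ (2*m)"]) (auto intro!: power_mono Ba)
    have ie: "integrable circle (\<lambda>t. norm (e t) ^ (2*m))"
      by (rule integrable_circle_bounded[where B="(\<Sum>i\<in>I. norm (c i)) ^ (2*m)"])
         (auto intro!: power_mono Be)
    have eq: "of_real ((norm (a t))\<^sup>2) - a t * cnj (e t) = - poly (PA * PB) (cis t)" for t
      unfolding complex_norm_square e_def by (simp add: algebra_simps flip: a b)
    have eqm: "(of_real ((norm (a t))\<^sup>2) - a t * cnj (e t)) ^ m = poly (smult ((-1)^m) ((PA * PB) ^ m)) (cis t)" for t
      unfolding eq by (simp add: power_minus[of "poly PA (cis t) * poly PB (cis t)"])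
    let ?P = "smult ((-1)^m) ((PA * PB) ^ m)"
    have ip: "integrable circle (\<lambda>t. poly ?P (cis t))"
    proof (rule integrable_circle_bounded)
      show "(\<lambda>t. poly ?P (cis t)) \<in> borel_measurable borel"
        by (simp flip: a b)
      show "norm (poly ?P (cis t)) \<le> (\<Sum>i\<le>degree ?P. norm (coeff ?P i))" for t
        unfolding poly_altdef[of ?P] by (rule sum_norm_le) (simp add: norm_mult norm_power)
    qed
    have "(LINT t|circle. norm (a t) ^ (2*m)) \<le> (LINT t|circle. C * norm (e t) ^ (2*m) + 2 * Re (poly ?P (cis t)))"
    proof (rule integral_mono)
      show "integrable circle (\<lambda>t. C * norm (e t) ^ (2*m) + 2 * Re (poly ?P (cis t)))"
        using ie ip by (intro Bochner_Integration.integrable_add integrable_mult_right integrable_Re)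
      show "norm (a t) ^ (2*m) \<le> C * norm (e t) ^ (2*m) + 2 * Re (poly ?P (cis t))" for t
        using pw[of "a t" "e t"] unfolding eqm .
    qed (rule ia)
    also have "\<dots> = C * (LINT t|circle. norm (e t) ^ (2*m)) + 2 * (LINT t|circle. Re (poly ?P (cis t)))"
      using ie integrable_Re[OF ip] by (simp del: poly_smult)
    \<comment> \<open>Because \<open>m > 0\<close>, the power inherits the zero of \<open>PB\<close>
      at 0, and the mean is its value there.\<close>
    also have "(LINT t|circle. Re (poly ?P (cis t))) = 0"
      unfolding integral_Re[OF ip] integral_circle_poly using PB0 m by (simp add: power_0_left)
    finally have "(LINT t|circle. norm (a t) ^ (2*m)) \<le> C * (LINT t|circle. norm (e t) ^ (2*m))" by simp
    then have "(\<integral>\<^sup>+ t. ennreal (norm (a t) ^ (2*m)) \<partial>circle) \<le> ennreal C * (\<integral>\<^sup>+ t. ennreal (norm (e t) ^ (2*m)) \<partial>circle)"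
      using ia ie C by (simp add: nn_integral_eq_integral flip: ennreal_mult)
    moreover have "x powr real (2*m) = x ^ (2*m)" if "x \<ge> 0" for x :: real
      using that m by (auto simp: powr_realpow' simp del: of_nat_mult)
    ultimately show "(\<integral>\<^sup>+ t. ennreal (norm (trig I \<kappa> (\<lambda>i. (if \<kappa> i \<ge> N then 1 else 0) * c i) t) powr real (2*m)) \<partial>circle)
      \<le> ennreal C * (\<integral>\<^sup>+ t. ennreal (norm (trig I \<kappa> c t) powr real (2*m)) \<partial>circle)"
      unfolding Nfull Nproj by simp
  qed (rule C)
  then show thesis using that by blast
qed

section \<open>Trigonometric polynomials on the torus\<close>

definition tpoly :: "nat \<Rightarrow> (nat \<Rightarrow> int) set \<Rightarrow> ((nat \<Rightarrow> int) \<Rightarrow> complex) \<Rightarrow> (nat \<Rightarrow> real) \<Rightarrow> complex" where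
  "tpoly d K c x = (\<Sum>k\<in>K. c k * character d k x)"

definition power_integral :: "nat \<Rightarrow> real \<Rightarrow> ((nat \<Rightarrow> real) \<Rightarrow> complex) \<Rightarrow> ennreal" where
  "power_integral d q g = (\<integral>\<^sup>+ x. ennreal (norm (g x) powr q) \<partial>torus d)"

lemma torus_eq: "torus d = PiM {1..d} (\<lambda>_. circle)"
  by (simp add: torus_def circle_def)

lemma product_sigma_finite_circle: "product_sigma_finite (\<lambda>_. circle)"
  using prob_space_imp_sigma_finite[OF prob_space_circle] by (simp add: product_sigma_finite_def)

lemma prob_space_torus: "prob_space (torus d)"
  unfolding torus_eq by (intro prob_space_PiM prob_space_circle)

lemma character_cis: "character d k x = cis (dot d (\<lambda>j. of_int (k j)) x)"
  by (simp add: character_def cis_conv_exp)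

lemma cis_sum: "finite A \<Longrightarrow> cis (\<Sum>i\<in>A. f i) = (\<Prod>i\<in>A. cis (f i))"
  by (induction A rule: finite_induct) (auto simp flip: cis_mult)

lemma character_prod: "character d k x = (\<Prod>j=1..d. cis (of_int (k j) * x j))"
  by (simp add: character_cis dot_def cis_sum)

lemma norm_character [simp]: "norm (character d k x) = 1"
  by (simp add: character_cis)

lemma component_measurable_torus: "j \<in> {1..d} \<Longrightarrow> (\<lambda>x. x j) \<in> borel_measurable (torus d)"
proof -
  assume "j \<in> {1..d}"
  then have "(\<lambda>x. x j) \<in> measurable (PiM {1..d} (\<lambda>_. circle)) circle"
    by (rule measurable_component_singleton)
  moreover have "measurable (torus d) circle = borel_measurable (torus d)"
    by (rule measurable_cong_sets) auto
  ultimately show ?thesis by (simp add: torus_eq)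
qed

lemma character_measurable [measurable]: "character d k \<in> borel_measurable (torus d)"
proof -
  have "(\<lambda>x. \<Prod>j=1..d. cis (of_int (k j) * x j)) \<in> borel_measurable (torus d)"
    by (intro borel_measurable_prod borel_measurable_cis borel_measurable_times
          borel_measurable_const component_measurable_torus)
  then show ?thesis unfolding character_prod[symmetric] .
qed

lemma tpoly_measurable [measurable]: "tpoly d K c \<in> borel_measurable (torus d)"
  unfolding tpoly_def[abs_def] by measurable

text \<open>With all variables but the j-th frozen, a polynomial is a \<open>trig\<close> sum over
  the same index set \<open>K\<close>, with frequencies \<open>k j\<close> and the other
  exponentials absorbed into the coefficients. The one-variable bound applies for each frozen point
  and is integrated.\<close>

lemma mult_bdd_lift_one:
  assumes m: "mult_bdd q m C" and K: "finite K" and j: "j \<in> {1..d}"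
  shows "power_integral d q (tpoly d K (\<lambda>k. m (k j) * c k)) \<le> ennreal C * power_integral d q (tpoly d K c)"
proof -
  interpret product_sigma_finite "\<lambda>_. circle" by (rule product_sigma_finite_circle)
  let ?J = "{1..d} - {j}"
  have tor: "torus d = PiM (insert j ?J) (\<lambda>_. circle)"
    using j by (simp add: torus_eq insert_absorb)
  have split: "tpoly d K c (x(j := t)) = trig K (\<lambda>k. k j) (\<lambda>k. c k * (\<Prod>i\<in>?J. cis (of_int (k i) * x i))) t" for c x t
  proof -
    have "character d k (x(j := t)) = (\<Prod>i\<in>?J. cis (of_int (k i) * x i)) * cis (of_int (k j) * t)" for k
      unfolding character_prod prod.remove[OF finite_atLeastAtMost j] by (auto intro!: prod.cong)
    then show ?thesis by (simp add: tpoly_def trig_def mult_ac)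
  qed
  have meas: "(\<lambda>x. ennreal (norm (tpoly d K c x) powr q)) \<in> borel_measurable (PiM (insert j ?J) (\<lambda>_. circle))" for c
    unfolding tor[symmetric] by measurable
  have pi: "power_integral d q (tpoly d K c)
     = (\<integral>\<^sup>+ x. \<integral>\<^sup>+ t. ennreal (norm (trig K (\<lambda>k. k j) (\<lambda>k. c k * (\<Prod>i\<in>?J. cis (of_int (k i) * x i))) t) powr q) \<partial>circle \<partial>PiM ?J (\<lambda>_. circle))" for c
    unfolding power_integral_def tor using meas
    by (subst product_nn_integral_insert) (auto simp: split)
  have "power_integral d q (tpoly d K (\<lambda>k. m (k j) * c k))
     \<le> (\<integral>\<^sup>+ x. ennreal C * (\<integral>\<^sup>+ t. ennreal (norm (trig K (\<lambda>k. k j) (\<lambda>k. c k * (\<Prod>i\<in>?J. cis (of_int (k i) * x i))) t) powr q) \<partial>circle) \<partial>PiM ?J (\<lambda>_. circle))"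
    unfolding pi mult.assoc using m K by (intro nn_integral_mono) (auto simp: mult_bdd_def)
  also have "\<dots> = ennreal C * power_integral d q (tpoly d K c)"
  proof -
    have "(\<lambda>x. \<integral>\<^sup>+ t. ennreal (norm (tpoly d K c (x(j := t))) powr q) \<partial>circle) \<in> borel_measurable (PiM ?J (\<lambda>_. circle))"
    proof -
      have "(\<lambda>(x, t). x(j := t)) \<in> measurable (PiM ?J (\<lambda>_. circle) \<Otimes>\<^sub>M circle) (PiM (insert j ?J) (\<lambda>_. circle))"
        by (rule measurable_add_dim)
      from measurable_compose[OF this meas]
      have [measurable]: "(\<lambda>(x, t). ennreal (norm (tpoly d K c (x(j := t))) powr q)) \<in> borel_measurable (PiM ?J (\<lambda>_. circle) \<Otimes>\<^sub>M circle)"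
        by (simp add: split_def)
      interpret sigma_finite_measure circle using prob_space_imp_sigma_finite[OF prob_space_circle] .
      show ?thesis by measurable
    qed
    then show ?thesis unfolding pi split by (rule nn_integral_cmult)
  qed
  finally show ?thesis .
qed

lemma mult_bdd_lift:
  assumes m: "\<And>j. j \<in> {1..d} \<Longrightarrow> mult_bdd q (m j) C" and K: "finite K"
  shows "power_integral d q (tpoly d K (\<lambda>k. (\<Prod>j=1..d. m j (k j)) * c k))
    \<le> ennreal (C ^ d) * power_integral d q (tpoly d K c)"
proof -
  have "power_integral d q (tpoly d K (\<lambda>k. (\<Prod>j\<in>J. m j (k j)) * c k))
    \<le> ennreal (C ^ card J) * power_integral d q (tpoly d K c)" if "finite J" "J \<subseteq> {1..d}" for J
    using that
  proof (induction J rule: finite_induct)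
    case (insert j J)
    have C: "C \<ge> 0" using m[of j] insert.prems by (auto simp: mult_bdd_def)
    have "power_integral d q (tpoly d K (\<lambda>k. (\<Prod>j\<in>insert j J. m j (k j)) * c k))
      = power_integral d q (tpoly d K (\<lambda>k. m j (k j) * ((\<Prod>j\<in>J. m j (k j)) * c k)))"
      using insert.hyps by (simp add: mult.assoc)
    also have "\<dots> \<le> ennreal C * power_integral d q (tpoly d K (\<lambda>k. (\<Prod>j\<in>J. m j (k j)) * c k))"
      using insert.prems by (intro mult_bdd_lift_one m K) auto
    also have "\<dots> \<le> ennreal C * (ennreal (C ^ card J) * power_integral d q (tpoly d K c))"
      using insert by (intro mult_left_mono) auto
    also have "\<dots> = ennreal (C ^ card (insert j J)) * power_integral d q (tpoly d K c)"
      using insert.hyps C by (simp add: ennreal_mult mult.assoc)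
    finally show ?case .
  qed simp
  from this[of "{1..d}"] show ?thesis by simp
qed

section \<open>The dyadic multipliers\<close>

text \<open>The trapezoid that is 1 up to \<open>l\<close> and falls linearly to 0 at
  \<open>2 * l\<close>. Writing it through two triangles makes the Fejer bound available.\<close>

definition vp_symbol :: "nat \<Rightarrow> int \<Rightarrow> real" where
  "vp_symbol l k = 2 * fejer (2 * l) k - fejer l k"

text \<open>For \<open>s = 1\<close> the kernel subtracts the constant 1; its symbol is the
  indicator of frequency 0, which is \<open>fejer 1\<close>.\<close>

definition a_symbol :: "nat \<Rightarrow> int \<Rightarrow> real" where
  "a_symbol s k = (if s = 1 then vp_symbol 2 k - fejer 1 k
     else vp_symbol (2 ^ s) k - vp_symbol (2 ^ (s - 1)) k)"

definition block_symbol :: "nat \<Rightarrow> int \<Rightarrow> complex" where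
  "block_symbol s k = (if 2 ^ (s - 1) \<le> \<bar>k\<bar> \<and> \<bar>k\<bar> < 2 ^ s then 1 else 0)"

lemma mult_bdd_diff:
  assumes "1 \<le> q" "mult_bdd q m C" "mult_bdd q m' C'"
  shows "mult_bdd q (\<lambda>k. m k - m' k) (2 powr q * (C + C'))"
  using mult_bdd_add[OF assms(1,2) mult_bdd_scale[OF assms(3), of "-1"]] by simp

lemma mult_bdd_vp:
  assumes "1 \<le> q" "l > 0"
  shows "mult_bdd q (\<lambda>k. of_real (vp_symbol l k)) (2 powr q * (2 powr q + 1))"
proof -
  have "mult_bdd q (\<lambda>k. 2 * of_real (fejer (2 * l) k)) (norm (2::complex) powr q * 1)"
    using assms by (intro mult_bdd_scale mult_bdd_fejer) auto
  from mult_bdd_diff[OF assms(1) this mult_bdd_fejer[OF assms(2,1)]]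
  show ?thesis by (simp add: vp_symbol_def)
qed

text \<open>Uniformity in \<open>s\<close> is inherited from the Fejer multipliers, whose constant
  is 1 for every order.\<close>

lemma mult_bdd_a_symbol:
  assumes "1 \<le> q"
  obtains C where "\<And>s. mult_bdd q (\<lambda>k. of_real (a_symbol s k)) C"
proof -
  define V where "V = 2 powr q * (2 powr q + 1)"
  \<comment> \<open>Lets the same constant also bound \<open>fejer 1\<close>, so that
    \<open>s = 1\<close> shares the constant of the other cases.\<close>
  have V1: "1 \<le> V"
  proof -
    have "1 * 1 \<le> V" unfolding V_def using assms by (intro mult_mono) (auto simp: ge_one_powr_ge_zero)
    then show ?thesis by simp
  qed
  have mono: "mult_bdd q m C'" if "mult_bdd q m C" "C \<le> C'" for m C C'
    using that unfolding mult_bdd_def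
    by (meson ennreal_leI mult_right_mono order_trans zero_le)
  have "mult_bdd q (\<lambda>k. of_real (a_symbol s k)) (2 powr q * (V + V))" for s
  proof (cases "s = 1")
    case True
    have "mult_bdd q (\<lambda>k. of_real (fejer 1 k)) V"
      using V1 assms by (intro mono[OF mult_bdd_fejer]) auto
    from mult_bdd_diff[OF assms mult_bdd_vp[OF assms, of 2, folded V_def] this] True
    show ?thesis by (simp add: a_symbol_def)
  next
    case False
    from mult_bdd_diff[OF assms mult_bdd_vp[OF assms, of "2^s", folded V_def] mult_bdd_vp[OF assms, of "2^(s-1)", folded V_def]] False
    show ?thesis by (simp add: a_symbol_def)
  qed
  then show thesis using that by blast
qed

lemma mult_bdd_block_symbol:
  assumes "m > 0"
  obtains C where "\<And>s. mult_bdd (real (2 * m)) (block_symbol s) C"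
proof -
  let ?q = "real (2 * m)"
  obtain C where C: "\<And>N. mult_bdd ?q (\<lambda>k. if k \<ge> N then 1 else 0) C"
    using mult_bdd_riesz[OF assms] by blast
  have q: "1 \<le> ?q" using assms by simp
  let ?I = "\<lambda>N k. if k \<ge> N then 1 else (0::complex)"
  note D = mult_bdd_diff[OF q C C]
  have "mult_bdd ?q (block_symbol s) (2 powr ?q * (2 powr ?q * (C + C) + 2 powr ?q * (C + C)))" for s
  proof -
    define a b where "a = (2::int) ^ (s - 1)" and "b = (2::int) ^ s"
    have pos: "a > 0" "a \<le> b" by (auto simp: a_def b_def intro: power_increasing)
    \<comment> \<open>The two sides of the block are differences of closed half-lines. The negative
      side \<open>- 2 ^ s < k \<le> - 2 ^ (s - 1)\<close> starts at \<open>1 - 2 ^ s\<close>, whence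
      the shift by 1.\<close>
    have "block_symbol s k = (?I (2 ^ (s - 1)) k - ?I (2 ^ s) k) + (?I (1 - 2 ^ s) k - ?I (1 - 2 ^ (s - 1)) k)" for k
      using pos unfolding block_symbol_def a_def[symmetric] b_def[symmetric] by auto
    then show ?thesis
      using mult_bdd_add[OF q D[of "2 ^ (s - 1)" "2 ^ s"] D[of "1 - 2 ^ s" "1 - 2 ^ (s - 1)"]]
      by presburger
  qed
  then show thesis using that by blast
qed

section \<open>Supports and special values of the symbols\<close>

lemma vp_symbol_low: "l > 0 \<Longrightarrow> \<bar>k\<bar> \<le> int l \<Longrightarrow> vp_symbol l k = 1"
  and vp_symbol_mid: "l > 0 \<Longrightarrow> int l \<le> \<bar>k\<bar> \<Longrightarrow> \<bar>k\<bar> \<le> 2 * int l \<Longrightarrow> vp_symbol l k = 1 - (of_int \<bar>k\<bar> - real l) / real l"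
  and vp_symbol_high: "l > 0 \<Longrightarrow> \<bar>k\<bar> \<ge> 2 * int l \<Longrightarrow> vp_symbol l k = 0"
  unfolding vp_symbol_def fejer_def max_def
  by (auto simp: field_simps)

text \<open>Below \<open>2 ^ (s - 1)\<close> both trapezoids equal 1, above
  \<open>2 ^ (s + 1)\<close> both vanish. The bounds are chosen so that the range is exactly the
  union of the dyadic shells \<open>s\<close> and \<open>s + 1\<close>.\<close>

lemma a_symbol_support:
  assumes "s \<ge> 1" "a_symbol s k \<noteq> 0"
  shows "2 ^ (s - 1) \<le> \<bar>k\<bar>" "\<bar>k\<bar> < 2 ^ (s + 1)"
proof -
  have "2 ^ (s - 1) \<le> \<bar>k\<bar> \<and> \<bar>k\<bar> < 2 ^ (s + 1)"
  proof (cases "s = 1")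
    case True
    have "k \<noteq> 0" using assms True vp_symbol_low[of 2 k] by (auto simp: a_symbol_def fejer_def)
    moreover have "\<bar>k\<bar> < 4"
    proof (rule ccontr)
      assume "\<not> \<bar>k\<bar> < 4"
      then have "vp_symbol 2 k = 0" "fejer 1 k = 0"
        by (auto intro!: vp_symbol_high simp: fejer_def)
      then show False using assms True by (simp add: a_symbol_def)
    qed
    ultimately show ?thesis using True by auto
  next
    case False
    then have s: "(2::int) ^ s = 2 * 2 ^ (s - 1)" using assms by (cases s) auto
    have "\<not> \<bar>k\<bar> < 2 ^ (s - 1)"
    proof
      assume "\<bar>k\<bar> < 2 ^ (s - 1)"
      then have "vp_symbol (2 ^ s) k = 1" "vp_symbol (2 ^ (s - 1)) k = 1"
        using s by (auto intro!: vp_symbol_low)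
      then show False using assms False by (simp add: a_symbol_def)
    qed
    moreover have "\<not> \<bar>k\<bar> \<ge> 2 ^ (s + 1)"
    proof
      assume "\<bar>k\<bar> \<ge> 2 ^ (s + 1)"
      then have "vp_symbol (2 ^ s) k = 0" "vp_symbol (2 ^ (s - 1)) k = 0"
        using s by (auto intro!: vp_symbol_high)
      then show False using assms False by (simp add: a_symbol_def)
    qed
    ultimately show ?thesis by simp
  qed
  then show "2 ^ (s - 1) \<le> \<bar>k\<bar>" "\<bar>k\<bar> < 2 ^ (s + 1)" by auto
qed

text \<open>At \<open>2 ^ u\<close> the trapezoid of height parameter \<open>2 ^ v\<close> is 1 or 0
  according to whether \<open>u \<le> v\<close>, so a difference of consecutive ones sees only
  \<open>s = u\<close>. These are the frequencies used for the extremal functions.\<close>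

lemma a_symbol_power_two:
  assumes "s \<ge> 1" "u \<ge> 1"
  shows "a_symbol s (2 ^ u) = (if s = u then 1 else 0)"
proof -
  have V: "vp_symbol (2 ^ v) (2 ^ u) = (if u \<le> v then 1 else 0)" for v
  proof (cases "u \<le> v")
    case True
    then have "(2::int) ^ u \<le> 2 ^ v" by (intro power_increasing) auto
    then show ?thesis using True by (auto intro!: vp_symbol_low)
  next
    case False
    then have "(2::int) ^ (v + 1) \<le> 2 ^ u" by (intro power_increasing) auto
    then show ?thesis using False by (auto intro!: vp_symbol_high)
  qed
  show ?thesis
  proof (cases "s = 1")
    case True
    have "(1::real) \<le> 2 ^ u" by simp
    then have "fejer 1 (2 ^ u) = 0" unfolding fejer_def by (simp add: max_def del: one_le_power one_le_numeral)
    then show ?thesis using V[of 1] True assms by (auto simp: a_symbol_def)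
  next
    case False
    then show ?thesis using V[of s] V[of "s - 1"] assms by (auto simp: a_symbol_def)
  qed
qed

section \<open>The kernels as trigonometric polynomials\<close>

lemma even_cis_sum:
  assumes "\<And>k. g (- k) = g k"
  shows "(\<Sum>k\<in>{- int M..int M}. complex_of_real (g k) * cis (of_int k * t))
     = of_real (g 0 + 2 * (\<Sum>k=1..M. g (int k) * cos (real k * t)))"
proof (induction M)
  case (Suc M)
  have "{- int (Suc M)..int (Suc M)} = insert (- int (Suc M)) (insert (int (Suc M)) {- int M..int M})"
    by auto
  then have "(\<Sum>k\<in>{- int (Suc M)..int (Suc M)}. complex_of_real (g k) * cis (of_int k * t))
    = g (int (Suc M)) * (cis (- (real (Suc M) * t)) + cis (real (Suc M) * t))
       + (\<Sum>k\<in>{- int M..int M}. complex_of_real (g k) * cis (of_int k * t))"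
    using assms[of "int (Suc M)"] by (simp add: algebra_simps)
  also have "cis (- (real (Suc M) * t)) + cis (real (Suc M) * t) = of_real (2 * cos (real (Suc M) * t))"
    by (simp add: complex_eq_iff)
  finally show ?case unfolding Suc.IH by (simp add: algebra_simps)
qed simp

lemma fejer_even: "fejer N (- k) = fejer N k"
  by (simp add: fejer_def)

text \<open>The cosine range may exceed the degree of the kernel, so that two kernels of different
  degree can be subtracted over one common range.\<close>

lemma vallee_poussin_expansion:
  assumes l: "l > 0" and M: "2 * l - 1 \<le> M"
  shows "vallee_poussin l t = vp_symbol l 0 + 2 * (\<Sum>k=1..M. vp_symbol l (int k) * cos (real k * t))"
proof -
  have "{1..M} = {1..l} \<union> ({l+1..2*l-1} \<union> {2*l..M})" using l M by auto
  then have "(\<Sum>k=1..M. vp_symbol l (int k) * cos (real k * t))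
    = (\<Sum>k=1..l. vp_symbol l (int k) * cos (real k * t)) + ((\<Sum>k=l+1..2*l-1. vp_symbol l (int k) * cos (real k * t))
      + (\<Sum>k=2*l..M. vp_symbol l (int k) * cos (real k * t)))"
    using l by (simp only:) (subst sum.union_disjoint; force?)+
  also have "(\<Sum>k=1..l. vp_symbol l (int k) * cos (real k * t)) = (\<Sum>k=1..l. cos (real k * t))"
    using l by (intro sum.cong) (auto simp: vp_symbol_low)
  also have "(\<Sum>k=l+1..2*l-1. vp_symbol l (int k) * cos (real k * t))
     = (\<Sum>k=l+1..2*l-1. (1 - (real k - real l) / real l) * cos (real k * t))"
    using l by (intro sum.cong) (auto simp: vp_symbol_mid)
  also have "(\<Sum>k=2*l..M. vp_symbol l (int k) * cos (real k * t)) = 0"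
    using l by (intro sum.neutral) (auto simp: vp_symbol_high)
  finally show ?thesis using l by (simp add: vallee_poussin_def vp_symbol_low)
qed

lemma a_symbol_even: "a_symbol s (- k) = a_symbol s k"
  by (simp add: a_symbol_def vp_symbol_def fejer_even)

lemma vp_diff_expansion:
  assumes s: "s \<ge> 1" and M: "2 ^ (s + 1) \<le> M"
  shows "complex_of_real (vp_diff s t) = (\<Sum>k\<in>{- int M..int M}. of_real (a_symbol s k) * cis (of_int k * t))"
proof -
  have V: "vallee_poussin (2 ^ v) t = vp_symbol (2 ^ v) 0 + 2 * (\<Sum>k=1..M. vp_symbol (2 ^ v) (int k) * cos (real k * t))"
    if "v \<le> s" for v
  proof (rule vallee_poussin_expansion)
    have "(2::nat) ^ (v + 1) \<le> 2 ^ (s + 1)" using that by (intro power_increasing) auto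
    also note M
    finally show "2 * 2 ^ v - 1 \<le> M" by simp
  qed simp
  have "vp_diff s t = a_symbol s 0 + 2 * (\<Sum>k=1..M. a_symbol s (int k) * cos (real k * t))"
  proof (cases "s = 1")
    case True
    have "fejer 1 (int k) = 0" if "k \<in> {1..M}" for k using that by (simp add: fejer_def max_def)
    then have "(\<Sum>k=1..M. a_symbol s (int k) * cos (real k * t)) = (\<Sum>k=1..M. vp_symbol 2 (int k) * cos (real k * t))"
      using True by (intro sum.cong) (auto simp: a_symbol_def)
    then show ?thesis using True V[of 1] by (simp add: vp_diff_def a_symbol_def fejer_def)
  next
    case False
    then show ?thesis using V[of s] V[of "s - 1"]
      by (simp add: vp_diff_def a_symbol_def left_diff_distrib sum_subtractf)
  qed
  then show ?thesis by (subst even_cis_sum) (simp_all only: a_symbol_even)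
qed

section \<open>Fourier coefficients\<close>

lemma fourier_coeff_eq: "fourier_coeff d f k = (LINT t|torus d. f t * cnj (character d k t))"
  by (simp add: fourier_coeff_def character_def exp_cnj)

lemma cnj_measurable [measurable]: "cnj \<in> borel_measurable borel"
  by (intro borel_measurable_continuous_onI continuous_intros)

lemma integrable_mult_cnj_character:
  assumes "integrable (torus d) f"
  shows "integrable (torus d) (\<lambda>t. f t * cnj (character d k t))"
proof (rule Bochner_Integration.integrable_bound[OF assms])
  have [measurable]: "f \<in> borel_measurable (torus d)" using assms by (rule borel_measurable_integrable)
  show "(\<lambda>t. f t * cnj (character d k t)) \<in> borel_measurable (torus d)" by measurable
qed (simp add: norm_mult)

lemma integrable_torus_bounded:
  fixes f :: "(nat \<Rightarrow> real) \<Rightarrow> 'b::{banach, second_countable_topology}"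
  assumes "f \<in> borel_measurable (torus d)" "\<And>t. norm (f t) \<le> B"
  shows "integrable (torus d) f"
proof -
  interpret prob_space "torus d" by (rule prob_space_torus)
  show ?thesis using assms by (intro integrable_const_bound[of _ B]) auto
qed

lemma integrable_character: "integrable (torus d) (character d k)"
  by (rule integrable_torus_bounded[where B=1]) auto

lemma norm_tpoly_le: "norm (tpoly d K c x) \<le> (\<Sum>k\<in>K. norm (c k))"
  unfolding tpoly_def by (rule sum_norm_le) (simp add: norm_mult)

lemma integrable_tpoly: "integrable (torus d) (tpoly d K c)"
  by (rule integrable_torus_bounded[OF tpoly_measurable norm_tpoly_le])

text \<open>Orthogonality factors over the coordinates. A character sees its frequency only on
  \<open>{1..d}\<close>, so equality of frequencies requires both to be extensional.\<close>

lemma fourier_coeff_character: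
  assumes "k \<in> {1..d} \<rightarrow>\<^sub>E UNIV" "l \<in> {1..d} \<rightarrow>\<^sub>E UNIV"
  shows "fourier_coeff d (character d l) k = (if k = l then 1 else 0)"
proof -
  interpret product_sigma_finite "\<lambda>_. circle" by (rule product_sigma_finite_circle)
  have "fourier_coeff d (character d l) k = (LINT t|torus d. (\<Prod>j=1..d. cis (of_int (l j - k j) * t j)))"
    by (simp add: fourier_coeff_eq character_prod cis_cnj cis_mult left_diff_distrib flip: prod.distrib)
  also have "\<dots> = (\<Prod>j=1..d. (LINT t|circle. cis (of_int (l j - k j) * t)))"
    unfolding torus_eq
    by (intro product_integral_prod integrable_circle_bounded[where B=1]) auto
  also have "\<dots> = (\<Prod>j=1..d. if k j = l j then 1 else 0)"
    unfolding integral_circle_cis by (intro prod.cong) auto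
  also have "\<dots> = (if \<forall>j\<in>{1..d}. k j = l j then 1 else 0)"
    by (auto intro!: prod.neutral simp: prod_zero_iff)
  also have "(\<forall>j\<in>{1..d}. k j = l j) \<longleftrightarrow> k = l"
    using assms by (auto intro: PiE_ext)
  finally show ?thesis .
qed

lemma fourier_coeff_tpoly:
  assumes "finite K" "K \<subseteq> {1..d} \<rightarrow>\<^sub>E UNIV" "k \<in> {1..d} \<rightarrow>\<^sub>E UNIV"
  shows "fourier_coeff d (tpoly d K c) k = (if k \<in> K then c k else 0)"
proof -
  have "fourier_coeff d (tpoly d K c) k = (LINT t|torus d. (\<Sum>l\<in>K. c l * (character d l t * cnj (character d k t))))"
    by (simp add: fourier_coeff_eq tpoly_def sum_distrib_right mult.assoc)
  also have "\<dots> = (\<Sum>l\<in>K. LINT t|torus d. c l * (character d l t * cnj (character d k t)))"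
    by (intro Bochner_Integration.integral_sum integrable_mult_right integrable_mult_cnj_character integrable_character)
  also have "\<dots> = (\<Sum>l\<in>K. c l * fourier_coeff d (character d l) k)"
    by (simp add: fourier_coeff_eq)
  also have "\<dots> = (\<Sum>l\<in>K. if k = l then c l else 0)"
    using assms by (intro sum.cong) (auto simp: fourier_coeff_character)
  also have "\<dots> = (if k \<in> K then c k else 0)" using assms(1) by simp
  finally show ?thesis .
qed

lemma fourier_coeff_diff:
  assumes "integrable (torus d) f" "integrable (torus d) g"
  shows "fourier_coeff d (\<lambda>x. f x - g x) k = fourier_coeff d f k - fourier_coeff d g k"
  using integrable_mult_cnj_character[OF assms(1)] integrable_mult_cnj_character[OF assms(2)]
  by (simp add: fourier_coeff_eq left_diff_distrib)

lemma fourier_sum_tpoly: "fourier_sum d Q f = tpoly d Q (fourier_coeff d f)"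
  by (simp add: fun_eq_iff fourier_sum_def tpoly_def)

section \<open>Dyadic blocks\<close>

text \<open>Two adjacent dyadic shells in each coordinate: a union of blocks \<open>rho\<close> that
  contains the support of the symbol of \<open>A_kernel\<close>.\<close>

definition wide_block :: "nat \<Rightarrow> (nat \<Rightarrow> nat) \<Rightarrow> (nat \<Rightarrow> int) set" where
  "wide_block d s = {k \<in> {1..d} \<rightarrow>\<^sub>E UNIV. \<forall>j \<in> {1..d}. 2 ^ (s j - 1) \<le> \<bar>k j\<bar> \<and> \<bar>k j\<bar> < 2 ^ (s j + 1)}"

definition A_symbol :: "nat \<Rightarrow> (nat \<Rightarrow> nat) \<Rightarrow> (nat \<Rightarrow> int) \<Rightarrow> real" where
  "A_symbol d s k = (\<Prod>j=1..d. a_symbol (s j) (k j))"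

text \<open>The set \<open>e\<close> records the coordinates in which the upper of the two shells is
  taken; its subsets index the \<open>2 ^ d\<close> dyadic blocks making up a wide block.\<close>

definition bump :: "nat \<Rightarrow> (nat \<Rightarrow> nat) \<Rightarrow> nat set \<Rightarrow> nat \<Rightarrow> nat" where
  "bump d s e = (\<lambda>j\<in>{1..d}. if j \<in> e then Suc (s j) else s j)"

lemma finite_bounded_frequencies:
  fixes K :: "(nat \<Rightarrow> int) set"
  assumes "\<And>k j. k \<in> K \<Longrightarrow> j \<in> {1..d} \<Longrightarrow> \<bar>k j\<bar> \<le> b j" "K \<subseteq> {1..d} \<rightarrow>\<^sub>E UNIV"
  shows "finite K"
proof (rule finite_subset)
  show "K \<subseteq> Pi\<^sub>E {1..d} (\<lambda>j. {- b j..b j})"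
  proof
    fix k assume k: "k \<in> K"
    have "k j \<in> {- b j..b j}" if "j \<in> {1..d}" for j
      using assms(1)[OF k that] by (simp add: abs_le_iff)
    moreover have "k \<in> extensional {1..d}" using assms(2) k by (auto simp: PiE_iff)
    ultimately show "k \<in> Pi\<^sub>E {1..d} (\<lambda>j. {- b j..b j})" by (simp add: PiE_iff)
  qed
qed (rule finite_PiE, auto)

lemma rho_extensional: "rho d s \<subseteq> {1..d} \<rightarrow>\<^sub>E UNIV"
  unfolding rho_def by (rule Collect_restrict)

lemma wide_block_extensional: "wide_block d s \<subseteq> {1..d} \<rightarrow>\<^sub>E UNIV"
  unfolding wide_block_def by (rule Collect_restrict)

lemma finite_wide_block: "finite (wide_block d s)"
  by (rule finite_bounded_frequencies[where b="\<lambda>j. 2 ^ (s j + 1)", OF _ wide_block_extensional])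
     (auto simp: wide_block_def less_imp_le)

lemma finite_rho: "finite (rho d s)"
  by (rule finite_bounded_frequencies[where b="\<lambda>j. 2 ^ (s j)", OF _ rho_extensional])
     (auto simp: rho_def less_imp_le)

lemma bump_block_indices: "s \<in> block_indices d \<Longrightarrow> bump d s e \<in> block_indices d"
  by (auto simp: block_indices_def bump_def)

lemma bump_inj: "inj_on (bump d s) (Pow {1..d})"
proof (rule inj_onI)
  fix e e' assume e: "e \<in> Pow {1..d}" "e' \<in> Pow {1..d}" and eq: "bump d s e = bump d s e'"
  have "j \<in> e \<longleftrightarrow> j \<in> e'" if "j \<in> {1..d}" for j
    using fun_cong[OF eq, of j] that by (auto simp: bump_def split: if_splits)
  with e show "e = e'" by blast
qed

lemma dyadic_unique:
  assumes "2 ^ (a - 1) \<le> (n::int)" "n < 2 ^ a" "2 ^ (b - 1) \<le> n" "n < 2 ^ b"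
  shows "a = b"
proof -
  have "\<not> a < b" if "2 ^ (b - 1) \<le> n" "n < 2 ^ a" for a b
  proof
    assume "a < b"
    then have "(2::int) ^ a \<le> 2 ^ (b - 1)" by (intro power_increasing) auto
    with that show False by linarith
  qed
  from this[of b a] this[of a b] assms show ?thesis by linarith
qed

lemma rho_disjoint:
  assumes "s \<in> block_indices d" "s' \<in> block_indices d" "k \<in> rho d s" "k \<in> rho d s'"
  shows "s = s'"
proof (rule PiE_ext)
  show "s \<in> {1..d} \<rightarrow>\<^sub>E {1..}" "s' \<in> {1..d} \<rightarrow>\<^sub>E {1..}" using assms by (auto simp: block_indices_def)
  fix j assume "j \<in> {1..d}"
  then show "s j = s' j" using assms(3,4) by (intro dyadic_unique[of "s j" "\<bar>k j\<bar>" "s' j"]) (auto simp: rho_def)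
qed

lemma wide_block_eq:
  assumes "s \<in> block_indices d"
  shows "wide_block d s = (\<Union>e\<in>Pow {1..d}. rho d (bump d s e))"
proof (intro equalityI subsetI)
  fix k assume k: "k \<in> wide_block d s"
  define e where "e = {j\<in>{1..d}. \<bar>k j\<bar> \<ge> 2 ^ s j}"
  have "k \<in> rho d (bump d s e)"
    using k by (auto simp: rho_def wide_block_def bump_def e_def)
  then show "k \<in> (\<Union>e\<in>Pow {1..d}. rho d (bump d s e))" by (auto simp: e_def)
next
  fix k assume "k \<in> (\<Union>e\<in>Pow {1..d}. rho d (bump d s e))"
  then obtain e where k: "k \<in> rho d (bump d s e)" by auto
  have "2 ^ (s j - 1) \<le> \<bar>k j\<bar> \<and> \<bar>k j\<bar> < 2 ^ (s j + 1)" if j: "j \<in> {1..d}" for j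
  proof -
    have p: "(2::int) ^ (s j - 1) \<le> 2 ^ s j" "(2::int) ^ s j \<le> 2 ^ (s j + 1)"
      by (auto intro: power_increasing)
    have b: "2 ^ (bump d s e j - 1) \<le> \<bar>k j\<bar> \<and> \<bar>k j\<bar> < 2 ^ (bump d s e j)"
      using k j by (auto simp: rho_def)
    show ?thesis
    proof (cases "j \<in> e")
      case True
      then have "bump d s e j = s j + 1" using j by (simp add: bump_def)
      with b have "2 ^ s j \<le> \<bar>k j\<bar> \<and> \<bar>k j\<bar> < 2 ^ (s j + 1)" by simp
      with p(1) show ?thesis by linarith
    next
      case False
      then have "bump d s e j = s j" using j by (simp add: bump_def)
      with b have "2 ^ (s j - 1) \<le> \<bar>k j\<bar> \<and> \<bar>k j\<bar> < 2 ^ s j" by simp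
      with p(2) show ?thesis by linarith
    qed
  qed
  then show "k \<in> wide_block d s" using k by (auto simp: wide_block_def rho_def)
qed

lemma A_symbol_support:
  assumes "s \<in> block_indices d" "k \<in> {1..d} \<rightarrow>\<^sub>E UNIV" "k \<notin> wide_block d s"
  shows "A_symbol d s k = 0"
proof -
  obtain j where j: "j \<in> {1..d}" "\<not> (2 ^ (s j - 1) \<le> \<bar>k j\<bar> \<and> \<bar>k j\<bar> < 2 ^ (s j + 1))"
    using assms by (auto simp: wide_block_def)
  have "s j \<ge> 1" using assms j by (auto simp: block_indices_def PiE_iff)
  then have "a_symbol (s j) (k j) = 0" using a_symbol_support[of "s j" "k j"] j by blast
  then show ?thesis using j by (auto simp: A_symbol_def)
qed

lemma A_kernel_expansion:
  assumes s: "s \<in> block_indices d" and M: "\<And>j. j \<in> {1..d} \<Longrightarrow> 2 ^ (s j + 1) \<le> M"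
  shows "complex_of_real (A_kernel d s (\<lambda>j\<in>{1..d}. x j - y j))
    = (\<Sum>k\<in>{1..d} \<rightarrow>\<^sub>E {- int M..int M}. of_real (A_symbol d s k) * character d k x * cnj (character d k y))"
proof -
  have sj: "s j \<ge> 1" if "j \<in> {1..d}" for j using s that by (auto simp: block_indices_def PiE_iff)
  have "complex_of_real (A_kernel d s (\<lambda>j\<in>{1..d}. x j - y j))
    = (\<Prod>j=1..d. \<Sum>k\<in>{- int M..int M}. of_real (a_symbol (s j) k) * cis (of_int k * (x j - y j)))"
    unfolding A_kernel_def of_real_prod
  proof (intro prod.cong refl)
    fix j assume j: "j \<in> {1..d}"
    show "complex_of_real (vp_diff (s j) ((\<lambda>j\<in>{1..d}. x j - y j) j))
       = (\<Sum>k\<in>{- int M..int M}. of_real (a_symbol (s j) k) * cis (of_int k * (x j - y j)))"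
      using vp_diff_expansion[OF sj[OF j] M[OF j], of "x j - y j"] j by simp
  qed
  also have "\<dots> = (\<Sum>k\<in>{1..d} \<rightarrow>\<^sub>E {- int M..int M}. \<Prod>j=1..d. of_real (a_symbol (s j) (k j)) * cis (of_int (k j) * (x j - y j)))"
    by (rule prod_sum_PiE) auto
  also have "\<dots> = (\<Sum>k\<in>{1..d} \<rightarrow>\<^sub>E {- int M..int M}. of_real (A_symbol d s k) * character d k x * cnj (character d k y))"
    unfolding A_symbol_def character_prod of_real_prod cnj_prod
    by (simp add: prod.distrib[symmetric] cis_cnj cis_mult right_diff_distrib mult.assoc)
  finally show ?thesis .
qed

text \<open>The kernel is a trigonometric polynomial, so the convolution integral splits into
  Fourier coefficients of \<open>f\<close>. Afterwards every claim about \<open>A\<close>-blocks is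
  one about a multiplier acting on a finite polynomial.\<close>

lemma A_block_eq:
  assumes s: "s \<in> block_indices d" and f: "integrable (torus d) f"
  shows "A_block d s f = tpoly d (wide_block d s) (\<lambda>k. of_real (A_symbol d s k) * fourier_coeff d f k)"
proof
  fix x
  \<comment> \<open>A common degree bound for all \<open>d\<close> one-variable factors. The
    resulting frequency box is cut down to the wide block at the end.\<close>
  define M :: nat where "M = (\<Sum>j=1..d. 2 ^ (s j + 1))"
  have M: "2 ^ (s j + 1) \<le> M" if "j \<in> {1..d}" for j
    unfolding M_def using member_le_sum[OF that, of "\<lambda>j. (2::nat) ^ (s j + 1)"] by simp
  let ?B = "{1..d} \<rightarrow>\<^sub>E {- int M..int M}"
  have fin: "finite ?B" by (intro finite_PiE) auto
  have "A_block d s f x = (LINT y|torus d. (\<Sum>k\<in>?B. of_real (A_symbol d s k) * character d k x * (f y * cnj (character d k y))))"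
    unfolding A_block_def convolution_def
    by (intro Bochner_Integration.integral_cong refl)
       (subst A_kernel_expansion[OF s M], auto simp: sum_distrib_left mult_ac)
  also have "\<dots> = (\<Sum>k\<in>?B. LINT y|torus d. of_real (A_symbol d s k) * character d k x * (f y * cnj (character d k y)))"
    by (intro Bochner_Integration.integral_sum integrable_mult_right integrable_mult_cnj_character f)
  also have "\<dots> = (\<Sum>k\<in>?B. of_real (A_symbol d s k) * fourier_coeff d f k * character d k x)"
    by (intro sum.cong refl) (simp add: fourier_coeff_eq)
  also have "\<dots> = (\<Sum>k\<in>wide_block d s. of_real (A_symbol d s k) * fourier_coeff d f k * character d k x)"
  proof (rule sum.mono_neutral_right[OF fin])
    have "\<bar>k j\<bar> \<le> int M" if "k \<in> wide_block d s" "j \<in> {1..d}" for k j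
    proof -
      have "\<bar>k j\<bar> < int (2 ^ (s j + 1))" using that by (auto simp: wide_block_def)
      also have "\<dots> \<le> int M" using M[OF that(2)] by (simp only: of_nat_le_iff)
      finally show ?thesis by simp
    qed
    then have "k j \<in> {- int M..int M}" if "k \<in> wide_block d s" "j \<in> {1..d}" for k j
      using that unfolding abs_le_iff by (metis atLeastAtMost_iff minus_le_iff)
    then show "wide_block d s \<subseteq> ?B"
      using wide_block_extensional[of d s] by (auto simp: PiE_iff)
    show "\<forall>k\<in>?B - wide_block d s. of_real (A_symbol d s k) * fourier_coeff d f k * character d k x = 0"
      using A_symbol_support[OF s] by (auto simp: PiE_iff)
  qed
  finally show "A_block d s f x = tpoly d (wide_block d s) (\<lambda>k. of_real (A_symbol d s k) * fourier_coeff d f k) x"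
    by (simp add: tpoly_def)
qed

lemma delta_block_eq: "delta_block d s f = tpoly d (rho d s) (fourier_coeff d f)"
  by (simp add: delta_block_def fourier_sum_tpoly)

lemma tpoly_UN_blocks:
  assumes s: "s \<in> block_indices d" and E: "E \<subseteq> Pow {1..d}"
  shows "tpoly d (\<Union>e\<in>E. rho d (bump d s e)) c x = (\<Sum>e\<in>E. tpoly d (rho d (bump d s e)) c x)"
  unfolding tpoly_def
proof (rule sum.UNION_disjoint)
  show "finite E" using E finite_subset by auto
  show "\<forall>e\<in>E. \<forall>e'\<in>E. e \<noteq> e' \<longrightarrow> rho d (bump d s e) \<inter> rho d (bump d s e') = {}"
    using rho_disjoint[OF bump_block_indices[OF s] bump_block_indices[OF s]] inj_onD[OF bump_inj] E by blast
qed (auto simp: finite_rho)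

section \<open>The hyperbolic cross as a finite union of dyadic blocks\<close>

lemma hyp_cross_iff:
  assumes "s \<in> block_indices d" "k \<in> rho d s"
  shows "k \<in> hyp_cross d \<beta> n \<longleftrightarrow> dot d (\<lambda>j. real (s j)) \<beta> < real n"
proof
  assume "k \<in> hyp_cross d \<beta> n"
  then obtain s' where s': "s' \<in> block_indices d" "dot d (\<lambda>j. real (s' j)) \<beta> < real n" "k \<in> rho d s'"
    by (auto simp: hyp_cross_def)
  moreover have "s = s'" using rho_disjoint[OF assms(1) s'(1) assms(2) s'(3)] .
  ultimately show "dot d (\<lambda>j. real (s j)) \<beta> < real n" by simp
next
  assume "dot d (\<lambda>j. real (s j)) \<beta> < real n"
  with assms show "k \<in> hyp_cross d \<beta> n" unfolding hyp_cross_def by blast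
qed

lemma dot_mono:
  assumes "\<And>j. j \<in> {1..d} \<Longrightarrow> x j \<le> y j" "\<And>j. j \<in> {1..d} \<Longrightarrow> 0 \<le> \<beta> j"
  shows "dot d x \<beta> \<le> dot d y \<beta>"
  unfolding dot_def using assms by (intro sum_mono mult_right_mono) auto

text \<open>Since \<open>\<beta> \<ge> 1\<close>, every coordinate of an admissible index is at most
  \<open>n\<close>. Finiteness is essential: a sum over an infinite frequency set would have the
  default value 0.\<close>

lemma finite_hyp_cross:
  assumes "\<And>j. j \<in> {1..d} \<Longrightarrow> 1 \<le> \<beta> j"
  shows "finite (hyp_cross d \<beta> n)"
proof -
  have "{s \<in> block_indices d. dot d (\<lambda>j. real (s j)) \<beta> < real n} \<subseteq> {1..d} \<rightarrow>\<^sub>E {..n}"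
  proof
    fix s assume s: "s \<in> {s \<in> block_indices d. dot d (\<lambda>j. real (s j)) \<beta> < real n}"
    have "s j \<le> n" if j: "j \<in> {1..d}" for j
    proof -
      have "real (s j) * 1 \<le> real (s j) * \<beta> j" using assms j by (intro mult_left_mono) auto
      also have "\<dots> \<le> dot d (\<lambda>j. real (s j)) \<beta>"
        unfolding dot_def using j assms by (intro member_le_sum[where f="\<lambda>j. real (s j) * \<beta> j"]) force+
      finally show ?thesis using s by auto
    qed
    then show "s \<in> {1..d} \<rightarrow>\<^sub>E {..n}" using s by (auto simp: block_indices_def PiE_iff)
  qed
  then have "finite {s \<in> block_indices d. dot d (\<lambda>j. real (s j)) \<beta> < real n}"
    by (rule finite_subset) (rule finite_PiE, auto)
  then show ?thesis by (auto simp: hyp_cross_def finite_rho)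
qed

lemma hyp_cross_extensional: "hyp_cross d \<beta> n \<subseteq> {1..d} \<rightarrow>\<^sub>E UNIV"
  using rho_extensional by (auto simp: hyp_cross_def)

lemma rho_nonzero: "k \<in> rho d s \<Longrightarrow> j \<in> {1..d} \<Longrightarrow> k j \<noteq> 0"
proof -
  assume "k \<in> rho d s" "j \<in> {1..d}"
  then have "2 ^ (s j - 1) \<le> \<bar>k j\<bar>" by (auto simp: rho_def)
  moreover have "(0::int) < 2 ^ (s j - 1)" by simp
  ultimately show "k j \<noteq> 0" by linarith
qed

lemma hyp_cross_nonzero: "k \<in> hyp_cross d \<beta> n \<Longrightarrow> j \<in> {1..d} \<Longrightarrow> k j \<noteq> 0"
  using rho_nonzero by (auto simp: hyp_cross_def)

text \<open>The cross is a union of whole blocks and blocks are disjoint, so each dyadic piece of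
  the wide block is either removed completely by the Fourier sum or left untouched.\<close>

lemma A_block_remainder:
  assumes s: "s \<in> block_indices d" and f: "integrable (torus d) f" and \<beta>: "\<And>j. j \<in> {1..d} \<Longrightarrow> 1 \<le> \<beta> j"
  shows "A_block d s (\<lambda>x. f x - fourier_sum d (hyp_cross d \<beta> n) f x)
    = (\<lambda>x. \<Sum>e\<in>{e\<in>Pow {1..d}. real n \<le> dot d (\<lambda>j. real (bump d s e j)) \<beta>}.
        tpoly d (rho d (bump d s e)) (\<lambda>k. of_real (A_symbol d s k) * fourier_coeff d f k) x)"
proof
  fix x
  let ?Q = "hyp_cross d \<beta> n" and ?h = "\<lambda>x. f x - fourier_sum d (hyp_cross d \<beta> n) f x"
  let ?E = "{e\<in>Pow {1..d}. real n \<le> dot d (\<lambda>j. real (bump d s e j)) \<beta>}"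
  let ?c = "\<lambda>k. of_real (A_symbol d s k) * fourier_coeff d f k"
  have Q: "finite ?Q" using \<beta> by (rule finite_hyp_cross)
  have int: "integrable (torus d) ?h"
    unfolding fourier_sum_tpoly by (intro Bochner_Integration.integrable_diff f integrable_tpoly)
  have hc: "fourier_coeff d ?h k = (if k \<in> ?Q then 0 else fourier_coeff d f k)" if "k \<in> wide_block d s" for k
    using that wide_block_extensional[of d s] unfolding fourier_sum_tpoly
    by (subst fourier_coeff_diff[OF f integrable_tpoly], subst fourier_coeff_tpoly[OF Q hyp_cross_extensional]) auto
  have "A_block d s ?h x = (\<Sum>k\<in>wide_block d s. (if k \<in> ?Q then 0 else ?c k * character d k x))"
    unfolding A_block_eq[OF s int] tpoly_def by (intro sum.cong) (auto simp: hc)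
  also have "\<dots> = (\<Sum>k\<in>{k\<in>wide_block d s. k \<notin> ?Q}. ?c k * character d k x)"
    by (subst sum.inter_filter) (auto simp: finite_wide_block intro!: sum.cong)
  also have "{k\<in>wide_block d s. k \<notin> ?Q} = (\<Union>e\<in>?E. rho d (bump d s e))"
    unfolding wide_block_eq[OF s]
    by (auto simp: hyp_cross_iff[OF bump_block_indices[OF s]] not_less)
  also have "(\<Sum>k\<in>\<dots>. ?c k * character d k x) = (\<Sum>e\<in>?E. tpoly d (rho d (bump d s e)) ?c x)"
    unfolding tpoly_def[symmetric] by (rule tpoly_UN_blocks[OF s]) auto
  finally show "A_block d s ?h x = (\<Sum>e\<in>?E. tpoly d (rho d (bump d s e)) ?c x)" .
qed

section \<open>Lebesgue norms\<close>

lemma epow_mono: "X \<le> Y \<Longrightarrow> 0 \<le> a \<Longrightarrow> epow X a \<le> epow Y a"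
  by (auto simp: epow_def top_unique less_top intro!: ennreal_leI powr_mono2 enn2real_mono)

lemma epow_cmult:
  assumes "C > 0"
  shows "epow (ennreal C * X) a = ennreal (C powr a) * epow X a"
proof (cases "X = \<top>")
  case True
  then show ?thesis using assms by (auto simp: epow_def ennreal_mult_top powr_def)
next
  case False
  then have "ennreal C * X \<noteq> \<top>" by (simp add: ennreal_mult_eq_top_iff)
  then show ?thesis using False assms
    by (simp add: epow_def enn2real_mult powr_mult ennreal_mult)
qed

lemma epow_ennreal: "0 \<le> x \<Longrightarrow> epow (ennreal x) a = ennreal (x powr a)"
  by (simp add: epow_def)

text \<open>Split \<open>(x + y) powr a\<close> as \<open>(x + y) * (x + y) powr (a - 1)\<close>;
  the exponent \<open>a - 1\<close> is at most 0, so replacing \<open>x + y\<close> by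
  \<open>x\<close> or by \<open>y\<close> only increases the power.\<close>

lemma powr_subadd:
  fixes x y :: real
  assumes "0 \<le> x" "0 \<le> y" "0 < a" "a \<le> 1"
  shows "(x + y) powr a \<le> x powr a + y powr a"
proof (cases "x = 0 \<or> y = 0")
  case False
  then have xy: "x > 0" "y > 0" using assms by auto
  have "(x + y) powr a = x * (x + y) powr (a - 1) + y * (x + y) powr (a - 1)"
  proof -
    have "(x + y) powr a = (x + y) * (x + y) powr (a - 1)" using xy by (simp add: powr_diff)
    then show ?thesis by (simp only: distrib_right)
  qed
  also have "\<dots> \<le> x * x powr (a - 1) + y * y powr (a - 1)"
    using xy assms by (intro add_mono mult_left_mono powr_mono2') auto
  also have "\<dots> = x powr a + y powr a" using xy by (simp add: powr_diff)
  finally show ?thesis .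
qed auto

lemma epow_subadd:
  assumes "0 < a" "a \<le> 1"
  shows "epow (X + Y) a \<le> epow X a + epow Y a"
proof (cases "X = \<top> \<or> Y = \<top>")
  case False
  then obtain x y where "X = ennreal x" "Y = ennreal y" "x \<ge> 0" "y \<ge> 0"
    by (metis ennreal_cases)
  then show ?thesis using powr_subadd[OF _ _ assms]
    by (simp add: epow_ennreal flip: ennreal_plus)
qed (auto simp: epow_def)

lemma epow_sum_le:
  assumes "0 < a" "a \<le> 1"
  shows "epow (\<Sum>i\<in>I. X i) a \<le> (\<Sum>i\<in>I. epow (X i) a)"
proof (induction I rule: infinite_finite_induct)
  case (insert i I)
  then show ?case using epow_subadd[OF assms, of "X i" "sum X I"] by (auto intro: order_trans add_left_mono)
qed (use assms in \<open>auto simp: epow_def\<close>)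

lemma Lp_norm_finite_exponent:
  assumes "q < \<top>"
  shows "Lp_norm d q f = epow (power_integral d (enn2real q) f) (1 / enn2real q)"
proof -
  have "q \<noteq> \<top>" using assms by auto
  then show ?thesis unfolding Lp_norm_def power_integral_def by (rule if_not_P)
qed

lemma enn2real_ge_1: "1 \<le> q \<Longrightarrow> q < \<top> \<Longrightarrow> 1 \<le> enn2real q"
  using enn2real_mono[of 1 q] by simp

lemma Lp_norm_le_of_power_integral:
  assumes q: "1 \<le> q" "q < \<top>" and C: "C > 0"
    and le: "power_integral d (enn2real q) g \<le> ennreal C * power_integral d (enn2real q) h"
  shows "Lp_norm d q g \<le> ennreal (C powr (1 / enn2real q)) * Lp_norm d q h"
  unfolding Lp_norm_finite_exponent[OF q(2)] epow_cmult[OF C, symmetric]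
  using le enn2real_ge_1[OF q] by (intro epow_mono) auto

lemma norm_sum_powr_le:
  fixes g :: "'i \<Rightarrow> 'a::real_normed_vector"
  assumes "finite I" "1 \<le> q"
  shows "norm (\<Sum>i\<in>I. g i) powr q \<le> real (card I) powr q * (\<Sum>i\<in>I. norm (g i) powr q)"
proof (cases "I = {}")
  case False
  define M where "M = Max ((\<lambda>i. norm (g i)) ` I)"
  have M: "norm (g i) \<le> M" if "i \<in> I" for i using that assms by (auto simp: M_def)
  obtain j where j: "j \<in> I" "M = norm (g j)"
  proof -
    have "M \<in> (\<lambda>i. norm (g i)) ` I" unfolding M_def using assms False by (intro Max_in) auto
    then show thesis using that by auto
  qed
  have "norm (\<Sum>i\<in>I. g i) \<le> real (card I) * M"
    using sum_norm_le[of I g "\<lambda>_. M"] M by simp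
  then have "norm (\<Sum>i\<in>I. g i) powr q \<le> (real (card I) * M) powr q"
    using assms by (intro powr_mono2) auto
  also have "\<dots> = real (card I) powr q * norm (g j) powr q"
    using j by (simp add: powr_mult)
  also have "\<dots> \<le> real (card I) powr q * (\<Sum>i\<in>I. norm (g i) powr q)"
    using assms j by (intro mult_left_mono member_le_sum[where f="\<lambda>i. norm (g i) powr q"]) auto
  finally show ?thesis .
qed auto

text \<open>A quasi-triangle inequality: the largest summand bounds the sum pointwise, and roots
  with exponent at most 1 are subadditive. The factor is harmless, as at most \<open>2 ^ d\<close>
  pieces are added.\<close>

lemma Lp_norm_sum_le:
  assumes q: "1 \<le> q" "q < \<top>" and I: "finite I"
    and [measurable]: "\<And>i. i \<in> I \<Longrightarrow> g i \<in> borel_measurable (torus d)"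
  shows "Lp_norm d q (\<lambda>x. \<Sum>i\<in>I. g i x) \<le> of_nat (card I) * (\<Sum>i\<in>I. Lp_norm d q (g i))"
proof (cases "I = {}")
  case True
  then show ?thesis using q by (simp add: Lp_norm_finite_exponent power_integral_def epow_def)
next
  case False
  let ?q = "enn2real q" and ?N = "real (card I)"
  have q1: "1 \<le> ?q" by (rule enn2real_ge_1[OF q])
  have N: "?N > 0" using False I by (simp add: card_gt_0_iff)
  have "power_integral d ?q (\<lambda>x. \<Sum>i\<in>I. g i x)
    \<le> (\<integral>\<^sup>+ x. ennreal (?N powr ?q) * (\<Sum>i\<in>I. ennreal (norm (g i x) powr ?q)) \<partial>torus d)"
    unfolding power_integral_def
  proof (intro nn_integral_mono)
    fix x
    have "ennreal (norm (\<Sum>i\<in>I. g i x) powr ?q) \<le> ennreal (?N powr ?q * (\<Sum>i\<in>I. norm (g i x) powr ?q))"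
      by (intro ennreal_leI norm_sum_powr_le I q1)
    also have "\<dots> = ennreal (?N powr ?q) * (\<Sum>i\<in>I. ennreal (norm (g i x) powr ?q))"
      by (subst ennreal_mult) (auto simp: sum_nonneg sum_ennreal)
    finally show "ennreal (norm (\<Sum>i\<in>I. g i x) powr ?q) \<le> ennreal (?N powr ?q) * (\<Sum>i\<in>I. ennreal (norm (g i x) powr ?q))" .
  qed
  also have "\<dots> = ennreal (?N powr ?q) * (\<Sum>i\<in>I. power_integral d ?q (g i))"
    unfolding power_integral_def by (subst nn_integral_cmult, measurable, subst nn_integral_sum, auto)
  finally have "Lp_norm d q (\<lambda>x. \<Sum>i\<in>I. g i x) \<le> epow (ennreal (?N powr ?q) * (\<Sum>i\<in>I. power_integral d ?q (g i))) (1 / ?q)"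
    unfolding Lp_norm_finite_exponent[OF q(2)] using q1 by (intro epow_mono) auto
  also have "\<dots> = ennreal ?N * epow (\<Sum>i\<in>I. power_integral d ?q (g i)) (1 / ?q)"
    using N q1 by (subst epow_cmult) (auto simp: powr_powr)
  also have "\<dots> \<le> ennreal ?N * (\<Sum>i\<in>I. Lp_norm d q (g i))"
    unfolding Lp_norm_finite_exponent[OF q(2)] using q1 by (intro mult_left_mono epow_sum_le) auto
  finally show ?thesis by (simp add: ennreal_of_nat_eq_real_of_nat)
qed

lemma norm_powr_AE_le:
  assumes "M < \<top>" "AE x in torus d. ennreal (norm (g x)) \<le> M" "0 < a"
  shows "power_integral d a g \<le> ennreal (enn2real M powr a)"
proof -
  interpret prob_space "torus d" by (rule prob_space_torus)
  have "power_integral d a g \<le> (\<integral>\<^sup>+ x. ennreal (enn2real M powr a) \<partial>torus d)"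
    unfolding power_integral_def
  proof (intro nn_integral_mono_AE)
    show "AE x in torus d. ennreal (norm (g x) powr a) \<le> ennreal (enn2real M powr a)"
      using assms(2)
    proof eventually_elim
      case (elim x)
      then have "norm (g x) \<le> enn2real M" using enn2real_mono[OF elim assms(1)] by simp
      then show ?case using assms(3) by (intro ennreal_leI powr_mono2) auto
    qed
  qed
  then show ?thesis by (simp add: emeasure_space_1)
qed

text \<open>Monotonicity in the exponent for a measure of total mass 1. The factor 2 is the price of
  an elementary pointwise comparison in place of Hoelder's inequality.\<close>

lemma Lp_norm_mono_exponent:
  assumes q: "1 \<le> q" "q \<le> p" "q < \<top>" and [measurable]: "g \<in> borel_measurable (torus d)"
  shows "Lp_norm d q g \<le> 2 * Lp_norm d p g"
proof (cases "Lp_norm d p g = \<top>")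
  case True
  then show ?thesis by (simp add: ennreal_mult_top)
next
  case fin: False
  interpret prob_space "torus d" by (rule prob_space_torus)
  let ?q = "enn2real q"
  have q1: "1 \<le> ?q" by (rule enn2real_ge_1[OF q(1,3)])
  show ?thesis
  proof (cases "p = \<top>")
    case True
    let ?M = "Lp_norm d p g"
    have "AE x in torus d. ennreal (norm (g x)) \<le> ?M"
      using True esssup_AE by (auto simp: Lp_norm_def)
    then have "power_integral d ?q g \<le> ennreal (enn2real ?M powr ?q)"
      using fin q1 by (intro norm_powr_AE_le) (auto simp: less_top)
    then have "Lp_norm d q g \<le> epow (ennreal (enn2real ?M powr ?q)) (1 / ?q)"
      unfolding Lp_norm_finite_exponent[OF q(3)] using q1 by (intro epow_mono) auto
    also have "\<dots> = ?M" using q1 fin by (simp add: epow_ennreal powr_powr less_top)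
    also have "\<dots> \<le> 2 * ?M" using mult_right_mono[of 1 2 ?M] by simp
    finally show ?thesis .
  next
    case False
    then have p: "1 \<le> p" "p < \<top>" using q by (auto simp: less_top)
    let ?p = "enn2real p"
    have p1: "1 \<le> ?p" by (rule enn2real_ge_1[OF p])
    have qp: "?q \<le> ?p" using q p by (intro enn2real_mono) auto
    define A where "A = power_integral d ?p g"
    have A: "A \<noteq> \<top>" using fin by (auto simp: Lp_norm_finite_exponent[OF p(2)] A_def epow_def)
    show ?thesis
    proof (cases "A = 0")
      case True
      have "AE x in torus d. ennreal (norm (g x) powr ?p) = 0"
        using True unfolding A_def power_integral_def by (subst (asm) nn_integral_0_iff_AE) auto
      then have "AE x in torus d. ennreal (norm (g x) powr ?q) = 0"
        by eventually_elim (auto simp: ennreal_eq_0_iff)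
      then have "power_integral d ?q g = 0"
        unfolding power_integral_def by (subst nn_integral_0_iff_AE) auto
      then show ?thesis using q1 by (simp add: Lp_norm_finite_exponent[OF q(3)] epow_def)
    next
      case False
      define a where "a = enn2real A"
      have a: "a > 0" "A = ennreal a" using A False by (auto simp: a_def enn2real_positive_iff less_top zero_less_iff_neq_zero)
      \<comment> \<open>\<open>L\<close> is the \<open>p\<close>-norm of \<open>g\<close>. Values up
        to \<open>L\<close> contribute at most \<open>L powr ?q\<close>; larger ones are dominated
        by their p-th power times \<open>L powr (?q - ?p)\<close>. Each part integrates to at most
        \<open>L powr ?q\<close>.\<close>
      define L where "L = a powr (1 / ?p)"
      have l: "L > 0" using a by (simp add: L_def)
      have lp: "L powr ?p = a" using a p1 by (simp add: L_def powr_powr)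
      have pw: "v powr ?q \<le> L powr ?q + L powr (?q - ?p) * v powr ?p" if "v \<ge> 0" for v
      proof (cases "v \<le> L")
        case True
        then have "v powr ?q \<le> L powr ?q" using that q1 by (intro powr_mono2) auto
        then show ?thesis by (smt (verit) mult_nonneg_nonneg powr_ge_zero)
      next
        case False
        then have v: "v > 0" "L \<le> v" using l by auto
        have "v powr ?q = v powr (?q - ?p) * v powr ?p" using v by (simp flip: powr_add)
        also have "\<dots> \<le> L powr (?q - ?p) * v powr ?p"
          using v l qp by (intro mult_right_mono powr_mono2') auto
        finally show ?thesis by (smt (verit) powr_ge_zero)
      qed
      have "power_integral d ?q g \<le> (\<integral>\<^sup>+ x. ennreal (L powr ?q) + ennreal (L powr (?q - ?p)) * ennreal (norm (g x) powr ?p) \<partial>torus d)"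
        unfolding power_integral_def using pw
        by (intro nn_integral_mono) (simp flip: ennreal_mult ennreal_plus)
      also have "\<dots> = ennreal (L powr ?q) + ennreal (L powr (?q - ?p)) * A"
        unfolding A_def power_integral_def
        by (subst nn_integral_add, simp, measurable, subst nn_integral_cmult, auto simp: emeasure_space_1)
      also have "\<dots> = ennreal (L powr ?q + L powr (?q - ?p) * L powr ?p)"
        unfolding a(2) lp using a by (simp add: ennreal_mult)
      also have "L powr ?q + L powr (?q - ?p) * L powr ?p = 2 * L powr ?q"
        using l by (simp flip: powr_add)
      finally have "Lp_norm d q g \<le> epow (ennreal (2 * L powr ?q)) (1 / ?q)"
        unfolding Lp_norm_finite_exponent[OF q(3)] using q1 by (intro epow_mono) auto
      also have "\<dots> = ennreal (2 powr (1 / ?q) * L)"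
        using l q1 by (simp add: epow_ennreal powr_mult powr_powr)
      also have "\<dots> \<le> ennreal (2 * L)"
      proof (intro ennreal_leI mult_right_mono)
        have "(2::real) powr (1 / ?q) \<le> 2 powr 1" using q1 by (intro powr_mono) auto
        then show "(2::real) powr (1 / ?q) \<le> 2" by simp
      qed (use l in simp)
      also have "\<dots> = 2 * Lp_norm d p g"
        unfolding Lp_norm_finite_exponent[OF p(2)] A_def[symmetric] a(2) using a l
        by (simp add: epow_ennreal L_def ennreal_mult)
      finally show ?thesis .
    qed
  qed
qed

lemma Lp_integrable:
  assumes "f \<in> Lp d p" "1 \<le> p"
  shows "integrable (torus d) f"
proof -
  have [measurable]: "f \<in> borel_measurable (torus d)" and fin: "Lp_norm d p f < \<top>"
    using assms by (auto simp: Lp_def)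
  have "Lp_norm d 1 f \<le> 2 * Lp_norm d p f" using assms by (intro Lp_norm_mono_exponent) auto
  also have "\<dots> < \<top>" using fin by (simp add: ennreal_mult_less_top)
  finally have "power_integral d 1 f < \<top>"
    by (auto simp: Lp_norm_finite_exponent epow_def less_top split: if_splits)
  then show ?thesis by (intro integrableI_bounded) (auto simp: power_integral_def)
qed

lemma Lp_norm_diff_finite:
  assumes q: "1 \<le> q" and f: "f \<in> borel_measurable (torus d)" "Lp_norm d q f < \<top>"
  shows "Lp_norm d q (\<lambda>x. f x - tpoly d K c x) < \<top>"
proof -
  note [measurable] = f(1)
  define B where "B = (\<Sum>k\<in>K. norm (c k))"
  have B: "norm (tpoly d K c x) \<le> B" for x using norm_tpoly_le by (simp add: B_def)
  show ?thesis
  proof (cases "q = \<top>")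
    case True
    have "AE x in torus d. ennreal (norm (f x - tpoly d K c x)) \<le> Lp_norm d q f + ennreal B"
    proof -
      have "AE x in torus d. ennreal (norm (f x)) \<le> Lp_norm d q f"
        using True esssup_AE by (auto simp: Lp_norm_def)
      then show ?thesis
      proof eventually_elim
        case (elim x)
        have "ennreal (norm (f x - tpoly d K c x)) \<le> ennreal (norm (f x) + B)"
          using B norm_triangle_ineq4[of "f x" "tpoly d K c x"] by (intro ennreal_leI) (smt (verit))
        also have "\<dots> = ennreal (norm (f x)) + ennreal B"
          by (rule ennreal_plus) (auto simp: B_def sum_nonneg)
        finally show ?case using elim by (meson add_right_mono order_trans)
      qed
    qed
    then have "esssup (torus d) (\<lambda>x. ennreal (norm (f x - tpoly d K c x))) \<le> Lp_norm d q f + ennreal B"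
      by (intro esssup_I) auto
    then show ?thesis using True f(2) by (auto simp: Lp_norm_def intro: order_le_less_trans)
  next
    case False
    then have q': "1 \<le> q" "q < \<top>" using q by (auto simp: less_top)
    let ?g = "\<lambda>i::nat. \<lambda>x. if i = 0 then f x else tpoly d K (\<lambda>k. - c k) x"
    have eq: "(\<lambda>x. \<Sum>i\<in>{0,1}. ?g i x) = (\<lambda>x. f x - tpoly d K c x)"
      by (simp add: fun_eq_iff tpoly_def sum_negf)
    have "Lp_norm d q (\<lambda>x. \<Sum>i\<in>{0,1}. ?g i x) \<le> of_nat (card {0::nat,1}) * (\<Sum>i\<in>{0,1}. Lp_norm d q (?g i))"
      using q' by (intro Lp_norm_sum_le) auto
    then have "Lp_norm d q (\<lambda>x. f x - tpoly d K c x) \<le> 2 * (Lp_norm d q f + Lp_norm d q (tpoly d K (\<lambda>k. - c k)))"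
      unfolding eq by simp
    moreover have "Lp_norm d q (tpoly d K (\<lambda>k. - c k)) < \<top>"
    proof -
      have "power_integral d (enn2real q) (tpoly d K (\<lambda>k. - c k)) \<le> ennreal (enn2real (ennreal B) powr enn2real q)"
        using enn2real_ge_1[OF q'] norm_tpoly_le[of d K "\<lambda>k. - c k"]
        by (intro norm_powr_AE_le) (auto simp: B_def intro!: ennreal_leI)
      then show ?thesis unfolding Lp_norm_finite_exponent[OF q'(2)]
        by (auto simp: epow_def top_unique)
    qed
    ultimately show ?thesis using f(2)
      by (elim order_le_less_trans) (simp add: ennreal_mult_less_top)
  qed
qed

lemma Lp_norm_zero [simp]: "1 \<le> q \<Longrightarrow> Lp_norm d q (\<lambda>x. 0) = 0"
proof -
  assume q: "1 \<le> q"
  have "esssup (torus d) (\<lambda>x. 0 :: ennreal) \<le> 0" by (rule esssup_I) auto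
  then show ?thesis
    by (auto simp: Lp_norm_def epow_def)
qed

lemma Lp_norm_const_norm:
  assumes "1 \<le> q" "0 \<le> a" and [measurable]: "g \<in> borel_measurable (torus d)" and "\<And>x. norm (g x) = a"
  shows "Lp_norm d q g = ennreal a"
proof -
  interpret prob_space "torus d" by (rule prob_space_torus)
  show ?thesis
  proof (cases "q = \<top>")
    case True
    have "emeasure (torus d) (space (torus d)) \<noteq> 0" by (simp add: emeasure_space_1)
    from esssup_const[OF this, of "ennreal a"] show ?thesis using True assms by (simp add: Lp_norm_def)
  next
    case False
    then have "1 \<le> enn2real q" using assms by (intro enn2real_ge_1) (auto simp: less_top)
    then show ?thesis using False assms
      by (simp add: Lp_norm_def emeasure_space_1 epow_ennreal powr_powr)
  qed
qed

section \<open>The spaces \<open>L\<^sub>p\<^sup>0\<close>\<close>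

lemma character_upd:
  assumes "j \<in> {1..d}"
  shows "character d k (x(j := t)) = (\<Prod>i\<in>{1..d}-{j}. cis (of_int (k i) * x i)) * cis (of_int (k j) * t)"
  unfolding character_prod prod.remove[OF finite_atLeastAtMost assms] by (auto intro!: prod.cong)

lemma tpoly_periodic: "periodic d (tpoly d K c)"
proof -
  have "character d k (x(j := x j + 2 * pi)) = character d k x" if "j \<in> {1..d}" for k x j
  proof -
    have "cis (of_int (k j) * (x j + 2 * pi)) = cis (of_int (k j) * x j)"
      using cis_multiple_2pi[of "of_int (k j)"] by (simp add: distrib_left cis_mult[symmetric] mult_ac)
    then show ?thesis
      using character_upd[OF that, of k x "x j + 2 * pi"] character_upd[OF that, of k x "x j"] by simp
  qed
  then show ?thesis by (simp add: periodic_def tpoly_def)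
qed

lemma tpoly_section_integral:
  assumes j: "j \<in> {1..d}" and nz: "\<And>k. k \<in> K \<Longrightarrow> k j \<noteq> 0"
  shows "set_integrable lborel {0..2*pi} (\<lambda>t. tpoly d K c (x(j := t)))"
    and "(LBINT t:{0..2*pi}. tpoly d K c (x(j := t))) = 0"
proof -
  have eq: "tpoly d K c (x(j := t)) = (\<Sum>k\<in>K. (c k * (\<Prod>i\<in>{1..d}-{j}. cis (of_int (k i) * x i))) * cis (of_int (k j) * t))" for t
    by (simp add: tpoly_def character_upd[OF j] mult_ac)
  have I: "set_integrable lborel {0..2*pi} (\<lambda>t. b * cis (of_int n * t))" for b n
    using set_integral_cis(1) by (rule set_integrable_mult_right)
  show "set_integrable lborel {0..2*pi} (\<lambda>t. tpoly d K c (x(j := t)))"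
    unfolding eq using I unfolding set_integrable_def scaleR_sum_right
    by (intro Bochner_Integration.integrable_sum) auto
  have "(LBINT t:{0..2*pi}. tpoly d K c (x(j := t)))
    = (\<Sum>k\<in>K. LBINT t:{0..2*pi}. (c k * (\<Prod>i\<in>{1..d}-{j}. cis (of_int (k i) * x i))) * cis (of_int (k j) * t))"
    unfolding eq set_lebesgue_integral_def scaleR_sum_right
    using I unfolding set_integrable_def by (intro Bochner_Integration.integral_sum) auto
  also have "\<dots> = 0" using nz by (simp add: set_integral_cis)
  finally show "(LBINT t:{0..2*pi}. tpoly d K c (x(j := t))) = 0" .
qed

lemma Lp0_diff_tpoly:
  assumes q: "1 \<le> q" and f: "f \<in> Lp0 d q" and nz: "\<And>k j. k \<in> K \<Longrightarrow> j \<in> {1..d} \<Longrightarrow> k j \<noteq> 0"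
  shows "(\<lambda>x. f x - tpoly d K c x) \<in> Lp0 d q"
proof -
  have [measurable]: "f \<in> borel_measurable (torus d)" and per: "periodic d f" and fin: "Lp_norm d q f < \<top>"
    and mean: "\<And>j. j \<in> {1..d} \<Longrightarrow> AE x in torus d. (LBINT t:{0..2 * pi}. f (x(j := t))) = 0"
    using f by (auto simp: Lp0_def Lp_def)
  have "AE x in torus d. (LBINT t:{0..2 * pi}. f (x(j := t)) - tpoly d K c (x(j := t))) = 0" if j: "j \<in> {1..d}" for j
    using mean[OF j]
  proof eventually_elim
    case (elim x)
    have S: "set_integrable lborel {0..2*pi} (\<lambda>t. tpoly d K c (x(j := t)))"
      "(LBINT t:{0..2*pi}. tpoly d K c (x(j := t))) = 0"
      by (intro tpoly_section_integral j nz; assumption)+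
    show ?case
    proof (cases "set_integrable lborel {0..2*pi} (\<lambda>t. f (x(j := t)))")
      case True
      then show ?thesis using elim S by (simp add: set_integral_diff)
    next
      case False
      \<comment> \<open>A section integral may be 0 merely as the default for a non-integrable
        section. Subtracting an integrable polynomial leaves the section non-integrable, so the
        value stays 0.\<close>
      have "\<not> set_integrable lborel {0..2*pi} (\<lambda>t. f (x(j := t)) - tpoly d K c (x(j := t)))"
      proof
        assume "set_integrable lborel {0..2*pi} (\<lambda>t. f (x(j := t)) - tpoly d K c (x(j := t)))"
        from set_integral_add(1)[OF this S(1)] False show False by simp
      qed
      then show ?thesis
        unfolding set_lebesgue_integral_def set_integrable_def by (rule not_integrable_integral_eq)
    qed
  qed
  moreover have "periodic d (\<lambda>x. f x - tpoly d K c x)"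
    using per tpoly_periodic[of d K c] by (simp add: periodic_def)
  ultimately show ?thesis using Lp_norm_diff_finite[OF q _ fin, of K c] by (auto simp: Lp0_def Lp_def)
qed

lemma tpoly_Lp0:
  assumes q: "1 \<le> q" and nz: "\<And>k j. k \<in> K \<Longrightarrow> j \<in> {1..d} \<Longrightarrow> k j \<noteq> 0"
  shows "tpoly d K c \<in> Lp0 d q"
proof -
  have "(\<lambda>x. 0) \<in> Lp0 d q"
    using q by (auto simp: Lp0_def Lp_def periodic_def set_lebesgue_integral_def)
  from Lp0_diff_tpoly[OF q this, of K "\<lambda>k. - c k"] nz
  show ?thesis by (simp add: tpoly_def[abs_def] sum_negf)
qed

lemma Lp0_mono_exponent:
  assumes "1 \<le> q" "q \<le> p" "q < \<top>" "f \<in> Lp0 d p"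
  shows "f \<in> Lp0 d q"
proof -
  have "f \<in> borel_measurable (torus d)" "Lp_norm d p f < \<top>" using assms by (auto simp: Lp0_def Lp_def)
  then have "Lp_norm d q f < \<top>"
    using Lp_norm_mono_exponent[OF assms(1-3), of f d] by (auto simp: ennreal_mult_less_top intro: order_le_less_trans)
  with assms(4) show ?thesis by (auto simp: Lp0_def Lp_def)
qed

text \<open>An infinite nonnegative sum is the supremum of its finite partial sums. Through this,
  both the class norm and the \<open>B_{q,1}\<close> norm are handled by finite sets of
  blocks.\<close>

lemma infsum_ennreal_le_iff:
  fixes f :: "'a \<Rightarrow> ennreal"
  shows "infsum f A \<le> c \<longleftrightarrow> (\<forall>F. finite F \<and> F \<subseteq> A \<longrightarrow> sum f F \<le> c)"
proof -
  have "infsum f A = (SUP F\<in>{F. finite F \<and> F \<subseteq> A}. sum f F)"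
    by (rule nonneg_infsum_complete) simp
  then show ?thesis by (simp add: SUP_le_iff)
qed

lemma epow_le_1D: "epow X a \<le> 1 \<Longrightarrow> a > 0 \<Longrightarrow> X \<le> 1"
proof -
  assume le: "epow X a \<le> 1" and a: "a > 0"
  have X: "X \<noteq> \<top>" using le by (auto simp: epow_def top_unique)
  then obtain x where x: "X = ennreal x" "x \<ge> 0" by (metis ennreal_cases)
  have "x powr a \<le> 1" using le x by (simp add: epow_ennreal)
  have "x \<le> 1"
  proof (rule ccontr)
    assume "\<not> x \<le> 1"
    then have "1 powr a < x powr a" using a by (intro powr_less_mono2) auto
    with \<open>x powr a \<le> 1\<close> show False by simp
  qed
  then show ?thesis using x by simp
qed

lemma enn2real_one_divide:
  assumes "1 \<le> \<theta>" "\<theta> < \<top>"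
  shows "enn2real (1 / \<theta>) = 1 / enn2real \<theta>"
proof -
  have "\<theta> = ennreal (enn2real \<theta>)" using assms by (simp add: less_top)
  moreover have "1 \<le> enn2real \<theta>" by (rule enn2real_ge_1[OF assms])
  ultimately have "1 / \<theta> = ennreal (1 / enn2real \<theta>)"
    using divide_ennreal[of 1 "enn2real \<theta>"] by simp
  then show ?thesis by simp
qed

section \<open>Sums over the complement of a hyperbolic cross\<close>

text \<open>\<open>\<beta>\<close> is the vector \<open>\<gamma>'\<close> of the theorem, and the
  strict inequality \<open>\<gamma>' < \<gamma>\<close> appears multiplied by
  \<open>r 1\<close>.\<close>

locale cross_params =
  fixes d \<nu> :: nat and r \<beta> :: "nat \<Rightarrow> real"
  assumes \<nu>: "1 \<le> \<nu>" "\<nu> \<le> d"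
    and r1: "0 < r 1" "\<And>j. j \<in> {1..\<nu>} \<Longrightarrow> r j = r 1"
    and \<beta>_low: "\<And>j. j \<in> {1..\<nu>} \<Longrightarrow> \<beta> j = 1"
    and \<beta>_high: "\<And>j. j \<in> {\<nu>+1..d} \<Longrightarrow> 1 < \<beta> j \<and> r 1 * \<beta> j < r j"
begin

lemma \<beta>_ge_1: "j \<in> {1..d} \<Longrightarrow> 1 \<le> \<beta> j"
  using \<beta>_low[of j] \<beta>_high[of j] by (cases "j \<le> \<nu>") auto

lemma gap:
  obtains \<epsilon> where "\<epsilon> > 0" "\<And>j. j \<in> {\<nu>+1..d} \<Longrightarrow> r 1 * (\<beta> j + \<epsilon>) \<le> r j"
proof -
  \<comment> \<open>Inserting 1 keeps the minimum defined when \<open>\<nu> = d\<close>.\<close>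
  define \<epsilon> where "\<epsilon> = Min (insert 1 ((\<lambda>j. r j / r 1 - \<beta> j) ` {\<nu>+1..d}))"
  have "\<epsilon> > 0" unfolding \<epsilon>_def using \<beta>_high r1(1) by (subst Min_gr_iff) (auto simp: field_simps)
  moreover have "r 1 * (\<beta> j + \<epsilon>) \<le> r j" if "j \<in> {\<nu>+1..d}" for j
  proof -
    have "\<epsilon> \<le> r j / r 1 - \<beta> j" unfolding \<epsilon>_def using that by (intro Min_le) auto
    then show ?thesis using r1(1) by (simp add: field_simps)
  qed
  ultimately show thesis using that by blast
qed

lemma dot_r_ge: "r 1 * dot d (\<lambda>j. real (s j)) \<beta> \<le> dot d (\<lambda>j. real (s j)) r"
  unfolding dot_def sum_distrib_left
proof (rule sum_mono)
  fix j assume j: "j \<in> {1..d}"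
  have "r 1 * \<beta> j \<le> r j"
  proof (cases "j \<le> \<nu>")
    case True
    then show ?thesis using r1(2)[of j] \<beta>_low[of j] j by simp
  next
    case False
    then show ?thesis using \<beta>_high[of j] j by simp
  qed
  then have "real (s j) * (r 1 * \<beta> j) \<le> real (s j) * r j" by (intro mult_left_mono) auto
  then show "r 1 * (real (s j) * \<beta> j) \<le> real (s j) * r j" by (simp add: mult_ac)
qed

text \<open>
  Replacing \<open>s\<^sub>1\<close> by (a shift of) \<open>\<lfloor>(s,\<beta>)\<rfloor>\<close> is injective because \<open>\<beta>\<^sub>1 = 1\<close>; in the new
  variables the weight is dominated by a product of one-dimensional weights.
\<close>
lemma tail_sum:
  fixes \<tau> :: real and c :: nat
  assumes \<tau>: "\<tau> > 0"
  obtains C where "C > 0" "\<And>n G. 1 \<le> n \<Longrightarrow> finite G \<Longrightarrow> G \<subseteq> block_indices d \<Longrightarrow>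
      (\<And>s. s \<in> G \<Longrightarrow> real n \<le> dot d (\<lambda>j. real (s j)) \<beta> + real c) \<Longrightarrow>
      (\<Sum>s\<in>G. 2 powr (- \<tau> * dot d (\<lambda>j. real (s j)) r)) \<le> C * 2 powr (- \<tau> * r 1 * real n) * real n ^ (\<nu> - 1)"
proof -
  obtain \<epsilon> where \<epsilon>: "\<epsilon> > 0" "\<And>j. j \<in> {\<nu>+1..d} \<Longrightarrow> r 1 * (\<beta> j + \<epsilon>) \<le> r j" by (rule gap) auto
  define a where "a = \<tau> * r 1"
  have a: "a > 0" using \<tau> r1 by (simp add: a_def)
  have d: "d > 0" using \<nu> by linarith
  \<comment> \<open>A decay rate valid in all coordinates: the surplus \<open>a * (m s - n)\<close>
    is shared equally among the \<open>d\<close> coordinates, while a coordinate beyond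
    \<open>\<nu>\<close> decays at rate \<open>a * \<epsilon>\<close> thanks to the gap.\<close>
  define b where "b = min (a / real d) (a * \<epsilon>)"
  have b: "b > 0" using a \<epsilon> d by (simp add: b_def)
  define x where "x = (2::real) powr (- b)"
  have x: "0 < x" "x < 1" using b by (auto simp: x_def powr_less_one)
  define S where "S = 1 / (1 - x)"
  have S: "S > 0" using x by (simp add: S_def)
  have geo: "(\<Sum>t<N. x ^ t) \<le> S" for N
  proof -
    have "(\<Sum>t<N. x ^ t) = (1 - x ^ N) / (1 - x)" using x by (simp add: sum_gp_strict)
    also have "\<dots> \<le> S" unfolding S_def using x by (intro divide_right_mono) auto
    finally show ?thesis .
  qed
  define C where "C = 2 powr (a * real c) * (1 + S) ^ d"
  have "C > 0" using S by (simp add: C_def)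
  moreover have "(\<Sum>s\<in>G. 2 powr (- \<tau> * dot d (\<lambda>j. real (s j)) r)) \<le> C * 2 powr (- \<tau> * r 1 * real n) * real n ^ (\<nu> - 1)"
    if n: "1 \<le> n" and G: "finite G" "G \<subseteq> block_indices d"
      and far: "\<And>s. s \<in> G \<Longrightarrow> real n \<le> dot d (\<lambda>j. real (s j)) \<beta> + real c" for n G
  proof -
    define D where "D = (\<lambda>s::nat \<Rightarrow> nat. dot d (\<lambda>j. real (s j)) \<beta>)"
    \<comment> \<open>The shift by \<open>c\<close> ensures \<open>n \<le> m s\<close> on
      \<open>G\<close>, although an index may lie up to \<open>c\<close> below the boundary of the
      cross.\<close>
    define m where "m = (\<lambda>s. nat \<lfloor>D s\<rfloor> + c)"
    define \<Phi> where "\<Phi> = (\<lambda>s::nat \<Rightarrow> nat. s(1 := m s))"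
    \<comment> \<open>Subtraction of naturals is truncated: for \<open>2 \<le> j \<le> \<nu>\<close>
      the weight is 1 up to \<open>n\<close> and geometric afterwards, so each of these
      \<open>\<nu> - 1\<close> coordinates sums to order \<open>n\<close>. All other coordinates
      have bounded sums.\<close>
    define \<phi> where "\<phi> = (\<lambda>j t. if j = 1 then (if n \<le> t then x ^ (t - n) else 0) else if j \<le> \<nu> then x ^ (t - n) else x ^ t)"
    have D0: "D s \<ge> 0" for s unfolding D_def dot_def using \<beta>_ge_1 by (intro sum_nonneg) force
    have sD: "real (s j) \<le> D s" if j: "j \<in> {1..d}" for s j
    proof -
      have "real (s j) * 1 \<le> real (s j) * \<beta> j" using \<beta>_ge_1[OF j] by (intro mult_left_mono) auto
      also have "\<dots> \<le> D s"
        unfolding D_def dot_def using j \<beta>_ge_1 by (intro member_le_sum[where f="\<lambda>j. real (s j) * \<beta> j"]) force+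
      finally show ?thesis by simp
    qed
    have sm: "s j \<le> m s" if j: "j \<in> {1..d}" for s j
    proof -
      have "int (s j) \<le> \<lfloor>D s\<rfloor>" using sD[OF j, of s] by (simp add: le_floor_iff)
      then show ?thesis by (simp add: m_def)
    qed
    have mD: "real (m s) \<le> D s + real c" for s
      using D0[of s] by (simp add: m_def)
    have nm: "n \<le> m s" if "s \<in> G" for s
    proof -
      have "real n \<le> D s + real c" using far[OF that] by (simp add: D_def)
      then have "int n - int c \<le> \<lfloor>D s\<rfloor>" by (simp add: le_floor_iff)
      then show ?thesis unfolding m_def by linarith
    qed
    have weight: "2 powr (- \<tau> * dot d (\<lambda>j. real (s j)) r)
        \<le> 2 powr (a * real c) * 2 powr (- a * real n) * (\<Prod>j=1..d. \<phi> j (\<Phi> s j))" if s: "s \<in> G" for s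
    proof -
      define \<eta> where "\<eta> = (\<lambda>j. if j = 1 then m s - n else if j \<le> \<nu> then s j - n else s j)"
      have "(\<Prod>j=1..d. \<phi> j (\<Phi> s j)) = (\<Prod>j=1..d. x ^ \<eta> j)"
        using nm[OF s] by (intro prod.cong) (auto simp: \<phi>_def \<Phi>_def \<eta>_def)
      also have "\<dots> = x ^ (\<Sum>j=1..d. \<eta> j)" by (simp add: power_sum)
      also have "\<dots> = 2 powr (- (b * (\<Sum>j=1..d. real (\<eta> j))))"
        using x(1) by (simp add: x_def powr_powr mult.commute flip: powr_realpow)
      finally have prod: "(\<Prod>j=1..d. \<phi> j (\<Phi> s j)) = 2 powr (- (b * (\<Sum>j=1..d. real (\<eta> j))))" .
      have mn: "real (m s - n) = real (m s) - real n" using nm[OF s] by (simp add: of_nat_diff)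
      have key: "b * real (\<eta> j) + a * (real (s j) * \<beta> j) \<le> a / real d * real (m s - n) + \<tau> * (real (s j) * r j)"
        if j: "j \<in> {1..d}" for j
      proof (cases "j \<le> \<nu>")
        case True
        then have "\<eta> j \<le> m s - n" using sm[OF j, of s] by (auto simp: \<eta>_def)
        then have "b * real (\<eta> j) \<le> a / real d * real (m s - n)"
          using b a d by (intro mult_mono) (auto simp: b_def)
        moreover have "a * (real (s j) * \<beta> j) = \<tau> * (real (s j) * r j)"
          using True j \<beta>_low[of j] r1(2)[of j] by (simp add: a_def)
        ultimately show ?thesis by linarith
      next
        case False
        then have \<eta>j: "\<eta> j = s j" using \<nu> by (auto simp: \<eta>_def)
        have "b * real (s j) \<le> a * \<epsilon> * real (s j)" by (intro mult_right_mono) (auto simp: b_def)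
        moreover have "\<tau> * real (s j) * (r 1 * (\<beta> j + \<epsilon>)) \<le> \<tau> * real (s j) * r j"
          using \<epsilon>(2)[of j] False j \<tau> by (intro mult_left_mono) auto
        then have "a * \<epsilon> * real (s j) + a * (real (s j) * \<beta> j) \<le> \<tau> * (real (s j) * r j)"
          by (simp add: a_def algebra_simps)
        moreover have "0 \<le> a / real d * real (m s - n)" using a by simp
        ultimately show ?thesis unfolding \<eta>j by linarith
      qed
      have "b * (\<Sum>j=1..d. real (\<eta> j)) + a * D s
        = (\<Sum>j=1..d. b * real (\<eta> j) + a * (real (s j) * \<beta> j))"
        by (simp add: D_def dot_def sum.distrib sum_distrib_left)
      also have "\<dots> \<le> (\<Sum>j=1..d. a / real d * real (m s - n) + \<tau> * (real (s j) * r j))"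
        by (intro sum_mono key)
      also have "\<dots> = a * real (m s - n) + \<tau> * dot d (\<lambda>j. real (s j)) r"
        using d by (simp add: dot_def sum.distrib sum_distrib_left)
      finally have "b * (\<Sum>j=1..d. real (\<eta> j)) + a * D s \<le> a * (real (m s) - real n) + \<tau> * dot d (\<lambda>j. real (s j)) r"
        unfolding mn .
      moreover have "a * real (m s) \<le> a * (D s + real c)" using mD[of s] a by (intro mult_left_mono) auto
      ultimately have "- \<tau> * dot d (\<lambda>j. real (s j)) r \<le> a * real c + - a * real n + - (b * (\<Sum>j=1..d. real (\<eta> j)))"
        by (simp add: algebra_simps)
      then show ?thesis unfolding prod powr_add[symmetric] by (intro powr_mono) auto
    qed
    have inj: "inj_on \<Phi> G"
    proof (rule inj_onI)
      fix s s' assume s: "s \<in> G" "s' \<in> G" and eq: "\<Phi> s = \<Phi> s'"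
      have other: "s j = s' j" if "j \<noteq> 1" for j using fun_cong[OF eq, of j] that by (simp add: \<Phi>_def)
      have split: "D s = real (s 1) + (\<Sum>j\<in>{1..d}-{1}. real (s j) * \<beta> j)" for s
        unfolding D_def dot_def using \<beta>_low[of 1] \<nu> by (subst sum.remove[of _ 1]) auto
      have "(\<Sum>j\<in>{1..d}-{1}. real (s j) * \<beta> j) = (\<Sum>j\<in>{1..d}-{1}. real (s' j) * \<beta> j)"
        by (intro sum.cong) (auto simp: other)
      then have DD: "D s' = D s + of_int (int (s' 1) - int (s 1))" unfolding split by simp
      have "m s = m s'" using fun_cong[OF eq, of 1] by (simp add: \<Phi>_def)
      then have "\<lfloor>D s\<rfloor> = \<lfloor>D s'\<rfloor>"
        using D0[of s] D0[of s'] by (simp add: m_def eq_nat_nat_iff)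
      then have "s 1 = s' 1" unfolding DD floor_add_int[symmetric] by linarith
      with other show "s = s'" by (metis ext)
    qed
    define N where "N = Suc (Max (insert 0 ((\<lambda>(s, j). \<Phi> s j) ` (G \<times> {1..d}))))"
    have N: "\<Phi> s j < N" if "s \<in> G" "j \<in> {1..d}" for s j
    proof -
      have "(\<lambda>(s, j). \<Phi> s j) (s, j) \<in> (\<lambda>(s, j). \<Phi> s j) ` (G \<times> {1..d})"
        using that by (intro imageI) auto
      then have "\<Phi> s j \<le> Max (insert 0 ((\<lambda>(s, j). \<Phi> s j) ` (G \<times> {1..d})))"
        using G(1) by (intro Max_ge) auto
      then show ?thesis by (simp add: N_def)
    qed
    have sub: "\<Phi> ` G \<subseteq> {1..d} \<rightarrow>\<^sub>E {..<N}"
    proof (rule image_subsetI)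
      fix s assume s: "s \<in> G"
      then have "s \<in> extensional {1..d}" using G(2) by (auto simp: block_indices_def PiE_iff)
      then have "\<Phi> s \<in> extensional {1..d}" using d by (auto simp: \<Phi>_def extensional_def)
      then show "\<Phi> s \<in> {1..d} \<rightarrow>\<^sub>E {..<N}" using N[OF s] by (auto simp: PiE_iff)
    qed
    have \<phi>0: "\<phi> j t \<ge> 0" for j t using x by (auto simp: \<phi>_def)
    have one: "(\<Sum>t<N. \<phi> j t) \<le> (1 + S) * (if j \<in> {2..\<nu>} then real n else 1)" if j: "j \<in> {1..d}" for j
    proof -
      have shift: "(\<Sum>t\<in>{n..<N}. x ^ (t - n)) \<le> S"
      proof -
        have "(\<Sum>t\<in>{n..<N}. x ^ (t - n)) = (\<Sum>t<N - n. x ^ t)"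
          by (rule sum.reindex_bij_witness[of _ "\<lambda>t. t + n" "\<lambda>t. t - n"]) auto
        then show ?thesis using geo by simp
      qed
      consider "j = 1" | "j \<noteq> 1" "j \<le> \<nu>" | "j > \<nu>" by linarith
      then show ?thesis
      proof cases
        case 1
        have "(\<Sum>t<N. \<phi> j t) = (\<Sum>t\<in>{t\<in>{..<N}. n \<le> t}. x ^ (t - n))"
          using 1 by (subst sum.inter_filter) (auto simp: \<phi>_def)
        also have "{t\<in>{..<N}. n \<le> t} = {n..<N}" by auto
        finally show ?thesis using shift 1 by auto
      next
        case 2
        have "(\<Sum>t<N. \<phi> j t) = (\<Sum>t<N. x ^ (t - n))" using 2 by (simp add: \<phi>_def)
        also have "\<dots> \<le> (\<Sum>t\<in>{..<n} \<union> {n..<N}. x ^ (t - n))"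
          using x by (intro sum_mono2) auto
        also have "\<dots> = real n + (\<Sum>t\<in>{n..<N}. x ^ (t - n))"
          by (subst sum.union_disjoint) auto
        also have "\<dots> \<le> real n + S" using shift by simp
        also have "\<dots> \<le> (1 + S) * real n" using n S by (simp add: algebra_simps)
        finally show ?thesis using 2 j by auto
      next
        case 3
        have "(\<Sum>t<N. \<phi> j t) = (\<Sum>t<N. x ^ t)" using 3 \<nu> by (auto simp: \<phi>_def)
        then show ?thesis using geo[of N] 3 by simp
      qed
    qed
    have "(\<Sum>s\<in>G. 2 powr (- \<tau> * dot d (\<lambda>j. real (s j)) r))
      \<le> (\<Sum>s\<in>G. 2 powr (a * real c) * 2 powr (- a * real n) * (\<Prod>j=1..d. \<phi> j (\<Phi> s j)))"
      by (intro sum_mono weight)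
    also have "\<dots> = 2 powr (a * real c) * 2 powr (- a * real n) * (\<Sum>g\<in>\<Phi> ` G. \<Prod>j=1..d. \<phi> j (g j))"
      by (simp add: sum_distrib_left sum.reindex[OF inj])
    also have "\<dots> \<le> 2 powr (a * real c) * 2 powr (- a * real n) * (\<Sum>g\<in>{1..d} \<rightarrow>\<^sub>E {..<N}. \<Prod>j=1..d. \<phi> j (g j))"
      using sub \<phi>0 by (intro mult_left_mono sum_mono2 finite_PiE prod_nonneg) auto
    also have "(\<Sum>g\<in>{1..d} \<rightarrow>\<^sub>E {..<N}. \<Prod>j=1..d. \<phi> j (g j)) = (\<Prod>j=1..d. \<Sum>t<N. \<phi> j t)"
      by (rule prod_sum_PiE[symmetric]) auto
    also have "2 powr (a * real c) * 2 powr (- a * real n) * (\<Prod>j=1..d. \<Sum>t<N. \<phi> j t)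
      \<le> 2 powr (a * real c) * 2 powr (- a * real n) * (\<Prod>j=1..d. (1 + S) * (if j \<in> {2..\<nu>} then real n else 1))"
      using \<phi>0 one by (intro mult_left_mono prod_mono conjI sum_nonneg) auto
    also have "(\<Prod>j=1..d. (1 + S) * (if j \<in> {2..\<nu>} then real n else 1)) = (1 + S) ^ d * real n ^ (\<nu> - 1)"
    proof -
      have "(\<Prod>j=1..d. (if j \<in> {2..\<nu>} then real n else 1)) = (\<Prod>j\<in>{j\<in>{1..d}. j \<in> {2..\<nu>}}. real n)"
        by (rule prod.inter_filter[symmetric]) simp
      also have "{j\<in>{1..d}. j \<in> {2..\<nu>}} = {2..\<nu>}" using \<nu> by auto
      finally show ?thesis by (simp add: prod.distrib)
    qed
    finally show ?thesis by (simp add: C_def a_def mult_ac)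
  qed
  ultimately show thesis using that by blast
qed

section \<open>The Besov norm controls the tail\<close>

text \<open>The quotient \<open>1 / \<theta>\<close> is formed in \<open>ennreal\<close>, so
  \<open>\<theta> = \<top>\<close> gives the exponent \<open>\<nu> - 1\<close> without a case
  distinction.\<close>

definition rate :: "ennreal \<Rightarrow> nat \<Rightarrow> real" where
  "rate \<theta> n = 2 powr (- real n * r 1) * real n powr ((real \<nu> - 1) * (1 - enn2real (1 / \<theta>)))"

text \<open>Hoelder between the weighted block norms and the weights
  \<open>2 powr (- (s,r))\<close>: the tail sum enters with the conjugate exponent, which is 1 for
  \<open>\<theta> = \<top>\<close> and is replaced by a supremum for \<open>\<theta> = 1\<close>.
  The slack \<open>c\<close> admits blocks slightly inside the cross.\<close>

lemma besov_tail:
  fixes \<theta> :: ennreal and c :: nat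
  assumes \<theta>: "1 \<le> \<theta>"
  obtains C where "C > 0" "\<And>n G f. 1 \<le> n \<Longrightarrow> finite G \<Longrightarrow> G \<subseteq> block_indices d \<Longrightarrow>
      (\<And>s. s \<in> G \<Longrightarrow> real n \<le> dot d (\<lambda>j. real (s j)) \<beta> + real c) \<Longrightarrow> f \<in> besov_class d r p \<theta> \<Longrightarrow>
      (\<Sum>s\<in>G. Lp_norm d p (beta_block d p s f)) \<le> ennreal (C * rate \<theta> n)"
proof -
  let ?P = "\<lambda>C. \<forall>n G f. 1 \<le> n \<longrightarrow> finite G \<longrightarrow> G \<subseteq> block_indices d \<longrightarrow>
      (\<forall>s\<in>G. real n \<le> dot d (\<lambda>j. real (s j)) \<beta> + real c) \<longrightarrow> f \<in> besov_class d r p \<theta> \<longrightarrow>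
      (\<Sum>s\<in>G. Lp_norm d p (beta_block d p s f)) \<le> ennreal (C * rate \<theta> n)"
  let ?b = "\<lambda>f s. Lp_norm d p (beta_block d p s f)"
  let ?w = "\<lambda>s::nat\<Rightarrow>nat. dot d (\<lambda>j. real (s j)) r"
  have "\<exists>C>0. ?P C"
  proof (cases "\<theta> = \<top>")
    case True
    obtain C where C: "C > 0" and tail: "\<And>n G. 1 \<le> n \<Longrightarrow> finite G \<Longrightarrow> G \<subseteq> block_indices d \<Longrightarrow>
      (\<And>s. s \<in> G \<Longrightarrow> real n \<le> dot d (\<lambda>j. real (s j)) \<beta> + real c) \<Longrightarrow>
      (\<Sum>s\<in>G. 2 powr (- 1 * ?w s)) \<le> C * 2 powr (- 1 * r 1 * real n) * real n ^ (\<nu> - 1)"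
      by (rule tail_sum[of 1 c]) auto
    have "?P C"
    proof (intro allI impI)
      fix n G f assume n: "1 \<le> n" and G: "finite G" "G \<subseteq> block_indices d"
        and far: "\<forall>s\<in>G. real n \<le> dot d (\<lambda>j. real (s j)) \<beta> + real c" and f: "f \<in> besov_class d r p \<theta>"
      have "?b f s \<le> ennreal (2 powr (- 1 * ?w s))" if s: "s \<in> G" for s
      proof -
        have "ennreal (2 powr ?w s) * ?b f s \<le> besov_norm d r p \<theta> f"
          unfolding besov_norm_def using True G s by (auto intro!: SUP_upper)
        also have "\<dots> \<le> 1" using f by (simp add: besov_class_def)
        finally have le: "ennreal (2 powr ?w s) * ?b f s \<le> 1" .
        have "?b f s = ennreal (2 powr (- 1 * ?w s)) * (ennreal (2 powr ?w s) * ?b f s)"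
          by (simp add: mult.assoc[symmetric] powr_minus flip: ennreal_mult powr_add)
        also have "\<dots> \<le> ennreal (2 powr (- 1 * ?w s)) * 1" using le by (intro mult_left_mono) auto
        finally show ?thesis by simp
      qed
      then have "(\<Sum>s\<in>G. ?b f s) \<le> (\<Sum>s\<in>G. ennreal (2 powr (- 1 * ?w s)))" by (rule sum_mono)
      also have "\<dots> = ennreal (\<Sum>s\<in>G. 2 powr (- 1 * ?w s))" by (rule sum_ennreal) simp
      also have "\<dots> \<le> ennreal (C * 2 powr (- 1 * r 1 * real n) * real n ^ (\<nu> - 1))"
        using far by (intro ennreal_leI tail n G) auto
      also have "C * 2 powr (- 1 * r 1 * real n) * real n ^ (\<nu> - 1) = C * rate \<theta> n"
        using True \<nu> n by (simp add: rate_def mult_ac of_nat_diff flip: powr_realpow)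
      finally show "(\<Sum>s\<in>G. ?b f s) \<le> ennreal (C * rate \<theta> n)" .
    qed
    with C show ?thesis by blast
  next
    case False
    then have \<theta>f: "\<theta> < \<top>" by (simp add: less_top)
    let ?\<theta> = "enn2real \<theta>"
    have \<theta>1: "1 \<le> ?\<theta>" by (rule enn2real_ge_1[OF \<theta> \<theta>f])
    note inv\<theta> = enn2real_one_divide[OF \<theta> \<theta>f]
    \<comment> \<open>The block norms with the smoothness weight restored; membership in the class
      says that their \<open>\<theta>\<close>-th powers sum to at most 1.\<close>
    define U where "U = (\<lambda>f s. 2 powr ?w s * enn2real (?b f s))"
    have U: "?b f s = ennreal (U f s * 2 powr (- ?w s))" "U f s \<ge> 0" "(\<Sum>s\<in>G. U f s powr ?\<theta>) \<le> 1"
      if G: "finite G" "G \<subseteq> block_indices d" and f: "f \<in> besov_class d r p \<theta>" and s: "s \<in> G" for f G s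
    proof -
      let ?t = "\<lambda>s. ennreal (2 powr (?w s * ?\<theta>)) * epow (?b f s) ?\<theta>"
      have "epow (\<Sum>\<^sub>\<infinity>s\<in>block_indices d. ?t s) (1 / ?\<theta>) \<le> 1"
        using f False by (simp add: besov_class_def besov_norm_def)
      then have "(\<Sum>\<^sub>\<infinity>s\<in>block_indices d. ?t s) \<le> 1"
        by (rule epow_le_1D) (use \<theta>1 in simp)
      then have sum1: "(\<Sum>s\<in>G. ?t s) \<le> 1" using G unfolding infsum_ennreal_le_iff by blast
      have fin: "?b f s < \<top>" if s: "s \<in> G" for s
      proof (rule ccontr)
        assume "\<not> ?b f s < \<top>"
        then have "?t s = \<top>" by (simp add: epow_def less_top ennreal_mult_top)
        moreover have "?t s \<le> (\<Sum>s\<in>G. ?t s)" using G s by (intro member_le_sum) auto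
        ultimately have "(\<Sum>s\<in>G. ?t s) = \<top>" by (simp add: top_unique)
        with sum1 show False by (simp add: top_unique)
      qed
      have t: "?t s = ennreal (U f s powr ?\<theta>)" if s: "s \<in> G" for s
        using fin[OF s] by (simp add: epow_def less_top U_def powr_mult powr_powr flip: ennreal_mult)
      have "(\<Sum>s\<in>G. ?t s) = ennreal (\<Sum>s\<in>G. U f s powr ?\<theta>)"
        by (simp add: t sum_ennreal)
      with sum1 show "(\<Sum>s\<in>G. U f s powr ?\<theta>) \<le> 1" by (simp add: ennreal_le_1)
      show "?b f s = ennreal (U f s * 2 powr (- ?w s))"
      proof -
        have "U f s * 2 powr (- ?w s) = enn2real (?b f s) * (2 powr ?w s * 2 powr (- ?w s))"
          by (simp only: U_def mult_ac)
        also have "2 powr ?w s * 2 powr (- ?w s) = (1::real)" by (simp flip: powr_add)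
        finally show ?thesis using fin[OF s] by (simp add: less_top)
      qed
      show "U f s \<ge> 0" by (simp add: U_def)
    qed
    have reduce: "?P C" if main: "\<And>n G f. 1 \<le> n \<Longrightarrow> finite G \<Longrightarrow> G \<subseteq> block_indices d \<Longrightarrow> G \<noteq> {} \<Longrightarrow>
      (\<And>s. s \<in> G \<Longrightarrow> real n \<le> dot d (\<lambda>j. real (s j)) \<beta> + real c) \<Longrightarrow> (\<And>s. s \<in> G \<Longrightarrow> U f s \<ge> 0) \<Longrightarrow>
      (\<Sum>s\<in>G. U f s powr ?\<theta>) \<le> 1 \<Longrightarrow> (\<Sum>s\<in>G. U f s * 2 powr (- ?w s)) \<le> C * rate \<theta> n" for C
    proof (intro allI impI)
      fix n G f assume n: "1 \<le> n" and G: "finite G" "G \<subseteq> block_indices d"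
        and far: "\<forall>s\<in>G. real n \<le> dot d (\<lambda>j. real (s j)) \<beta> + real c" and f: "f \<in> besov_class d r p \<theta>"
      show "(\<Sum>s\<in>G. ?b f s) \<le> ennreal (C * rate \<theta> n)"
      proof (cases "G = {}")
        case False
        then obtain s0 where s0: "s0 \<in> G" by auto
        have "(\<Sum>s\<in>G. ?b f s) = (\<Sum>s\<in>G. ennreal (U f s * 2 powr (- ?w s)))"
          by (intro sum.cong refl U(1)[OF G f])
        also have "\<dots> = ennreal (\<Sum>s\<in>G. U f s * 2 powr (- ?w s))"
          using U(2)[OF G f] by (intro sum_ennreal) auto
        also have "\<dots> \<le> ennreal (C * rate \<theta> n)"
          using far False U(2,3)[OF G f] s0 by (intro ennreal_leI main n G) auto
        finally show ?thesis .
      qed simp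
    qed
    show ?thesis
    proof (cases "?\<theta> = 1")
      case True
      \<comment> \<open>For \<open>\<theta> = 1\<close> the largest weight suffices, since
        \<open>(s,r) \<ge> r 1 * (s,\<beta>) \<ge> r 1 * (n - c)\<close>; no power of
        \<open>n\<close> arises.\<close>
      have "?P (2 powr (r 1 * real c))"
      proof (rule reduce)
        fix n G f assume n: "1 \<le> n" and G: "finite G"
          and far: "\<And>s. s \<in> G \<Longrightarrow> real n \<le> dot d (\<lambda>j. real (s j)) \<beta> + real c"
          and U0: "\<And>s. s \<in> G \<Longrightarrow> U f s \<ge> 0" and U1: "(\<Sum>s\<in>G. U f s powr ?\<theta>) \<le> 1"
        let ?W = "2 powr (r 1 * real c) * 2 powr (- real n * r 1)"
        have "(\<Sum>s\<in>G. U f s * 2 powr (- ?w s)) \<le> (\<Sum>s\<in>G. U f s * ?W)"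
        proof (intro sum_mono mult_left_mono U0)
          fix s assume s: "s \<in> G"
          have "r 1 * (real n - real c) \<le> r 1 * dot d (\<lambda>j. real (s j)) \<beta>"
            using far[OF s] r1 by (intro mult_left_mono) auto
          also note dot_r_ge
          finally have "- ?w s \<le> r 1 * real c + - real n * r 1" by (simp add: algebra_simps)
          then show "2 powr (- ?w s) \<le> ?W" unfolding powr_add[symmetric] by (intro powr_mono) auto
        qed
        also have "\<dots> = (\<Sum>s\<in>G. U f s powr ?\<theta>) * ?W"
          using U0 True by (simp add: sum_distrib_right)
        also have "\<dots> \<le> 1 * ?W" using U1 by (intro mult_right_mono) auto
        also have "\<dots> = 2 powr (r 1 * real c) * rate \<theta> n"
          using n True inv\<theta> by (simp add: rate_def)
        finally show "(\<Sum>s\<in>G. U f s * 2 powr (- ?w s)) \<le> 2 powr (r 1 * real c) * rate \<theta> n" .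
      qed
      then show ?thesis by (intro exI[of _ "2 powr (r 1 * real c)"]) auto
    next
      case False
      then have \<theta>2: "1 < ?\<theta>" using \<theta>1 by linarith
      define \<theta>' where "\<theta>' = ?\<theta> / (?\<theta> - 1)"
      have \<theta>': "1 < \<theta>'" "1 / ?\<theta> + 1 / \<theta>' = 1" "1 / \<theta>' = 1 - 1 / ?\<theta>"
        using \<theta>2 by (auto simp: \<theta>'_def field_simps)
      obtain C where C: "C > 0" and tail: "\<And>n G. 1 \<le> n \<Longrightarrow> finite G \<Longrightarrow> G \<subseteq> block_indices d \<Longrightarrow>
        (\<And>s. s \<in> G \<Longrightarrow> real n \<le> dot d (\<lambda>j. real (s j)) \<beta> + real c) \<Longrightarrow>
        (\<Sum>s\<in>G. 2 powr (- \<theta>' * ?w s)) \<le> C * 2 powr (- \<theta>' * r 1 * real n) * real n ^ (\<nu> - 1)"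
        using \<theta>'(1) by (elim tail_sum[of \<theta>' c, rotated]) auto
      have "?P (C powr (1 / \<theta>'))"
      proof (rule reduce)
        fix n G f assume n: "1 \<le> n" and G: "finite G" "G \<subseteq> block_indices d"
          and far: "\<And>s. s \<in> G \<Longrightarrow> real n \<le> dot d (\<lambda>j. real (s j)) \<beta> + real c"
          and U0: "\<And>s. s \<in> G \<Longrightarrow> U f s \<ge> 0" and U1: "(\<Sum>s\<in>G. U f s powr ?\<theta>) \<le> 1"
        \<comment> \<open>\<open>V\<close> bounds the sum of the \<open>\<theta>'\<close>-th powers
          of the weights. Dividing the weights by \<open>L = V powr (1 / \<theta>')\<close>
          normalises that sum to at most 1, so Young's inequality, summed over \<open>G\<close>,
          yields Hoelder's.\<close>
        define V where "V = C * 2 powr (- \<theta>' * r 1 * real n) * real n ^ (\<nu> - 1)"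
        have V: "V > 0" using C n by (simp add: V_def)
        define L where "L = V powr (1 / \<theta>')"
        have L: "L > 0" "L powr \<theta>' = V" using V \<theta>'(1) by (auto simp: L_def powr_powr)
        have Leq: "L = C powr (1 / \<theta>') * rate \<theta> n"
        proof -
          have "real n ^ (\<nu> - 1) = real n powr (real \<nu> - 1)"
            using n \<nu> by (simp add: powr_realpow[symmetric] of_nat_diff)
          then have "L = C powr (1 / \<theta>') * (2 powr (- \<theta>' * r 1 * real n)) powr (1 / \<theta>') * (real n powr (real \<nu> - 1)) powr (1 / \<theta>')"
            unfolding L_def V_def using C by (simp add: powr_mult)
          also have "(2 powr (- \<theta>' * r 1 * real n)) powr (1 / \<theta>') = 2 powr (- real n * r 1)"
            using \<theta>'(1) by (simp add: powr_powr mult.commute)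
          also have "(real n powr (real \<nu> - 1)) powr (1 / \<theta>') = real n powr ((real \<nu> - 1) * (1 - enn2real (1 / \<theta>)))"
            unfolding inv\<theta> \<theta>'(3)[symmetric] by (simp add: powr_powr)
          finally show ?thesis by (simp add: rate_def)
        qed
        have "(\<Sum>s\<in>G. U f s * 2 powr (- ?w s))
          \<le> (\<Sum>s\<in>G. L * (U f s powr ?\<theta> / ?\<theta> + 2 powr (- \<theta>' * ?w s) / V / \<theta>'))"
        proof (rule sum_mono)
          fix s assume s: "s \<in> G"
          have "U f s * (2 powr (- ?w s) / L) \<le> U f s powr ?\<theta> / ?\<theta> + (2 powr (- ?w s) / L) powr \<theta>' / \<theta>'"
            using \<theta>2 \<theta>' U0[OF s] L by (intro Youngs_inequality) auto
          also have "(2 powr (- ?w s) / L) powr \<theta>' = 2 powr (- \<theta>' * ?w s) / V"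
            using L by (simp add: powr_divide powr_powr mult.commute)
          finally have "L * (U f s * (2 powr (- ?w s) / L)) \<le> L * (U f s powr ?\<theta> / ?\<theta> + 2 powr (- \<theta>' * ?w s) / V / \<theta>')"
            using L by (intro mult_left_mono) auto
          then show "U f s * 2 powr (- ?w s) \<le> L * (U f s powr ?\<theta> / ?\<theta> + 2 powr (- \<theta>' * ?w s) / V / \<theta>')"
            using L by simp
        qed
        also have "\<dots> = L * ((\<Sum>s\<in>G. U f s powr ?\<theta>) / ?\<theta> + (\<Sum>s\<in>G. 2 powr (- \<theta>' * ?w s)) / V / \<theta>')"
          by (simp add: sum_distrib_left[symmetric] sum.distrib sum_divide_distrib)
        also have "\<dots> \<le> L * (1 / ?\<theta> + 1 / \<theta>')"
        proof (intro mult_left_mono add_mono divide_right_mono U1)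
          show "(\<Sum>s\<in>G. 2 powr (- \<theta>' * ?w s)) / V \<le> 1"
            using tail[OF n G far] V by (simp add: V_def)
        qed (use \<theta>2 \<theta>' L in auto)
        also have "\<dots> = C powr (1 / \<theta>') * rate \<theta> n" using \<theta>'(2) Leq by simp
        finally show "(\<Sum>s\<in>G. U f s * 2 powr (- ?w s)) \<le> C powr (1 / \<theta>') * rate \<theta> n" .
      qed
      moreover have "C powr (1 / \<theta>') > 0" using C by simp
      ultimately show ?thesis by blast
    qed
  qed
  then obtain C where "C > 0" "?P C" by blast
  then show thesis using that[of C] by blast
qed

end

section \<open>Upper bound\<close>

lemma tpoly_restrict:
  assumes "finite K'" "K \<subseteq> K'" "\<And>k. k \<in> K' \<Longrightarrow> m k = (if k \<in> K then 1 else 0)"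
  shows "tpoly d K c = tpoly d K' (\<lambda>k. m k * c k)"
proof
  fix x
  have "(\<Sum>k\<in>K'. m k * c k * character d k x) = (\<Sum>k\<in>K. m k * c k * character d k x)"
    using assms by (intro sum.mono_neutral_right) auto
  also have "\<dots> = (\<Sum>k\<in>K. c k * character d k x)"
    using assms by (intro sum.cong) auto
  finally show "tpoly d K c x = tpoly d K' (\<lambda>k. m k * c k) x" by (simp add: tpoly_def)
qed

text \<open>The index on the right follows the form of the class norm. For finite \<open>p\<close>
  the piece is a multiplier of the \<open>\<delta>\<close>-block at the bumped index; for
  \<open>p = \<top>\<close> it is a projection of the \<open>A\<close>-block at \<open>s\<close>
  itself.\<close>

lemma block_norm_bound:
  assumes q: "1 \<le> q" "q < p"
  obtains C where "C > 0" "\<And>f s e. f \<in> Lp0 d p \<Longrightarrow> s \<in> block_indices d \<Longrightarrow> e \<subseteq> {1..d} \<Longrightarrow>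
    Lp_norm d q (tpoly d (rho d (bump d s e)) (\<lambda>k. of_real (A_symbol d s k) * fourier_coeff d f k))
      \<le> ennreal C * Lp_norm d p (beta_block d p (if p = \<top> then s else bump d s e) f)"
proof -
  have qf: "q < \<top>" using q(2) by (rule less_le_trans) simp
  have q1: "1 \<le> enn2real q" by (rule enn2real_ge_1[OF q(1) qf])
  have qp: "q \<le> p" using q by simp
  \<comment> \<open>The maximum with 1 makes the constant positive, as required for extracting it
    from the extended power.\<close>
  have lift: "Lp_norm d Q (tpoly d K (\<lambda>k. (\<Prod>j=1..d. m j (k j)) * c k))
      \<le> ennreal (max 1 (C ^ d) powr (1 / enn2real Q)) * Lp_norm d Q (tpoly d K c)"
    if Q: "1 \<le> Q" "Q < \<top>" and m: "\<And>j. j \<in> {1..d} \<Longrightarrow> mult_bdd (enn2real Q) (m j) C" and K: "finite K" for Q m C K c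
  proof (rule Lp_norm_le_of_power_integral[OF Q])
    have "power_integral d (enn2real Q) (tpoly d K (\<lambda>k. (\<Prod>j=1..d. m j (k j)) * c k))
        \<le> ennreal (C ^ d) * power_integral d (enn2real Q) (tpoly d K c)"
      by (rule mult_bdd_lift[OF m K])
    also have "\<dots> \<le> ennreal (max 1 (C ^ d)) * power_integral d (enn2real Q) (tpoly d K c)"
      by (intro mult_right_mono ennreal_leI) auto
    finally show "power_integral d (enn2real Q) (tpoly d K (\<lambda>k. (\<Prod>j=1..d. m j (k j)) * c k))
        \<le> ennreal (max 1 (C ^ d)) * power_integral d (enn2real Q) (tpoly d K c)" .
  qed simp
  have double: "2 * x = ennreal 2 * x" for x by simp
  show thesis
  proof (cases "p = \<top>")
    case False
    then have p: "1 < p" "p < \<top>" using q by (auto simp: less_top intro: le_less_trans)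
    obtain CA where CA: "\<And>s. mult_bdd (enn2real q) (\<lambda>k. of_real (a_symbol s k)) CA"
      using mult_bdd_a_symbol[OF q1] by blast
    define D where "D = max 1 (CA ^ d) powr (1 / enn2real q)"
    have D: "D > 0" by (simp add: D_def)
    show thesis
    proof (rule that[of "D * 2"])
      fix f s e assume f: "f \<in> Lp0 d p" and s: "s \<in> block_indices d" and e: "e \<subseteq> {1..d}"
      let ?R = "rho d (bump d s e)"
      have "Lp_norm d q (tpoly d ?R (\<lambda>k. (\<Prod>j=1..d. of_real (a_symbol (s j) (k j))) * fourier_coeff d f k))
        \<le> ennreal D * Lp_norm d q (tpoly d ?R (fourier_coeff d f))"
        unfolding D_def by (rule lift[OF q(1) qf CA finite_rho])
      also have "\<dots> \<le> ennreal D * (2 * Lp_norm d p (tpoly d ?R (fourier_coeff d f)))"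
        by (intro mult_left_mono Lp_norm_mono_exponent q(1) qp qf tpoly_measurable) auto
      also have "tpoly d ?R (fourier_coeff d f) = beta_block d p (if p = \<top> then s else bump d s e) f"
        using p False by (simp add: beta_block_def delta_block_eq)
      finally show "Lp_norm d q (tpoly d ?R (\<lambda>k. of_real (A_symbol d s k) * fourier_coeff d f k))
        \<le> ennreal (D * 2) * Lp_norm d p (beta_block d p (if p = \<top> then s else bump d s e) f)"
        using D unfolding double by (simp add: A_symbol_def ennreal_mult mult.assoc)
    qed (use D in simp)
  next
    case True
    \<comment> \<open>\<open>2 * m\<close> is an even exponent with
      \<open>q \<le> 2 * m < \<top>\<close>; the estimate passes from \<open>q\<close> to
      \<open>2 * m\<close>, projects there, and then goes up to the supremum norm.\<close>
    define m where "m = nat \<lceil>enn2real q\<rceil>"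
    have m: "m > 0" "enn2real q \<le> real (2 * m)" unfolding m_def using q1 by linarith+
    define Q where "Q = ennreal (real (2 * m))"
    have QR: "enn2real Q = real (2 * m)" unfolding Q_def by simp
    have "ennreal 1 \<le> Q" unfolding Q_def using m by (intro ennreal_leI) simp
    then have Q: "1 \<le> Q" "Q < \<top>" by (simp_all add: Q_def)
    have "q = ennreal (enn2real q)" using qf by (simp add: less_top)
    also have "\<dots> \<le> Q" unfolding Q_def using m by (intro ennreal_leI)
    finally have qQ: "q \<le> Q" .
    obtain CB where CB: "\<And>s. mult_bdd (enn2real Q) (block_symbol s) CB"
      unfolding QR using mult_bdd_block_symbol[OF m(1)] by blast
    define D where "D = max 1 (CB ^ d) powr (1 / enn2real Q)"
    have D: "D > 0" by (simp add: D_def)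
    show thesis
    proof (rule that[of "2 * D * 2"])
      fix f s e assume f: "f \<in> Lp0 d p" and s: "s \<in> block_indices d" and e: "e \<subseteq> {1..d}"
      have int: "integrable (torus d) f" using f True by (intro Lp_integrable[of f d p]) (auto simp: Lp0_def)
      let ?R = "rho d (bump d s e)" and ?c = "\<lambda>k. of_real (A_symbol d s k) * fourier_coeff d f k"
      have sub: "?R \<subseteq> wide_block d s" unfolding wide_block_eq[OF s] using e by blast
      \<comment> \<open>The indicator of a dyadic block is a product of one-variable indicators, the
        form demanded by the lifting of multipliers.\<close>
      have ind: "(\<Prod>j=1..d. block_symbol (bump d s e j) (k j)) = (if k \<in> ?R then 1 else 0)"
        if "k \<in> wide_block d s" for k
      proof (cases "k \<in> ?R")
        case True
        then show ?thesis by (auto simp: rho_def block_symbol_def intro!: prod.neutral)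
      next
        case False
        have "k \<in> {1..d} \<rightarrow>\<^sub>E UNIV" using that wide_block_extensional by blast
        with False have "\<exists>j\<in>{1..d}. block_symbol (bump d s e j) (k j) = 0"
          unfolding rho_def block_symbol_def by auto
        then have "(\<Prod>j=1..d. block_symbol (bump d s e j) (k j)) = 0"
          by (intro prod_zero) auto
        then show ?thesis using False by simp
      qed
      have eqR: "tpoly d ?R ?c = tpoly d (wide_block d s) (\<lambda>k. (\<Prod>j=1..d. block_symbol (bump d s e j) (k j)) * ?c k)"
        by (rule tpoly_restrict[OF finite_wide_block sub ind])
      have "Lp_norm d q (tpoly d ?R ?c) \<le> 2 * Lp_norm d Q (tpoly d ?R ?c)"
        by (intro Lp_norm_mono_exponent q(1) qQ qf tpoly_measurable)
      also have "\<dots> \<le> 2 * (ennreal D * Lp_norm d Q (tpoly d (wide_block d s) ?c))"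
        unfolding D_def eqR by (intro mult_left_mono lift[OF Q CB finite_wide_block]) auto
      also have "\<dots> = 2 * (ennreal D * Lp_norm d Q (A_block d s f))" by (simp only: A_block_eq[OF s int])
      also have "\<dots> \<le> 2 * (ennreal D * (2 * Lp_norm d p (A_block d s f)))"
        unfolding A_block_eq[OF s int] using True
        by (intro mult_left_mono Lp_norm_mono_exponent Q tpoly_measurable) auto
      also have "A_block d s f = beta_block d p (if p = \<top> then s else bump d s e) f"
        using True by (simp add: beta_block_def)
      also have "2 * (ennreal D * (2 * Lp_norm d p (beta_block d p (if p = \<top> then s else bump d s e) f)))
        = ennreal (2 * D * 2) * Lp_norm d p (beta_block d p (if p = \<top> then s else bump d s e) f)"
      proof -
        have "ennreal (2 * D * 2) = ennreal (2 * D) * ennreal 2" "ennreal (2 * D) = ennreal 2 * ennreal D"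
          using D by (intro ennreal_mult; simp)+
        then have "ennreal (2 * D * 2) = 2 * ennreal D * 2" by (simp only: ennreal_numeral)
        then show ?thesis by (simp only: mult.assoc)
      qed
      finally show "Lp_norm d q (tpoly d ?R ?c)
        \<le> ennreal (2 * D * 2) * Lp_norm d p (beta_block d p (if p = \<top> then s else bump d s e) f)" .
    qed (use D in simp)
  qed
qed

lemma bump_inj_left: "inj_on (\<lambda>s. bump d s e) (block_indices d)"
proof (rule inj_onI)
  fix s s' assume s: "s \<in> block_indices d" "s' \<in> block_indices d" and eq: "bump d s e = bump d s' e"
  show "s = s'"
  proof (rule PiE_ext)
    show "s \<in> {1..d} \<rightarrow>\<^sub>E {1..}" "s' \<in> {1..d} \<rightarrow>\<^sub>E {1..}" using s by (auto simp: block_indices_def)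
    fix j assume "j \<in> {1..d}"
    then show "s j = s' j" using fun_cong[OF eq, of j] by (auto simp: bump_def split: if_splits)
  qed
qed

context cross_params
begin

lemma upper_bound:
  assumes q: "1 \<le> q" "q < p" and \<theta>: "1 \<le> \<theta>"
  obtains C where "C > 0" "\<And>n. 1 \<le> n \<Longrightarrow>
    fourier_approx d (Bq1_norm d q) (hyp_cross d \<beta> n) (besov_class d r p \<theta>) \<le> ennreal (C * rate \<theta> n)"
proof -
  have qf: "q < \<top>" using q(2) by (rule less_le_trans) simp
  \<comment> \<open>Bumping an index raises its product with \<open>\<beta>\<close> by at most the
    sum of the \<open>\<beta> j\<close>. Hence an index \<open>s\<close> with a bump outside the
    cross satisfies \<open>(s,\<beta>) \<ge> n - c\<close>.\<close>
  define c where "c = nat \<lceil>\<Sum>j=1..d. \<beta> j\<rceil>"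
  have bump_dot: "dot d (\<lambda>j. real (bump d s e j)) \<beta> \<le> dot d (\<lambda>j. real (s j)) \<beta> + real c" for s e
  proof -
    have "dot d (\<lambda>j. real (bump d s e j)) \<beta> \<le> (\<Sum>j=1..d. real (s j) * \<beta> j + \<beta> j)"
      unfolding dot_def
    proof (rule sum_mono)
      fix j assume j: "j \<in> {1..d}"
      have "real (bump d s e j) * \<beta> j \<le> (real (s j) + 1) * \<beta> j"
        using \<beta>_ge_1[OF j] j by (intro mult_right_mono) (auto simp: bump_def)
      then show "real (bump d s e j) * \<beta> j \<le> real (s j) * \<beta> j + \<beta> j" by (simp add: distrib_right)
    qed
    also have "\<dots> = dot d (\<lambda>j. real (s j)) \<beta> + (\<Sum>j=1..d. \<beta> j)" by (simp add: dot_def sum.distrib)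
    also have "(\<Sum>j=1..d. \<beta> j) \<le> real c" unfolding c_def by linarith
    finally show ?thesis by simp
  qed
  obtain B where B: "B > 0" and block: "\<And>f s e. f \<in> Lp0 d p \<Longrightarrow> s \<in> block_indices d \<Longrightarrow> e \<subseteq> {1..d} \<Longrightarrow>
    Lp_norm d q (tpoly d (rho d (bump d s e)) (\<lambda>k. of_real (A_symbol d s k) * fourier_coeff d f k))
      \<le> ennreal B * Lp_norm d p (beta_block d p (if p = \<top> then s else bump d s e) f)"
    by (rule block_norm_bound[OF q, of d]) blast
  obtain T where T: "T > 0" and tail: "\<And>n G f. 1 \<le> n \<Longrightarrow> finite G \<Longrightarrow> G \<subseteq> block_indices d \<Longrightarrow>
      (\<And>s. s \<in> G \<Longrightarrow> real n \<le> dot d (\<lambda>j. real (s j)) \<beta> + real c) \<Longrightarrow> f \<in> besov_class d r p \<theta> \<Longrightarrow>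
      (\<Sum>s\<in>G. Lp_norm d p (beta_block d p s f)) \<le> ennreal (T * rate \<theta> n)"
    by (rule besov_tail[OF \<theta>, of c p]) blast
  \<comment> \<open>Enters twice: as the factor of the quasi-triangle inequality and as the number
    of subsets \<open>e\<close> summed at the end.\<close>
  define N where "N = real (2 ^ d)"
  have N: "N > 0" by (simp add: N_def)
  show thesis
  proof (rule that[of "N * (N * (B * T))"])
    show "N * (N * (B * T)) > 0" using N B T by simp
    fix n :: nat assume n: "1 \<le> n"
    show "fourier_approx d (Bq1_norm d q) (hyp_cross d \<beta> n) (besov_class d r p \<theta>) \<le> ennreal (N * (N * (B * T)) * rate \<theta> n)"
      unfolding fourier_approx_def
    proof (rule SUP_least)
      fix f assume fB: "f \<in> besov_class d r p \<theta>"
      then have f: "f \<in> Lp0 d p" by (simp add: besov_class_def)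
      have int: "integrable (torus d) f" using f q by (intro Lp_integrable[of f d p]) (auto simp: Lp0_def)
      let ?h = "\<lambda>x. f x - fourier_sum d (hyp_cross d \<beta> n) f x"
      have "f \<in> Lp0 d q" using q qf f by (intro Lp0_mono_exponent[of q p]) auto
      then have h: "?h \<in> Lp0 d q"
        unfolding fourier_sum_tpoly using hyp_cross_nonzero by (intro Lp0_diff_tpoly q(1)) auto
      define E where "E = (\<lambda>s. {e\<in>Pow {1..d}. real n \<le> dot d (\<lambda>j. real (bump d s e j)) \<beta>})"
      \<comment> \<open>The index of the class block that dominates the piece \<open>e\<close> of
        the block \<open>s\<close>.\<close>
      define \<sigma> where "\<sigma> = (\<lambda>s e. if p = \<top> then s else bump d s e)"
      let ?b = "\<lambda>s. Lp_norm d p (beta_block d p s f)"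
      have one: "Lp_norm d q (A_block d s ?h) \<le> ennreal N * (\<Sum>e\<in>E s. ennreal B * ?b (\<sigma> s e))" if s: "s \<in> block_indices d" for s
      proof -
        have fin: "finite (E s)" by (simp add: E_def)
        let ?g = "\<lambda>e. tpoly d (rho d (bump d s e)) (\<lambda>k. of_real (A_symbol d s k) * fourier_coeff d f k)"
        have "Lp_norm d q (A_block d s ?h) = Lp_norm d q (\<lambda>x. \<Sum>e\<in>E s. ?g e x)"
          unfolding E_def by (subst A_block_remainder[OF s int \<beta>_ge_1]) simp_all
        also have "\<dots> \<le> of_nat (card (E s)) * (\<Sum>e\<in>E s. Lp_norm d q (?g e))"
          by (rule Lp_norm_sum_le[OF q(1) qf fin]) (rule tpoly_measurable)
        also have "\<dots> \<le> ennreal N * (\<Sum>e\<in>E s. ennreal B * ?b (\<sigma> s e))"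
        proof (intro mult_mono sum_mono)
          have "card (E s) \<le> card (Pow {1..d})" by (rule card_mono) (auto simp: E_def)
          then have "card (E s) \<le> 2 ^ d" by (simp add: card_Pow)
          then have "real (card (E s)) \<le> N" unfolding N_def by (rule of_nat_mono)
          then show "of_nat (card (E s)) \<le> ennreal N"
            unfolding ennreal_of_nat_eq_real_of_nat by (rule ennreal_leI)
          fix e assume "e \<in> E s"
          then show "Lp_norm d q (?g e) \<le> ennreal B * ?b (\<sigma> s e)"
            unfolding \<sigma>_def by (intro block f s) (auto simp: E_def)
        qed auto
        finally show ?thesis .
      qed
      have "(\<Sum>s\<in>F. Lp_norm d q (A_block d s ?h)) \<le> ennreal (N * (N * (B * T)) * rate \<theta> n)"
        if F: "finite F" "F \<subseteq> block_indices d" for F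
      proof -
        have "(\<Sum>s\<in>F. Lp_norm d q (A_block d s ?h)) \<le> (\<Sum>s\<in>F. ennreal N * (\<Sum>e\<in>E s. ennreal B * ?b (\<sigma> s e)))"
          using F by (intro sum_mono one) auto
        also have "\<dots> = ennreal N * (\<Sum>s\<in>F. \<Sum>e\<in>E s. ennreal B * ?b (\<sigma> s e))"
          by (simp add: sum_distrib_left)
        \<comment> \<open>For fixed \<open>e\<close> the map from \<open>s\<close> to
          \<open>\<sigma> s e\<close> is injective, so with \<open>e\<close> outermost each inner
          sum is one tail sum of the class norm.\<close>
        also have "(\<Sum>s\<in>F. \<Sum>e\<in>E s. ennreal B * ?b (\<sigma> s e))
          = (\<Sum>e\<in>Pow {1..d}. \<Sum>s\<in>{s\<in>F. real n \<le> dot d (\<lambda>j. real (bump d s e j)) \<beta>}. ennreal B * ?b (\<sigma> s e))"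
          unfolding E_def using F(1) by (intro sum.swap_restrict) auto
        also have "\<dots> \<le> (\<Sum>e\<in>Pow {1..d}. ennreal (B * (T * rate \<theta> n)))"
        proof (rule sum_mono)
          fix e
          let ?F = "{s\<in>F. real n \<le> dot d (\<lambda>j. real (bump d s e j)) \<beta>}"
          have inj: "inj_on (\<lambda>s. \<sigma> s e) ?F"
          proof (cases "p = \<top>")
            case True
            then show ?thesis by (simp add: \<sigma>_def)
          next
            case False
            have "?F \<subseteq> block_indices d" using F(2) by blast
            from inj_on_subset[OF bump_inj_left this] False show ?thesis by (simp add: \<sigma>_def)
          qed
          have "(\<Sum>s\<in>?F. ?b (\<sigma> s e)) = (\<Sum>s\<in>(\<lambda>s. \<sigma> s e) ` ?F. ?b s)"
            by (simp add: sum.reindex[OF inj])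
          also have "\<dots> \<le> ennreal (T * rate \<theta> n)"
          proof (rule tail[OF n _ _ _ fB])
            show "finite ((\<lambda>s. \<sigma> s e) ` ?F)" using F(1) by simp
            show "(\<lambda>s. \<sigma> s e) ` ?F \<subseteq> block_indices d"
              using F(2) bump_block_indices by (auto simp: \<sigma>_def)
            fix t assume "t \<in> (\<lambda>s. \<sigma> s e) ` ?F"
            then obtain s where s: "t = \<sigma> s e" "real n \<le> dot d (\<lambda>j. real (bump d s e j)) \<beta>" by auto
            show "real n \<le> dot d (\<lambda>j. real (t j)) \<beta> + real c"
              using s bump_dot[of s e] by (cases "p = \<top>") (auto simp: \<sigma>_def)
          qed
          finally have "ennreal B * (\<Sum>s\<in>?F. ?b (\<sigma> s e)) \<le> ennreal B * ennreal (T * rate \<theta> n)"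
            by (intro mult_left_mono) auto
          also have "\<dots> = ennreal (B * (T * rate \<theta> n))" using B by (simp add: ennreal_mult')
          finally show "(\<Sum>s\<in>?F. ennreal B * ?b (\<sigma> s e)) \<le> ennreal (B * (T * rate \<theta> n))"
            by (simp only: sum_distrib_left)
        qed
        also have "\<dots> = ennreal N * ennreal (B * (T * rate \<theta> n))"
        proof -
          have "(2::ennreal) ^ d = ennreal N" using ennreal_power[of 2 d] by (simp add: N_def)
          then show ?thesis by (simp add: card_Pow)
        qed
        also have "ennreal N * \<dots> = ennreal (N * (N * (B * T)) * rate \<theta> n)"
          using N by (simp add: mult.assoc ennreal_mult')
        finally show ?thesis by (simp add: mult_left_mono)
      qed
      then show "Bq1_norm d q ?h \<le> ennreal (N * (N * (B * T)) * rate \<theta> n)"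
        using h by (simp add: Bq1_norm_def infsum_ennreal_le_iff)
    qed
  qed
qed

end

section \<open>Lower bound\<close>

text \<open>At \<open>2 ^ s j\<close> the symbol \<open>a_symbol (s j)\<close> is 1 and those of all
  other indices vanish. The point opens the dyadic shell \<open>s j + 1\<close>, so it lies in the
  block \<open>rho\<close> bumped in every coordinate.\<close>

definition lacunary :: "nat \<Rightarrow> (nat \<Rightarrow> nat) \<Rightarrow> nat \<Rightarrow> int" where
  "lacunary d s = (\<lambda>j\<in>{1..d}. 2 ^ s j)"

lemma lacunary_extensional: "lacunary d s \<in> {1..d} \<rightarrow>\<^sub>E UNIV"
  by (auto simp: lacunary_def)

lemma lacunary_inj: "inj_on (lacunary d) (block_indices d)"
proof (rule inj_onI)
  fix s s' assume s: "s \<in> block_indices d" "s' \<in> block_indices d" and eq: "lacunary d s = lacunary d s'"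
  show "s = s'"
  proof (rule PiE_ext)
    show "s \<in> {1..d} \<rightarrow>\<^sub>E {1..}" "s' \<in> {1..d} \<rightarrow>\<^sub>E {1..}" using s by (auto simp: block_indices_def)
    fix j assume "j \<in> {1..d}"
    then have "(2::int) ^ s j = 2 ^ s' j" using fun_cong[OF eq, of j] by (simp add: lacunary_def)
    then show "s j = s' j" by simp
  qed
qed

lemma lacunary_rho: "lacunary d s \<in> rho d (bump d s {1..d})"
  by (auto simp: lacunary_def rho_def bump_def)

lemma lacunary_wide_block: "s \<in> block_indices d \<Longrightarrow> lacunary d s \<in> wide_block d s"
  using lacunary_rho[of d s] by (auto simp: wide_block_eq)

lemma A_symbol_lacunary:
  assumes "s \<in> block_indices d" "u \<in> block_indices d"
  shows "A_symbol d s (lacunary d u) = (if s = u then 1 else 0)"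
proof -
  have "A_symbol d s (lacunary d u) = (\<Prod>j=1..d. if s j = u j then 1 else 0)"
    unfolding A_symbol_def
  proof (rule prod.cong[OF refl])
    fix j assume j: "j \<in> {1..d}"
    then have "1 \<le> s j" "1 \<le> u j" using assms by (auto simp: block_indices_def PiE_iff)
    then show "a_symbol (s j) (lacunary d u j) = (if s j = u j then 1 else 0)"
      using j by (simp add: lacunary_def a_symbol_power_two)
  qed
  also have "\<dots> = (if \<forall>j\<in>{1..d}. s j = u j then 1 else 0)"
    by (auto intro!: prod.neutral simp: prod_zero_iff)
  also have "(\<forall>j\<in>{1..d}. s j = u j) \<longleftrightarrow> s = u"
    using assms by (auto simp: block_indices_def intro: PiE_ext)
  finally show ?thesis .
qed

lemma tpoly_single:
  assumes "finite K" "k0 \<in> K" "\<And>k. k \<in> K \<Longrightarrow> c k = (if k = k0 then a else 0)"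
  shows "tpoly d K c = (\<lambda>x. a * character d k0 x)"
proof
  fix x
  have "tpoly d K c x = (\<Sum>k\<in>K. if k = k0 then a * character d k0 x else 0)"
    unfolding tpoly_def using assms by (intro sum.cong) auto
  also have "\<dots> = a * character d k0 x" using assms by simp
  finally show "tpoly d K c x = a * character d k0 x" .
qed

lemma tpoly_zero: "(\<And>k. k \<in> K \<Longrightarrow> c k = 0) \<Longrightarrow> tpoly d K c = (\<lambda>x. 0)"
  by (simp add: fun_eq_iff tpoly_def)

lemma Lp_norm_character:
  assumes "1 \<le> q" "0 \<le> a"
  shows "Lp_norm d q (\<lambda>x. complex_of_real a * character d k x) = ennreal a"
  using assms by (intro Lp_norm_const_norm) (auto simp: norm_mult)

text \<open>
  The extremal functions: one exponential of the same amplitude in each of the blocks of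
  \<open>\<Theta>\<close>, at frequencies where \<open>A\<^sub>s\<close> reproduces the exponential belonging to \<open>s\<close> and kills all others.
\<close>

locale lacunary_sum =
  fixes d :: nat and \<Theta> :: "(nat \<Rightarrow> nat) set" and \<alpha> :: real
  assumes fin: "finite \<Theta>" and \<Theta>: "\<Theta> \<subseteq> block_indices d" and \<alpha>: "0 \<le> \<alpha>"
begin

definition F :: "(nat \<Rightarrow> real) \<Rightarrow> complex" where
  "F = tpoly d (lacunary d ` \<Theta>) (\<lambda>_. of_real \<alpha>)"

lemma integrable_F: "integrable (torus d) F"
  unfolding F_def by (rule integrable_tpoly)

lemma F_Lp0: "1 \<le> q \<Longrightarrow> F \<in> Lp0 d q"
  unfolding F_def by (rule tpoly_Lp0) (auto simp: lacunary_def)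

lemma fourier_coeff_F: "k \<in> {1..d} \<rightarrow>\<^sub>E UNIV \<Longrightarrow> fourier_coeff d F k = (if k \<in> lacunary d ` \<Theta> then of_real \<alpha> else 0)"
  unfolding F_def
  by (rule fourier_coeff_tpoly[OF finite_imageI[OF fin] image_subsetI[OF lacunary_extensional]])

lemma A_symbol_F:
  assumes s: "s \<in> block_indices d" and k: "k \<in> {1..d} \<rightarrow>\<^sub>E UNIV"
  shows "of_real (A_symbol d s k) * fourier_coeff d F k = (if s \<in> \<Theta> \<and> k = lacunary d s then of_real \<alpha> else 0)"
proof (cases "k \<in> lacunary d ` \<Theta>")
  case True
  then obtain u where u: "u \<in> \<Theta>" "k = lacunary d u" by auto
  then have "lacunary d u = lacunary d s \<longleftrightarrow> u = s"
    using inj_onD[OF lacunary_inj] s \<Theta> by blast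
  then show ?thesis using u s \<Theta> k True by (auto simp: A_symbol_lacunary fourier_coeff_F)
next
  case False
  then show ?thesis using k by (auto simp: fourier_coeff_F)
qed

text \<open>The symbol selects at most one exponential of \<open>F\<close>, and a multiple of an
  exponential has constant modulus; hence the same value for every exponent.\<close>

lemma Lp_norm_A_block_F:
  assumes "1 \<le> p" "s \<in> block_indices d"
  shows "Lp_norm d p (A_block d s F) = (if s \<in> \<Theta> then ennreal \<alpha> else 0)"
proof (cases "s \<in> \<Theta>")
  case True
  have "A_block d s F = (\<lambda>x. of_real \<alpha> * character d (lacunary d s) x)"
    unfolding A_block_eq[OF assms(2) integrable_F]
  proof (rule tpoly_single[OF finite_wide_block lacunary_wide_block[OF assms(2)]])
    fix k assume "k \<in> wide_block d s"
    then have "k \<in> {1..d} \<rightarrow>\<^sub>E UNIV" using wide_block_extensional by blast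
    with True A_symbol_F[OF assms(2) this]
    show "of_real (A_symbol d s k) * fourier_coeff d F k = (if k = lacunary d s then of_real \<alpha> else 0)" by simp
  qed
  then show ?thesis using True assms(1) \<alpha> by (simp add: Lp_norm_character)
next
  case False
  have "A_block d s F = (\<lambda>x. 0)"
    unfolding A_block_eq[OF assms(2) integrable_F]
  proof (rule tpoly_zero)
    fix k assume "k \<in> wide_block d s"
    then have "k \<in> {1..d} \<rightarrow>\<^sub>E UNIV" using wide_block_extensional by blast
    with False A_symbol_F[OF assms(2) this]
    show "of_real (A_symbol d s k) * fourier_coeff d F k = 0" by simp
  qed
  then show ?thesis using False assms(1) by simp
qed

text \<open>Sharp blocks see the same exponentials with the index raised by one in every coordinate.
  Injectivity of that shift leaves one exponential per block.\<close>

lemma Lp_norm_delta_block_F: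
  assumes "1 \<le> p" "s \<in> block_indices d"
  shows "Lp_norm d p (delta_block d s F) = (if s \<in> (\<lambda>u. bump d u {1..d}) ` \<Theta> then ennreal \<alpha> else 0)"
proof -
  have hit: "s = bump d u {1..d}" if "u \<in> \<Theta>" "lacunary d u \<in> rho d s" for u
    using rho_disjoint[OF assms(2) bump_block_indices that(2) lacunary_rho] that(1) \<Theta> by blast
  show ?thesis
  proof (cases "s \<in> (\<lambda>u. bump d u {1..d}) ` \<Theta>")
    case True
    then obtain u where u: "u \<in> \<Theta>" "s = bump d u {1..d}" by auto
    have "delta_block d s F = (\<lambda>x. of_real \<alpha> * character d (lacunary d u) x)"
      unfolding delta_block_eq
    proof (rule tpoly_single[OF finite_rho])
      show "lacunary d u \<in> rho d s" using u lacunary_rho by simp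
      fix k assume k: "k \<in> rho d s"
      have "k \<in> lacunary d ` \<Theta> \<longleftrightarrow> k = lacunary d u"
      proof
        assume "k \<in> lacunary d ` \<Theta>"
        then obtain v where v: "v \<in> \<Theta>" "k = lacunary d v" by auto
        then have "bump d v {1..d} = bump d u {1..d}" using hit[of v] k u by simp
        then have "v = u" using inj_onD[OF bump_inj_left] v u \<Theta> by blast
        then show "k = lacunary d u" using v by simp
      qed (use u in simp)
      moreover have "k \<in> {1..d} \<rightarrow>\<^sub>E UNIV" using k rho_extensional by blast
      ultimately show "fourier_coeff d F k = (if k = lacunary d u then of_real \<alpha> else 0)"
        by (simp add: fourier_coeff_F)
    qed
    then show ?thesis using True assms(1) \<alpha> by (simp add: Lp_norm_character)
  next
    case False
    have "delta_block d s F = (\<lambda>x. 0)"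
      unfolding delta_block_eq
    proof (rule tpoly_zero)
      fix k assume k: "k \<in> rho d s"
      then have "k \<in> {1..d} \<rightarrow>\<^sub>E UNIV" using rho_extensional by blast
      moreover have "k \<notin> lacunary d ` \<Theta>" using hit k False by auto
      ultimately show "fourier_coeff d F k = 0" by (simp add: fourier_coeff_F)
    qed
    then show ?thesis using False assms(1) by simp
  qed
qed

text \<open>Both bounds by \<open>L\<close> are assumed so that \<open>A\<close>-blocks and
  \<open>\<delta>\<close>-blocks are covered together. The factor \<open>2 powr (- L)\<close>
  cancels the smoothness weight, and the power of \<open>card \<Theta>\<close> makes each of the at
  most \<open>card \<Theta>\<close> terms at most \<open>1 / card \<Theta>\<close> when
  \<open>\<theta>\<close> is finite.\<close>

lemma besov_norm_F_le_1:
  assumes p: "1 \<le> p" and \<theta>: "1 \<le> \<theta>" and ne: "\<Theta> \<noteq> {}"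
    and L: "\<And>s. s \<in> \<Theta> \<Longrightarrow> dot d (\<lambda>j. real (s j)) r \<le> L"
      "\<And>s. s \<in> \<Theta> \<Longrightarrow> dot d (\<lambda>j. real (bump d s {1..d} j)) r \<le> L"
    and \<alpha>_eq: "\<alpha> = 2 powr (- L) * real (card \<Theta>) powr (- enn2real (1 / \<theta>))"
  shows "besov_norm d r p \<theta> F \<le> 1"
proof -
  define \<Theta>' where "\<Theta>' = (if 1 < p \<and> p < \<top> then (\<lambda>u. bump d u {1..d}) ` \<Theta> else \<Theta>)"
  have b: "Lp_norm d p (beta_block d p s F) = (if s \<in> \<Theta>' then ennreal \<alpha> else 0)" if "s \<in> block_indices d" for s
    using Lp_norm_A_block_F[OF p that] Lp_norm_delta_block_F[OF p that] by (auto simp: \<Theta>'_def beta_block_def)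
  have fin': "finite \<Theta>'" using fin by (simp add: \<Theta>'_def)
  have card': "card \<Theta>' \<le> card \<Theta>" using fin by (simp add: \<Theta>'_def card_image_le)
  have L': "dot d (\<lambda>j. real (s j)) r \<le> L" if "s \<in> \<Theta>'" for s
    using that L by (auto simp: \<Theta>'_def split: if_splits)
  have N: "real (card \<Theta>) > 0" using ne fin by (simp add: card_gt_0_iff)
  show ?thesis
  proof (cases "\<theta> = \<top>")
    case True
    have "ennreal (2 powr dot d (\<lambda>j. real (s j)) r) * Lp_norm d p (beta_block d p s F) \<le> 1"
      if s: "s \<in> block_indices d" for s
    proof (cases "s \<in> \<Theta>'")
      case in\<Theta>: True
      have "2 powr dot d (\<lambda>j. real (s j)) r * \<alpha> = 2 powr (dot d (\<lambda>j. real (s j)) r + - L)"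
        unfolding \<alpha>_eq powr_add using True N by simp
      also have "\<dots> \<le> 2 powr 0" using L'[OF in\<Theta>] by (intro powr_mono) auto
      finally show ?thesis using b[OF s] in\<Theta> \<alpha> by (simp flip: ennreal_mult)
    qed (simp add: b[OF s])
    then show ?thesis using True by (auto simp: besov_norm_def intro!: SUP_least)
  next
    case False
    then have \<theta>f: "\<theta> < \<top>" by (simp add: less_top)
    let ?\<theta> = "enn2real \<theta>"
    have \<theta>1: "1 \<le> ?\<theta>" by (rule enn2real_ge_1[OF \<theta> \<theta>f])
    let ?t = "\<lambda>s. ennreal (2 powr (dot d (\<lambda>j. real (s j)) r * ?\<theta>)) * epow (Lp_norm d p (beta_block d p s F)) ?\<theta>"
    have \<alpha>\<theta>: "\<alpha> powr ?\<theta> = 2 powr (- L * ?\<theta>) / real (card \<Theta>)"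
    proof -
      have "\<alpha> powr ?\<theta> = 2 powr (- L * ?\<theta>) * real (card \<Theta>) powr (- (1 / ?\<theta>) * ?\<theta>)"
        unfolding \<alpha>_eq enn2real_one_divide[OF \<theta> \<theta>f] by (simp only: powr_mult powr_powr powr_ge_zero)
      moreover have "- (1 / ?\<theta>) * ?\<theta> = - 1" using \<theta>1 by simp
      ultimately show ?thesis using N by (simp add: powr_minus_divide)
    qed
    have t: "?t s \<le> (if s \<in> \<Theta>' then ennreal (1 / real (card \<Theta>)) else 0)" if s: "s \<in> block_indices d" for s
    proof (cases "s \<in> \<Theta>'")
      case True
      have "2 powr (dot d (\<lambda>j. real (s j)) r * ?\<theta>) * \<alpha> powr ?\<theta>
         = 2 powr (dot d (\<lambda>j. real (s j)) r * ?\<theta> + - L * ?\<theta>) / real (card \<Theta>)"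
        unfolding \<alpha>\<theta> powr_add by simp
      also have "\<dots> \<le> 2 powr 0 / real (card \<Theta>)"
        using mult_right_mono[OF L'[OF True], of ?\<theta>] \<theta>1 by (intro divide_right_mono powr_mono) auto
      finally show ?thesis using True b[OF s] \<alpha>
        by (simp add: epow_ennreal ennreal_leI flip: ennreal_mult)
    next
      case False
      then show ?thesis using b[OF s] \<theta>1 by (simp add: epow_def)
    qed
    have "infsum ?t (block_indices d) \<le> 1"
      unfolding infsum_ennreal_le_iff
    proof (intro allI impI, elim conjE)
      fix G assume G: "finite G" "G \<subseteq> block_indices d"
      have "(\<Sum>s\<in>G. ?t s) \<le> (\<Sum>s\<in>G. if s \<in> \<Theta>' then ennreal (1 / real (card \<Theta>)) else 0)"
        using G by (intro sum_mono t) auto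
      also have "\<dots> = (\<Sum>s\<in>{s\<in>G. s \<in> \<Theta>'}. ennreal (1 / real (card \<Theta>)))"
        using G(1) by (rule sum.inter_filter[symmetric])
      also have "\<dots> = of_nat (card {s\<in>G. s \<in> \<Theta>'}) * ennreal (1 / real (card \<Theta>))" by simp
      also have "\<dots> \<le> of_nat (card \<Theta>) * ennreal (1 / real (card \<Theta>))"
      proof (intro mult_right_mono of_nat_mono)
        have "card {s\<in>G. s \<in> \<Theta>'} \<le> card \<Theta>'" using fin' by (intro card_mono) auto
        then show "card {s\<in>G. s \<in> \<Theta>'} \<le> card \<Theta>" using card' by simp
      qed simp
      also have "\<dots> = 1" using N by (simp add: ennreal_of_nat_eq_real_of_nat flip: ennreal_mult)
      finally show "(\<Sum>s\<in>G. ?t s) \<le> 1" .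
    qed
    then have "epow (infsum ?t (block_indices d)) (1 / ?\<theta>) \<le> epow 1 (1 / ?\<theta>)"
      using \<theta>1 by (intro epow_mono) auto
    also have "epow 1 (1 / ?\<theta>) = 1" using epow_ennreal[of 1 "1 / ?\<theta>"] by simp
    finally show ?thesis using False by (simp add: besov_norm_def)
  qed
qed

text \<open>Bumping only increases the product with \<open>\<beta>\<close>, so the whole wide block
  of each \<open>s\<close> in \<open>\<Theta>\<close> avoids the cross. The blocks of
  \<open>F - t\<close> over \<open>\<Theta>\<close> are therefore those of \<open>F\<close>, and
  each contributes \<open>\<alpha>\<close>.\<close>

lemma best_approx_F:
  assumes q: "1 \<le> q" and F: "F \<in> B" and \<beta>: "\<And>j. j \<in> {1..d} \<Longrightarrow> 1 \<le> \<beta> j"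
    and far: "\<And>s. s \<in> \<Theta> \<Longrightarrow> real n \<le> dot d (\<lambda>j. real (s j)) \<beta>"
  shows "ennreal (real (card \<Theta>) * \<alpha>) \<le> best_approx d (Bq1_norm d q) (hyp_cross d \<beta> n) B"
proof -
  let ?Q = "hyp_cross d \<beta> n"
  have finQ: "finite ?Q" using \<beta> by (rule finite_hyp_cross)
  have "ennreal (real (card \<Theta>) * \<alpha>) \<le> Bq1_norm d q (\<lambda>x. F x - t x)" if "t \<in> trig_polys d ?Q" for t
  proof -
    obtain c where "t = (\<lambda>x. \<Sum>k\<in>?Q. c k * character d k x)"
      using \<open>t \<in> trig_polys d ?Q\<close> unfolding trig_polys_def by blast
    then have t: "t = tpoly d ?Q c" by (simp add: tpoly_def fun_eq_iff)
    let ?h = "\<lambda>x. F x - t x"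
    have int: "integrable (torus d) ?h"
      unfolding t by (intro Bochner_Integration.integrable_diff integrable_F integrable_tpoly)
    have A: "Lp_norm d q (A_block d s ?h) = ennreal \<alpha>" if s: "s \<in> \<Theta>" for s
    proof -
      have sb: "s \<in> block_indices d" using s \<Theta> by auto
      have notQ: "k \<notin> ?Q" if k: "k \<in> wide_block d s" for k
      proof -
        obtain e where e: "k \<in> rho d (bump d s e)" using k wide_block_eq[OF sb] by auto
        have "dot d (\<lambda>j. real (s j)) \<beta> \<le> dot d (\<lambda>j. real (bump d s e j)) \<beta>"
          using \<beta> by (intro dot_mono) (force simp: bump_def)+
        then show ?thesis using far[OF s] hyp_cross_iff[OF bump_block_indices[OF sb] e, of \<beta> n] by simp
      qed
      have "A_block d s ?h = A_block d s F"
        unfolding A_block_eq[OF sb int] A_block_eq[OF sb integrable_F]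
      proof (rule ext, unfold tpoly_def, rule sum.cong[OF refl])
        fix x k assume k: "k \<in> wide_block d s"
        then have ke: "k \<in> {1..d} \<rightarrow>\<^sub>E UNIV" using wide_block_extensional by blast
        have "fourier_coeff d t k = 0"
          unfolding t using notQ[OF k] fourier_coeff_tpoly[OF finQ hyp_cross_extensional ke] by simp
        then have "fourier_coeff d ?h k = fourier_coeff d F k"
          by (subst fourier_coeff_diff) (auto simp: t integrable_F integrable_tpoly)
        then show "of_real (A_symbol d s k) * fourier_coeff d ?h k * character d k x
          = of_real (A_symbol d s k) * fourier_coeff d F k * character d k x" by simp
      qed
      then show ?thesis using Lp_norm_A_block_F[OF q sb] s by simp
    qed
    show ?thesis
    proof (cases "?h \<in> Lp0 d q")
      case True
      have "(\<Sum>s\<in>\<Theta>. Lp_norm d q (A_block d s ?h)) = ennreal (real (card \<Theta>) * \<alpha>)"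
        using A \<alpha> by (simp add: ennreal_mult' ennreal_of_nat_eq_real_of_nat ennreal_mult)
      moreover have "(\<Sum>s\<in>\<Theta>. Lp_norm d q (A_block d s ?h)) \<le> (\<Sum>\<^sub>\<infinity>s\<in>block_indices d. Lp_norm d q (A_block d s ?h))"
        using infsum_ennreal_le_iff[of "\<lambda>s. Lp_norm d q (A_block d s ?h)" "block_indices d"] fin \<Theta> by blast
      ultimately show ?thesis using True by (simp add: Bq1_norm_def)
    qed (simp add: Bq1_norm_def)
  qed
  then have "ennreal (real (card \<Theta>) * \<alpha>) \<le> (INF t\<in>trig_polys d ?Q. Bq1_norm d q (\<lambda>x. F x - t x))"
    by (rule INF_greatest)
  also have "\<dots> \<le> best_approx d (Bq1_norm d q) ?Q B"
    unfolding best_approx_def using F by (rule SUP_upper)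
  finally show ?thesis .
qed

end

context cross_params
begin

text \<open>Coordinates 2 to \<open>\<nu>\<close> are chosen freely in a range proportional to
  \<open>n\<close>, the first balances the sum to \<open>n + \<nu>\<close>, and the remaining ones
  take their least value 1. As \<open>r\<close> is constant on the first \<open>\<nu>\<close>
  coordinates, \<open>(s,r)\<close> is the same for all these indices.\<close>

lemma hyperplane_indices:
  obtains \<Theta> where "finite \<Theta>" "\<Theta> \<subseteq> block_indices d" "\<Theta> \<noteq> {}" "(real n / real \<nu>) ^ (\<nu> - 1) \<le> real (card \<Theta>)"
    "\<And>s. s \<in> \<Theta> \<Longrightarrow> real n \<le> dot d (\<lambda>j. real (s j)) \<beta>"
    "\<And>s. s \<in> \<Theta> \<Longrightarrow> dot d (\<lambda>j. real (s j)) r = r 1 * real n + (r 1 * real \<nu> + (\<Sum>j=\<nu>+1..d. r j))"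
proof -
  \<comment> \<open>Large enough for \<open>K \<ge> n / \<nu>\<close>, small enough for
    \<open>(\<nu> - 1) * K < n + \<nu>\<close>, which keeps the first coordinate positive.\<close>
  define K where "K = n div \<nu> + 1"
  define H where "H = {2..\<nu>} \<rightarrow>\<^sub>E {1..K}"
  define \<sigma> where "\<sigma> = (\<lambda>g::nat \<Rightarrow> nat. \<lambda>j\<in>{1..d}. if j = 1 then n + \<nu> - (\<Sum>i=2..\<nu>. g i) else if j \<le> \<nu> then g j else 1)"
  have small: "(\<Sum>i=2..\<nu>. g i) < n + \<nu>" if g: "g \<in> H" for g
  proof -
    have "(\<Sum>i=2..\<nu>. g i) \<le> (\<Sum>i=2..\<nu>. K)" using g by (intro sum_mono) (auto simp: H_def PiE_iff)
    also have "\<dots> = (\<nu> - 1) * K" by simp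
    also have "\<dots> < n + \<nu>"
    proof -
      have "(\<nu> - 1) * (n div \<nu>) \<le> \<nu> * (n div \<nu>)" by (intro mult_right_mono) auto
      also have "\<dots> \<le> n" by simp
      finally show ?thesis using \<nu> by (simp add: K_def)
    qed
    finally show ?thesis .
  qed
  have inj: "inj_on \<sigma> H"
  proof (rule inj_onI)
    fix g g' assume g: "g \<in> H" "g' \<in> H" and eq: "\<sigma> g = \<sigma> g'"
    show "g = g'"
    proof (rule PiE_ext)
      show "g \<in> {2..\<nu>} \<rightarrow>\<^sub>E {1..K}" "g' \<in> {2..\<nu>} \<rightarrow>\<^sub>E {1..K}" using g by (auto simp: H_def)
      fix j assume "j \<in> {2..\<nu>}"
      then show "g j = g' j" using fun_cong[OF eq, of j] \<nu> by (auto simp: \<sigma>_def split: if_splits)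
    qed
  qed
  have parts: "{1..d} = insert 1 ({2..\<nu>} \<union> {\<nu>+1..d})" using \<nu> by auto
  have split: "dot d (\<lambda>j. real (\<sigma> g j)) w = (real n + real \<nu> - (\<Sum>i=2..\<nu>. real (g i))) * w 1
      + ((\<Sum>i=2..\<nu>. real (g i) * w i) + (\<Sum>j=\<nu>+1..d. w j))" if g: "g \<in> H" for g w
  proof -
    have "dot d (\<lambda>j. real (\<sigma> g j)) w = real (\<sigma> g 1) * w 1 + ((\<Sum>i=2..\<nu>. real (\<sigma> g i) * w i) + (\<Sum>j=\<nu>+1..d. real (\<sigma> g j) * w j))"
      unfolding dot_def parts using \<nu> by (subst sum.insert) (auto simp: sum.union_disjoint)
    moreover have "real (\<sigma> g 1) = real n + real \<nu> - (\<Sum>i=2..\<nu>. real (g i))"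
      using small[OF g] \<nu> by (simp add: \<sigma>_def of_nat_diff)
    moreover have "(\<Sum>i=2..\<nu>. real (\<sigma> g i) * w i) = (\<Sum>i=2..\<nu>. real (g i) * w i)"
      using \<nu> by (intro sum.cong) (auto simp: \<sigma>_def)
    moreover have "(\<Sum>j=\<nu>+1..d. real (\<sigma> g j) * w j) = (\<Sum>j=\<nu>+1..d. w j)"
      using \<nu> by (intro sum.cong) (auto simp: \<sigma>_def)
    ultimately show ?thesis by simp
  qed
  have finH: "finite H" unfolding H_def by (rule finite_PiE) auto
  show thesis
  proof (rule that[of "\<sigma> ` H"])
    show "finite (\<sigma> ` H)" using finH by simp
    show "\<sigma> ` H \<subseteq> block_indices d"
    proof (rule image_subsetI)
      fix g assume g: "g \<in> H"
      have "\<sigma> g j \<ge> 1" if "j \<in> {1..d}" for j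
        using that small[OF g] g by (auto simp: \<sigma>_def H_def PiE_iff)
      then show "\<sigma> g \<in> block_indices d" by (auto simp: block_indices_def PiE_iff \<sigma>_def)
    qed
    have "(\<lambda>i\<in>{2..\<nu>}. 1) \<in> H" by (auto simp: H_def K_def)
    then show "\<sigma> ` H \<noteq> {}" by blast
    have "card (\<sigma> ` H) = K ^ (\<nu> - 1)"
      unfolding card_image[OF inj] by (simp add: H_def card_PiE)
    moreover have "real n / real \<nu> \<le> real K"
    proof -
      have "n \<le> \<nu> * K" using dividend_less_times_div[of \<nu> n] \<nu> by (simp add: K_def)
      then have "real n \<le> real \<nu> * real K" by (metis of_nat_le_iff of_nat_mult)
      then show ?thesis using \<nu> by (simp add: field_simps)
    qed
    ultimately show "(real n / real \<nu>) ^ (\<nu> - 1) \<le> real (card (\<sigma> ` H))"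
      by (simp add: power_mono)
    fix s assume "s \<in> \<sigma> ` H"
    then obtain g where g: "g \<in> H" "s = \<sigma> g" by auto
    have "(\<Sum>i=2..\<nu>. real (g i) * \<beta> i) = (\<Sum>i=2..\<nu>. real (g i))"
      using \<beta>_low by (intro sum.cong) auto
    moreover have "0 \<le> (\<Sum>j=\<nu>+1..d. \<beta> j)" using \<beta>_high by (intro sum_nonneg) force
    moreover have "\<beta> 1 = 1" using \<beta>_low[of 1] \<nu> by simp
    ultimately show "real n \<le> dot d (\<lambda>j. real (s j)) \<beta>"
      unfolding g(2) split[OF g(1)] by simp
    have "(\<Sum>i=2..\<nu>. real (g i) * r i) = (\<Sum>i=2..\<nu>. real (g i)) * r 1"
      unfolding sum_distrib_right
    proof (rule sum.cong[OF refl])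
      fix i assume "i \<in> {2..\<nu>}"
      then have "r i = r 1" by (intro r1(2)) auto
      then show "real (g i) * r i = real (g i) * r 1" by (rule arg_cong)
    qed
    then show "dot d (\<lambda>j. real (s j)) r = r 1 * real n + (r 1 * real \<nu> + (\<Sum>j=\<nu>+1..d. r j))"
      unfolding g(2) split[OF g(1)] by (simp add: algebra_simps)
  qed
qed

lemma lower_bound:
  assumes q: "1 \<le> q" and p: "1 \<le> p" and \<theta>: "1 \<le> \<theta>"
  obtains C where "C > 0" "\<And>n. 1 \<le> n \<Longrightarrow>
    ennreal (C * rate \<theta> n) \<le> best_approx d (Bq1_norm d q) (hyp_cross d \<beta> n) (besov_class d r p \<theta>)"
proof -
  define t where "t = enn2real (1 / \<theta>)"
  have t1: "t \<le> 1"
  proof -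
    show ?thesis
    proof (cases "\<theta> = \<top>")
      case False
      then have "\<theta> < \<top>" by (simp add: less_top)
      from enn2real_one_divide[OF \<theta> this] enn2real_ge_1[OF \<theta> this] show ?thesis
        by (simp add: t_def)
    qed (simp add: t_def)
  qed
  have rpos: "r j > 0" if "j \<in> {1..d}" for j
  proof -
    have "0 < r 1 * \<beta> j" using r1(1) \<beta>_ge_1[OF that] by simp
    moreover have "r 1 * \<beta> j \<le> r j"
      using that r1(2)[of j] \<beta>_low[of j] \<beta>_high[of j] by (cases "j \<le> \<nu>") auto
    ultimately show ?thesis by linarith
  qed
  define c0 where "c0 = r 1 * real \<nu> + (\<Sum>j=\<nu>+1..d. r j)"
  \<comment> \<open>The extra sum of the \<open>r j\<close> leaves room for raising every coordinate
    by one, as the sharp blocks of the extremal function require.\<close>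
  define c1 where "c1 = c0 + (\<Sum>j=1..d. r j)"
  define e where "e = (real \<nu> - 1) * (1 - t)"
  define C where "C = 2 powr (- c1) * (1 / real \<nu>) powr e"
  have "C > 0" using \<nu> by (simp add: C_def)
  moreover have "ennreal (C * rate \<theta> n) \<le> best_approx d (Bq1_norm d q) (hyp_cross d \<beta> n) (besov_class d r p \<theta>)"
    if n: "1 \<le> n" for n
  proof -
    obtain \<Theta> where idx: "finite \<Theta>" "\<Theta> \<subseteq> block_indices d" "\<Theta> \<noteq> {}"
      and card: "(real n / real \<nu>) ^ (\<nu> - 1) \<le> real (card \<Theta>)"
      and far: "\<And>s. s \<in> \<Theta> \<Longrightarrow> real n \<le> dot d (\<lambda>j. real (s j)) \<beta>"
      and dotr: "\<And>s. s \<in> \<Theta> \<Longrightarrow> dot d (\<lambda>j. real (s j)) r = r 1 * real n + c0"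
      unfolding c0_def by (rule hyperplane_indices) blast
    define L where "L = r 1 * real n + c1"
    define \<alpha> where "\<alpha> = 2 powr (- L) * real (card \<Theta>) powr (- t)"
    interpret lacunary_sum d \<Theta> \<alpha> by unfold_locales (auto simp: idx(1) \<alpha>_def intro: subsetD[OF idx(2)])
    have N: "real (card \<Theta>) > 0" using idx(1,3) by (simp add: card_gt_0_iff)
    have "besov_norm d r p \<theta> F \<le> 1"
    proof (rule besov_norm_F_le_1[OF p \<theta> idx(3), where L=L])
      fix s assume s: "s \<in> \<Theta>"
      have "0 \<le> (\<Sum>j=1..d. r j)" using rpos by (intro sum_nonneg) force
      then show "dot d (\<lambda>j. real (s j)) r \<le> L" using dotr[OF s] by (simp add: L_def c1_def)
      have "dot d (\<lambda>j. real (bump d s {1..d} j)) r = dot d (\<lambda>j. real (s j)) r + (\<Sum>j=1..d. r j)"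
        by (simp add: dot_def bump_def distrib_right sum.distrib add.commute)
      then show "dot d (\<lambda>j. real (bump d s {1..d} j)) r \<le> L" using dotr[OF s] by (simp add: L_def c1_def)
    qed (simp add: \<alpha>_def t_def)
    then have "F \<in> besov_class d r p \<theta>" using F_Lp0[OF p] by (simp add: besov_class_def)
    from best_approx_F[OF q this \<beta>_ge_1 far]
    have "ennreal (real (card \<Theta>) * \<alpha>) \<le> best_approx d (Bq1_norm d q) (hyp_cross d \<beta> n) (besov_class d r p \<theta>)" by simp
    moreover have "C * rate \<theta> n \<le> real (card \<Theta>) * \<alpha>"
    proof -
      have pw: "(real n / real \<nu>) ^ (\<nu> - 1) = (real n / real \<nu>) powr (real \<nu> - 1)"
        using n \<nu> by (subst powr_realpow[symmetric]) (auto simp: of_nat_diff)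
      have "C * rate \<theta> n = 2 powr (- c1) * 2 powr (- real n * r 1) * ((1 / real \<nu>) powr e * real n powr e)"
        by (simp add: C_def rate_def e_def t_def)
      also have "(1 / real \<nu>) powr e * real n powr e = (real n / real \<nu>) powr e"
        by (simp flip: powr_mult)
      also have "2 powr (- c1) * 2 powr (- real n * r 1) = 2 powr (- L)"
        unfolding powr_add[symmetric] by (rule arg_cong) (simp add: L_def)
      also have "(real n / real \<nu>) powr e = ((real n / real \<nu>) ^ (\<nu> - 1)) powr (1 - t)"
        unfolding pw e_def by (simp add: powr_powr)
      \<comment> \<open>The exponent \<open>1 - t\<close> is nonnegative, so the lower bound on the
        number of indices carries over to its power.\<close>
      also have "2 powr (- L) * \<dots> \<le> 2 powr (- L) * real (card \<Theta>) powr (1 - t)"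
        using card t1 by (intro mult_left_mono powr_mono2) auto
      also have "\<dots> = real (card \<Theta>) * \<alpha>"
        using N by (simp add: \<alpha>_def powr_diff powr_minus divide_inverse)
      finally show ?thesis .
    qed
    ultimately show ?thesis by (meson ennreal_leI order_trans)
  qed
  ultimately show thesis using that by blast
qed

end

lemma best_approx_le_fourier_approx: "best_approx d N Q B \<le> fourier_approx d N Q B"
  unfolding best_approx_def fourier_approx_def
proof (rule SUP_mono')
  fix f
  have "fourier_sum d Q f \<in> trig_polys d Q"
    unfolding trig_polys_def fourier_sum_def[abs_def] by blast
  then show "(INF t\<in>trig_polys d Q. N (\<lambda>x. f x - t x)) \<le> N (\<lambda>x. f x - fourier_sum d Q f x)"
    by (rule INF_lower)
qed

theorem theorem3p10:
  fixes d \<nu> :: nat and p q \<theta> :: ennreal and r \<gamma> \<gamma>' :: "nat \<Rightarrow> real"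
  assumes "d \<ge> 2"
    and "1 \<le> q" and "q < p" and "p \<le> \<top>"
    and "1 \<le> \<theta>" and "\<theta> \<le> \<top>"
    and "1 \<le> \<nu>" and "\<nu> \<le> d"
    and "0 < r 1"
    and "\<forall>j\<in>{1..\<nu>}. r j = r 1"
    and "\<forall>j\<in>{\<nu>+1..d}. r 1 < r j"
    and "\<forall>i\<in>{\<nu>+1..d}. \<forall>j\<in>{\<nu>+1..d}. i \<le> j \<longrightarrow> r i \<le> r j"
    and "\<forall>j\<in>{1..d}. \<gamma> j = r j / r 1"
    and "\<forall>j\<in>{1..\<nu>}. \<gamma>' j = \<gamma> j \<and> \<gamma> j = 1"
    and "\<forall>j\<in>{\<nu>+1..d}. 1 < \<gamma>' j \<and> \<gamma>' j < \<gamma> j"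
  shows "(\<lambda>n. fourier_approx d (Bq1_norm d q) (hyp_cross d \<gamma>' n) (besov_class d r p \<theta>))
           \<asymp> (\<lambda>n. best_approx d (Bq1_norm d q) (hyp_cross d \<gamma>' n) (besov_class d r p \<theta>))
       \<and> (\<lambda>n. best_approx d (Bq1_norm d q) (hyp_cross d \<gamma>' n) (besov_class d r p \<theta>))
           \<asymp> (\<lambda>n. ennreal (2 powr (- real n * r 1)
                   * real n powr ((real \<nu> - 1) * (1 - enn2real (1 / \<theta>)))))"
proof -
  interpret cross_params d \<nu> r \<gamma>'
  proof
    show "1 \<le> \<nu>" "\<nu> \<le> d" "0 < r 1" by fact+
    show "r j = r 1" if "j \<in> {1..\<nu>}" for j using bspec[OF assms(10) that] .
    show "\<gamma>' j = 1" if "j \<in> {1..\<nu>}" for j using bspec[OF assms(14) that] by simp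
    show "1 < \<gamma>' j \<and> r 1 * \<gamma>' j < r j" if j: "j \<in> {\<nu>+1..d}" for j
    proof -
      have "\<gamma> j = r j / r 1" using j by (intro bspec[OF assms(13)]) auto
      then show ?thesis using bspec[OF assms(15) j] assms(9) by (simp add: field_simps)
    qed
  qed
  let ?F = "\<lambda>n. fourier_approx d (Bq1_norm d q) (hyp_cross d \<gamma>' n) (besov_class d r p \<theta>)"
  let ?E = "\<lambda>n. best_approx d (Bq1_norm d q) (hyp_cross d \<gamma>' n) (besov_class d r p \<theta>)"
  have p: "1 \<le> p" using assms(2,3) by simp
  obtain U where U: "U > 0" "\<And>n. 1 \<le> n \<Longrightarrow> ?F n \<le> ennreal (U * rate \<theta> n)"
    by (rule upper_bound[OF assms(2,3,5)]) blast
  obtain L where L: "L > 0" "\<And>n. 1 \<le> n \<Longrightarrow> ennreal (L * rate \<theta> n) \<le> ?E n"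
    by (rule lower_bound[OF assms(2) p assms(5)]) blast
  have EF: "?E n \<le> ?F n" for n by (rule best_approx_le_fourier_approx)
  have cancel: "ennreal (1 / c) * x \<le> ennreal (rate \<theta> n)" if "x \<le> ennreal (c * rate \<theta> n)" "c > 0" for c x n
  proof -
    have "ennreal (1 / c) * x \<le> ennreal (1 / c) * ennreal (c * rate \<theta> n)"
      using that by (intro mult_left_mono) auto
    also have "\<dots> = ennreal (rate \<theta> n)" using that by (simp flip: ennreal_mult')
    finally show ?thesis .
  qed
  have FE: "ennreal (L / U) * ?F n \<le> ?E n" if n: "1 \<le> n" for n
  proof -
    have "ennreal (L / U) * ?F n = ennreal L * (ennreal (1 / U) * ?F n)"
      using L(1) U(1) by (simp add: mult.assoc[symmetric] flip: ennreal_mult)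
    also have "\<dots> \<le> ennreal L * ennreal (rate \<theta> n)"
      using cancel[OF U(2)[OF n] U(1)] by (intro mult_left_mono) auto
    also have "\<dots> = ennreal (L * rate \<theta> n)" using L(1) by (simp add: ennreal_mult')
    also have "\<dots> \<le> ?E n" by (rule L(2)[OF n])
    finally show ?thesis .
  qed
  \<comment> \<open>The constant 1 expresses that the Fourier sum is one admissible approximant;
    \<open>L / U\<close> comes from comparing both quantities with the rate.\<close>
  have "?F \<asymp> ?E"
    unfolding same_order_def
    by (rule exI[of _ "L / U"], rule exI[of _ 1]) (use FE EF L(1) U(1) in auto)
  moreover have "?E \<asymp> (\<lambda>n. ennreal (rate \<theta> n))"
    unfolding same_order_def
  proof (rule exI[of _ "1 / U"], rule exI[of _ "1 / L"], intro conjI allI impI)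
    fix n :: nat assume n: "1 \<le> n"
    show "ennreal (1 / U) * ?E n \<le> ennreal (rate \<theta> n)"
      using EF U(2)[OF n] by (intro cancel U(1)) (rule order_trans)
    have "ennreal (rate \<theta> n) = ennreal (1 / L) * ennreal (L * rate \<theta> n)"
      using L(1) by (simp flip: ennreal_mult')
    also have "\<dots> \<le> ennreal (1 / L) * ?E n" using L(2)[OF n] by (intro mult_left_mono) auto
    finally show "ennreal (rate \<theta> n) \<le> ennreal (1 / L) * ?E n" .
  qed (use L(1) U(1) in auto)
  ultimately show ?thesis unfolding rate_def by blast
qed

end
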